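(* Let $\Gamma$ be a group generated by a finite symmetric set $S$ such that $\mathcal{C}(\Gamma,S)$ has no loops and has polynomial growth rate $D\ge 3$, and let $T(\cdot,\cdot)$ be the activation times of the frog model on $\mathcal{C}(\Gamma,S)$. Then there exist $C>0$, $\kappa>0$ and $\alpha>1$ such that $$\mathbb{P}\big(T(e,x)\ge\alpha n\big)\le C\exp(-n^\kappa)$$ for all $x\in\Gamma$ and every $n\in\mathbb{N}$ with $n\ge\|x\|_1$.
   Context: Conventions: $\mathbb{N}=\{0,1,2,\dots\}$, $\mathbb{N}^*=\mathbb{N}\setminus\{0\}$; $e$ is the neutral element of $\Gamma$. Cayley graph. $S$ is symmetric if $s\in S$ implies $s^{-1}\in S$. $\mathcal{C}(\Gamma,S)$ is the undirected graph with vertex set $\Gamma$ and edge set $\{\{sx,x\}:s\in S,\,x\in\Gamma\}$; no loops means $e\notin S$. Let $d$ be its graph distance (each edge has length $1$), $\|x\|_1=d(e,x)$ and $B(x,r)=\{y\in\Gamma:d(x,y)\le r\}$. The graph has polynomial growth rate $D$ if there is $c>0$ with $\frac1c r^D\le|B(x,r)|\le c\,r^D$ for all $x\in\Gamma$, $r\in\mathbb{N}^*$. Frog model. For each $x\in\Gamma$ let $(S^x_n)_{n\in\mathbb{N}}$ be a simple random walk started at $x$: $S^x_0=x$ and $S^x_n=\xi^x_n\xi^x_{n-1}\cdots\xi^x_1x$, where all $\xi^x_i$ ($x\in\Gamma$, $i\in\mathbb{N}^*$) are independent and uniformly distributed on $S$, defined on a probability space with measure $\mathbb{P}$. Let $t(x,y)=\inf\{n\in\mathbb{N}:S^x_n=y\}\in\mathbb{N}\cup\{\infty\}$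 and $$T(x,y)=\inf\Big\{\sum_{i=1}^m t(x_{i-1},x_i): m\in\mathbb{N}^*,\ x_0=x,\,x_1,\dots,x_m=y \text{ in }\Gamma\Big\}.$$ *)

theory Defs
  imports "HOL-Probability.Probability" "HOL-Algebra.Generated_Groups" "HOL-Library.Extended_Nat"
begin

definition cayley_edges :: "('a, 'b) monoid_scheme \<Rightarrow> 'a set \<Rightarrow> 'a set set" where
  "cayley_edges G S = {{s \<otimes>\<^bsub>G\<^esub> x, x} | s x. s \<in> S \<and> x \<in> carrier G}"

text \<open>A walk of length \<open>k\<close> is the sequence of its \<open>k + 1\<close> vertices \<open>p 0, \<dots>, p k\<close>.\<close>

definition is_walk :: "'a set set \<Rightarrow> 'a \<Rightarrow> 'a \<Rightarrow> nat \<Rightarrow> (nat \<Rightarrow> 'a) \<Rightarrow> bool" where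
  "is_walk E x y k p \<longleftrightarrow> p 0 = x \<and> p k = y \<and> (\<forall>i<k. {p i, p (Suc i)} \<in> E)"

text \<open>The distance between two vertices not joined by a walk is \<open>\<infinity>\<close>, the infimum of the empty
  set of type \<^typ>\<open>enat\<close>.\<close>

definition graph_dist :: "'a set set \<Rightarrow> 'a \<Rightarrow> 'a \<Rightarrow> enat" where
  "graph_dist E x y = (INF k \<in> {k. \<exists>p. is_walk E x y k p}. enat k)"

abbreviation cayley_dist :: "('a, 'b) monoid_scheme \<Rightarrow> 'a set \<Rightarrow> 'a \<Rightarrow> 'a \<Rightarrow> enat" where
  "cayley_dist G S \<equiv> graph_dist (cayley_edges G S)"

definition cayley_norm :: "('a, 'b) monoid_scheme \<Rightarrow> 'a set \<Rightarrow> 'a \<Rightarrow> enat" where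
  "cayley_norm G S x = cayley_dist G S \<one>\<^bsub>G\<^esub> x"

definition cayley_ball :: "('a, 'b) monoid_scheme \<Rightarrow> 'a set \<Rightarrow> 'a \<Rightarrow> nat \<Rightarrow> 'a set" where
  "cayley_ball G S x r = {y \<in> carrier G. cayley_dist G S x y \<le> enat r}"

definition polynomial_growth_rate :: "('a, 'b) monoid_scheme \<Rightarrow> 'a set \<Rightarrow> real \<Rightarrow> bool" where
  "polynomial_growth_rate G S D \<longleftrightarrow>
     (\<exists>c>0. \<forall>x\<in>carrier G. \<forall>r\<ge>1.
        1 / c * real r powr D \<le> real (card (cayley_ball G S x r)) \<and>
        real (card (cayley_ball G S x r)) \<le> c * real r powr D)"

text \<open>The step variables \<open>\<xi> x i\<close> are indexed by \<open>x\<close> in the group and \<open>i \<ge> 1\<close>; \<open>\<xi> x 0\<close> is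
  unconstrained and never used.\<close>

definition frog_steps ::
    "('a, 'b) monoid_scheme \<Rightarrow> 'a set \<Rightarrow> 'w measure \<Rightarrow> ('a \<Rightarrow> nat \<Rightarrow> 'w \<Rightarrow> 'a) \<Rightarrow> bool" where
  "frog_steps G S M \<xi> \<longleftrightarrow>
     prob_space.indep_vars M (\<lambda>_. count_space (carrier G)) (\<lambda>(x, i). \<xi> x i) (carrier G \<times> {1..}) \<and>
     (\<forall>x\<in>carrier G. \<forall>i\<ge>1.
        distr M (count_space (carrier G)) (\<xi> x i) = uniform_measure (count_space (carrier G)) S)"

primrec frog_walk ::
    "('a, 'b) monoid_scheme \<Rightarrow> ('a \<Rightarrow> nat \<Rightarrow> 'w \<Rightarrow> 'a) \<Rightarrow> 'a \<Rightarrow> nat \<Rightarrow> 'w \<Rightarrow> 'a" where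
  "frog_walk G \<xi> x 0 \<omega> = x"
| "frog_walk G \<xi> x (Suc n) \<omega> = \<xi> x (Suc n) \<omega> \<otimes>\<^bsub>G\<^esub> frog_walk G \<xi> x n \<omega>"

definition hitting_time ::
    "('a, 'b) monoid_scheme \<Rightarrow> ('a \<Rightarrow> nat \<Rightarrow> 'w \<Rightarrow> 'a) \<Rightarrow> 'a \<Rightarrow> 'a \<Rightarrow> 'w \<Rightarrow> enat" where
  "hitting_time G \<xi> x y \<omega> = (INF n \<in> {n. frog_walk G \<xi> x n \<omega> = y}. enat n)"

definition activation_time ::
    "('a, 'b) monoid_scheme \<Rightarrow> ('a \<Rightarrow> nat \<Rightarrow> 'w \<Rightarrow> 'a) \<Rightarrow> 'a \<Rightarrow> 'a \<Rightarrow> 'w \<Rightarrow> enat" where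
  "activation_time G \<xi> x y \<omega> =
     Inf {(\<Sum>i=1..m. hitting_time G \<xi> (p (i - 1)) (p i) \<omega>) | (m::nat) p.
            1 \<le> m \<and> p 0 = x \<and> p m = y \<and> (\<forall>i\<le>m. p i \<in> carrier G)}"

end

theory Submission
  imports Defs "HOL-Real_Asymp.Real_Asymp"
begin

text \<open>
  Let \<open>x\<^sub>0, \<dots>, x\<^sub>m\<close> be a geodesic from the neutral element to \<open>x\<close>. The activation time of \<open>x\<close> is
  at most the sum of the activation times of \<open>x\<^sub>i\<^sub>+\<^sub>1\<close> from \<open>x\<^sub>i\<close>, so it suffices that the time
  needed to wake a neighbour has a stretched exponential tail (\<open>neighbour_tail\<close>). Cap these times at
  \<open>L\<close>, about the cube root of \<open>n\<close>, and let the \<open>i\<close>-th of them use only the frogs of the ball of radius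
  \<open>L\<close> around \<open>x\<^sub>i\<close>. Because the path is a geodesic, the balls of indices in one residue class
  modulo \<open>2 L + 1\<close> are disjoint, and a Chernoff bound in each class controls the sum
  (\<open>chernoff_geodesic\<close>).

  To wake a neighbour within a time of order \<open>K\<close>, let the woken frogs walk for \<open>\<tau>\<close> steps, where \<open>\<tau>\<close> is
  slightly smaller than \<open>K\<close>, let the frogs on the newly visited sites do the same, and repeat this
  \<open>J\<close> times, \<open>J\<close> being the integer part of \<open>D / 2\<close>. The expected number of visits to a
  given site in one of these generations is an iterate of the truncated Green function, and for at most \<open>D / 2\<close>
  iterations this is smaller than every positive power of \<open>K\<close> (\<open>green_iter_upper\<close>). Khasminskii's
  inequality turns the bound on the expectation into an exponential tail (\<open>khasminskii\<close>,
  \<open>sum_functional_tail\<close>). Hence no site is visited often, each generation multiplies the number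
  of frogs by nearly \<open>\<tau>\<close>, and the last one has nearly \<open>K ^ J\<close> frogs, all within distance nearly
  \<open>sqrt K\<close>. Each of them hits the target within \<open>K\<close> steps with probability at least about
  \<open>K powr (1 - D / 2)\<close>. Since \<open>J + 1 > D / 2\<close>, the expected number of successful frogs is a positive power
  of \<open>K\<close>, and these frogs are independent (\<open>generations\<close>, \<open>one_step_tail\<close>).

  The estimates on the transition probabilities \<open>q\<close> lose an arbitrarily small power of the time
  and follow from the volume growth in an elementary way. Both the upper bound and the lower bound
  near the diagonal come from one inequality (\<open>psi_word\<close>): \<open>q (2 n) \<one> - q (2 n) g\<close> is half a squared
  distance in \<open>\<ell>\<^sup>2\<close>, so it grows at most quadratically in the length of an even word for \<open>g\<close>, with a factor
  proportional to \<open>q (2 n) \<one> - q (2 n + 2) \<one>\<close>. The lower bound on \<open>q (2 n) \<one>\<close> itself comes from the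
  Carne--Varopoulos bound on the displacement (\<open>q_carne_varopoulos\<close>).

  The estimates on the frogs are proved for finitely many walks of finite length, given as lists of steps with
  the uniform distribution. The event of the theorem is compared with this finite model at the very end
  (\<open>transfer_bound\<close>).
\<close>

section \<open>Elementary inequalities\<close>

lemma square_add_weighted:
  fixes u v m :: real
  assumes "m > 0"
  shows "(u + v)\<^sup>2 \<le> (1 + 1 / m) * u\<^sup>2 + (1 + m) * v\<^sup>2"
proof -
  have "0 \<le> (u - m * v)\<^sup>2 / m" using assms by simp
  also have "\<dots> = (1 + 1 / m) * u\<^sup>2 + (1 + m) * v\<^sup>2 - (u + v)\<^sup>2"
    using assms by (simp add: field_simps power2_eq_square)
  finally show ?thesis by simp
qed

lemma cosh_le_exp_square:
  fixes x :: real
  assumes "0 \<le> x" "x \<le> 1"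
  shows "cosh x \<le> exp (x\<^sup>2)"
proof -
  have "exp x \<le> 1 + x + x\<^sup>2" using assms by (rule exp_bound)
  moreover have "exp (- x) \<le> 1 - x + x\<^sup>2"
  proof -
    have "1 \<le> (1 - x + x\<^sup>2) * (1 + x)"
      using assms by (simp add: algebra_simps power2_eq_square)
    also have "\<dots> \<le> (1 - x + x\<^sup>2) * exp x"
    proof (rule mult_left_mono)
      show "1 + x \<le> exp x" by (rule exp_ge_add_one_self)
      show "0 \<le> 1 - x + x\<^sup>2" using assms by simp
    qed
    finally show ?thesis by (simp add: exp_minus field_simps)
  qed
  ultimately have "cosh x \<le> 1 + x\<^sup>2" by (simp add: cosh_field_def)
  also have "\<dots> \<le> exp (x\<^sup>2)" by (rule exp_ge_add_one_self)
  finally show ?thesis .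
qed

text \<open>The induction step of Khasminskii's inequality, with \<open>t = \<theta> f x\<close> and \<open>w\<close> the bound on the Green function.\<close>

lemma exp_weight_le:
  fixes t w :: real
  assumes "0 \<le> t" "0 \<le> w" "w \<le> 1"
  shows "exp t * (1 + (w - 2 * t)) \<le> 1 + w"
proof -
  have "1 + (w - 2 * t) \<le> (1 + w) * (1 - t)"
    using mult_right_mono[of w 1 t] assms by (simp add: algebra_simps)
  also have "\<dots> \<le> (1 + w) * exp (- t)"
    using assms exp_ge_add_one_self[of "- t"] by (intro mult_left_mono) auto
  finally have "exp t * (1 + (w - 2 * t)) \<le> exp t * ((1 + w) * exp (- t))"
    by (rule mult_left_mono) simp
  also have "\<dots> = 1 + w" by (simp add: exp_minus)
  finally show ?thesis .
qed

lemma sum_set_le_sum_list: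
  assumes "\<And>z. z \<in> set l \<Longrightarrow> (0 :: real) \<le> f z"
  shows "sum f (set l) \<le> sum_list (map f l)"
  using assms
proof (induction l)
  case (Cons u l)
  then show ?case by (cases "u \<in> set l") (auto simp: insert_absorb add_increasing)
qed simp

lemma sum_UN_le:
  assumes "finite A" "\<And>a. a \<in> A \<Longrightarrow> finite (B a)" "\<And>a z. a \<in> A \<Longrightarrow> z \<in> B a \<Longrightarrow> (0 :: real) \<le> f z"
  shows "sum f (\<Union>a\<in>A. B a) \<le> (\<Sum>a\<in>A. sum f (B a))"
  using assms
proof (induction A rule: finite_induct)
  case (insert a A)
  have "sum f (\<Union>a\<in>insert a A. B a) \<le> sum f (B a) + sum f (\<Union>a\<in>A. B a)"
  proof -
    have "sum f (B a \<union> (\<Union>a\<in>A. B a)) + sum f (B a \<inter> (\<Union>a\<in>A. B a)) = sum f (B a) + sum f (\<Union>a\<in>A. B a)"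
      using insert.prems(1) insert.hyps(1) by (intro sum.union_inter) auto
    moreover have "0 \<le> sum f (B a \<inter> (\<Union>a\<in>A. B a))"
      by (intro sum_nonneg insert.prems(2)[of a]) auto
    ultimately show ?thesis by simp
  qed
  then show ?case using insert by force
qed simp

text \<open>The pairs \<open>(i, m)\<close> with \<open>i + m = l\<close> have different \<open>m \<le> l\<close>, so there are at most \<open>l + 1\<close> of them.\<close>

lemma sum_diagonals_le:
  fixes h :: "nat \<Rightarrow> real"
  assumes "\<And>l. 0 \<le> h l"
  shows "(\<Sum>i\<le>\<tau>. \<Sum>m\<le>N. (real m + 1) ^ j * h (i + m)) \<le> (\<Sum>l\<le>\<tau> + N. (real l + 1) ^ Suc j * h l)"
proof -
  have "(\<Sum>i\<le>\<tau>. \<Sum>m\<le>N. (real m + 1) ^ j * h (i + m))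
    = (\<Sum>(i, m)\<in>{..\<tau>} \<times> {..N}. (real m + 1) ^ j * h (i + m))"
    by (rule sum.cartesian_product)
  also have "\<dots> = (\<Sum>l\<le>\<tau> + N. \<Sum>(i, m)\<in>{p \<in> {..\<tau>} \<times> {..N}. fst p + snd p = l}. (real m + 1) ^ j * h (i + m))"
    by (rule sum.group[symmetric, where g = "\<lambda>p. fst p + snd p"]) auto
  also have "\<dots> \<le> (\<Sum>l\<le>\<tau> + N. \<Sum>m\<le>l. (real l + 1) ^ j * h l)"
  proof (rule sum_mono)
    fix l
    have inj: "inj_on snd {p \<in> {..\<tau>} \<times> {..N}. fst p + snd p = l}" by (auto simp: inj_on_def)
    have "(\<Sum>(i, m)\<in>{p \<in> {..\<tau>} \<times> {..N}. fst p + snd p = l}. (real m + 1) ^ j * h (i + m))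
      \<le> (\<Sum>p\<in>{p \<in> {..\<tau>} \<times> {..N}. fst p + snd p = l}. (real l + 1) ^ j * h l)"
      using assms by (intro sum_mono) (auto intro!: mult_right_mono power_mono)
    also have "\<dots> = (\<Sum>m\<in>snd ` {p \<in> {..\<tau>} \<times> {..N}. fst p + snd p = l}. (real l + 1) ^ j * h l)"
      by (subst sum.reindex[OF inj]) simp
    also have "\<dots> \<le> (\<Sum>m\<le>l. (real l + 1) ^ j * h l)"
      using assms by (intro sum_mono2) auto
    finally show "(\<Sum>(i, m)\<in>{p \<in> {..\<tau>} \<times> {..N}. fst p + snd p = l}. (real m + 1) ^ j * h (i + m))
      \<le> (\<Sum>m\<le>l. (real l + 1) ^ j * h l)" .
  qed
  also have "\<dots> = (\<Sum>l\<le>\<tau> + N. (real l + 1) ^ Suc j * h l)" by (intro sum.cong) (auto simp: algebra_simps)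
  finally show ?thesis .
qed

lemma sum_pairs:
  fixes f :: "nat \<Rightarrow> real"
  shows "(\<Sum>n = 0..<k. f (2 * n) + f (2 * n + 1)) = (\<Sum>i<2 * k. f i)"
  by (induction k) auto

lemma card_residue_class: "card {i. i < m \<and> i mod p = r} \<le> m div p + 1"
proof -
  have "inj_on (\<lambda>i. i div p) {i. i < m \<and> i mod p = r}"
    by (rule inj_onI) (metis (mono_tags, lifting) mem_Collect_eq div_mult_mod_eq)
  moreover have "(\<lambda>i. i div p) ` {i. i < m \<and> i mod p = r} \<subseteq> {..m div p}"
    by (auto intro: div_le_mono)
  ultimately have "card {i. i < m \<and> i mod p = r} \<le> card {..m div p}"
    by (intro card_inj_on_le) auto
  then show ?thesis by simp
qed

text \<open>Constants and small powers of \<open>K\<close> are absorbed by this domination throughout.\<close>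

lemma eventually_powr_le:
  fixes C \<alpha> \<beta> :: real
  assumes "\<alpha> < \<beta>"
  shows "\<forall>\<^sub>F K::nat in sequentially. C * real K powr \<alpha> \<le> real K powr \<beta>"
proof -
  have "filterlim (\<lambda>K::nat. real K powr (\<beta> - \<alpha>)) at_top sequentially"
    using assms by real_asymp
  then have "\<forall>\<^sub>F K::nat in sequentially. C \<le> real K powr (\<beta> - \<alpha>)"
    by (simp add: filterlim_at_top)
  then show ?thesis
  proof (rule eventually_mono)
    fix K :: nat assume "C \<le> real K powr (\<beta> - \<alpha>)"
    then have "C * real K powr \<alpha> \<le> real K powr (\<beta> - \<alpha>) * real K powr \<alpha>" by (intro mult_right_mono) auto
    then show "C * real K powr \<alpha> \<le> real K powr \<beta>" by (simp add: powr_add[symmetric])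
  qed
qed

lemma eventually_poly_exp_le:
  fixes C p b \<alpha> \<beta> :: real
  assumes "0 < b" "0 < \<alpha>" "\<alpha> < \<beta>"
  shows "\<forall>\<^sub>F K::nat in sequentially. C * real K powr p * exp (- (b * real K powr \<beta>)) \<le> exp (- (real K powr \<alpha>))"
proof -
  have "\<forall>\<^sub>F K::nat in sequentially. (\<bar>p\<bar> / \<alpha> + \<bar>C\<bar> + 1) / b * real K powr \<alpha> \<le> real K powr \<beta>"
    by (rule eventually_powr_le[OF assms(3)])
  then show ?thesis using eventually_ge_at_top[of 1]
  proof eventually_elim
    case (elim K)
    have K1: "1 \<le> real K powr \<alpha>" using elim(2) assms(2) by (simp add: ge_one_powr_ge_zero)
    have "ln (real K) \<le> real K powr \<alpha> / \<alpha>" using ln_powr_bound[of "real K" \<alpha>] elim(2) assms(2) by simp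
    then have l: "\<bar>p\<bar> * ln (real K) \<le> \<bar>p\<bar> * (real K powr \<alpha> / \<alpha>)" by (intro mult_left_mono) auto
    have pl: "p * ln (real K) \<le> \<bar>p\<bar> * ln (real K)" using elim(2) by (intro mult_right_mono) auto
    have C1: "\<bar>C\<bar> * 1 \<le> \<bar>C\<bar> * real K powr \<alpha>" using K1 by (intro mult_left_mono) auto
    have "(\<bar>p\<bar> / \<alpha> + \<bar>C\<bar> + 1) * real K powr \<alpha> \<le> b * real K powr \<beta>"
      using elim(1) assms(1) by (simp add: field_simps)
    then have "\<bar>C\<bar> + p * ln (real K) - b * real K powr \<beta> \<le> - (real K powr \<alpha>)"
      using l pl C1 by (simp add: algebra_simps)
    then have e: "exp (\<bar>C\<bar> + p * ln (real K) - b * real K powr \<beta>) \<le> exp (- (real K powr \<alpha>))" by simp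
    have "C \<le> exp \<bar>C\<bar>" using exp_ge_add_one_self[of "\<bar>C\<bar>"] by linarith
    then have "C * real K powr p * exp (- (b * real K powr \<beta>)) \<le> exp \<bar>C\<bar> * real K powr p * exp (- (b * real K powr \<beta>))"
      by (intro mult_right_mono) auto
    also have "\<dots> = exp (\<bar>C\<bar> + p * ln (real K) - b * real K powr \<beta>)"
      using elim(2) by (simp add: powr_def exp_add exp_diff exp_minus field_simps)
    finally show ?case using e by linarith
  qed
qed

lemma exp_le_powr:
  fixes b p \<beta> :: real
  assumes "0 < b" "0 < \<beta>"
  shows "\<exists>C>0. \<forall>n::nat\<ge>1. exp (- (b * real n powr \<beta>)) \<le> C * real n powr p"
proof -
  have "\<forall>\<^sub>F K::nat in sequentially. 1 * real K powr (-p) * exp (- (b * real K powr \<beta>)) \<le> exp (- (real K powr (\<beta> / 2)))"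
    using assms by (intro eventually_poly_exp_le) auto
  then obtain N :: nat where N: "\<And>K. K \<ge> N \<Longrightarrow> real K powr (-p) * exp (- (b * real K powr \<beta>)) \<le> exp (- (real K powr (\<beta> / 2)))"
    by (auto simp: eventually_sequentially)
  define F where "F n = real n powr (-p) * exp (- (b * real n powr \<beta>))" for n :: nat
  define C where "C = 1 + (\<Sum>n<N. F n)"
  have F0: "0 \<le> F n" for n by (simp add: F_def)
  have "F n \<le> C" for n
  proof (cases "n < N")
    case True
    then have "F n \<le> (\<Sum>n<N. F n)" using F0 by (intro member_le_sum) auto
    then show ?thesis by (simp add: C_def)
  next
    case False
    then have "F n \<le> exp (- (real n powr (\<beta> / 2)))" using N[of n] by (simp add: F_def)
    also have "\<dots> \<le> 1" by simp
    also have "\<dots> \<le> C" using sum_nonneg[of "{..<N}" F] F0 by (simp add: C_def)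
    finally show ?thesis .
  qed
  then have "exp (- (b * real n powr \<beta>)) \<le> C * real n powr p" if "n \<ge> 1" for n :: nat
    using that by (simp add: F_def powr_minus divide_simps mult.commute)
  moreover have "0 < C" using sum_nonneg[of "{..<N}" F] F0 by (simp add: C_def add_pos_nonneg)
  ultimately show ?thesis by blast
qed

lemma powr_diff_ge:
  fixes \<delta> :: real
  assumes "0 < \<delta>" "\<delta> \<le> 1"
  shows "\<delta> * (real m + 1) powr (\<delta> - 1) \<le> (real m + 1) powr \<delta> - real m powr \<delta>"
proof (cases "m = 0")
  case False
  have "\<exists>z::real. real m < z \<and> z < real m + 1 \<and>
      (real m + 1) powr \<delta> - real m powr \<delta> = (real m + 1 - real m) * (\<delta> * z powr (\<delta> - 1))"
    using False by (intro MVT2) (auto intro!: derivative_eq_intros)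
  then obtain z where z: "real m < z" "z < real m + 1"
    "(real m + 1) powr \<delta> - real m powr \<delta> = \<delta> * z powr (\<delta> - 1)" by auto
  have "(real m + 1) powr (\<delta> - 1) \<le> z powr (\<delta> - 1)"
    using z(1,2) False assms by (intro powr_mono2') auto
  then show ?thesis unfolding z(3) using assms by (intro mult_left_mono) auto
qed (use assms in simp)

lemma sum_powr_le:
  fixes \<delta> :: real
  assumes "0 < \<delta>" "\<delta> \<le> 1"
  shows "(\<Sum>m\<le>N. (real m + 1) powr (\<delta> - 1)) \<le> (real N + 1) powr \<delta> / \<delta>"
proof -
  have "\<delta> * (\<Sum>m\<le>N. (real m + 1) powr (\<delta> - 1)) \<le> (\<Sum>m\<le>N. (real m + 1) powr \<delta> - real m powr \<delta>)"
    unfolding sum_distrib_left by (intro sum_mono powr_diff_ge assms)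
  also have "\<dots> = (real N + 1) powr \<delta>"
    by (induction N) (auto simp: algebra_simps)
  finally show ?thesis using assms by (simp add: field_simps)
qed

section \<open>Finitely supported distributions\<close>

lemma prob_expectation:
  "measure_pmf.prob p {x. P x} = measure_pmf.expectation p (\<lambda>x. of_bool (P x))"
proof -
  have "(\<lambda>x. of_bool (P x) :: real) = indicator {x. P x}"
    by (auto simp: indicator_def fun_eq_iff)
  then show ?thesis by simp
qed

lemma expectation_mono_finite:
  fixes f h :: "'b \<Rightarrow> real"
  assumes "finite (set_pmf p)" "\<And>x. x \<in> set_pmf p \<Longrightarrow> f x \<le> h x"
  shows "measure_pmf.expectation p f \<le> measure_pmf.expectation p h"
  using assms by (intro integral_mono_AE) (auto simp: AE_measure_pmf_iff integrable_measure_pmf_finite)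

lemma prob_mono_support:
  assumes "\<And>x. x \<in> set_pmf p \<Longrightarrow> P x \<Longrightarrow> Q x"
  shows "measure_pmf.prob p {x. P x} \<le> measure_pmf.prob p {x. Q x}"
  using assms by (intro measure_pmf.finite_measure_mono_AE) (auto simp: AE_measure_pmf_iff)

lemma prob_UN_le:
  assumes "finite I"
  shows "measure_pmf.prob p {x. \<exists>i\<in>I. P i x} \<le> (\<Sum>i\<in>I. measure_pmf.prob p {x. P i x})"
proof -
  have "{x. \<exists>i\<in>I. P i x} = (\<Union>i\<in>I. {x. P i x})" by auto
  then show ?thesis using measure_UNION_le[OF assms, of "\<lambda>i. {x. P i x}" p] by simp
qed

lemma prob_disj_le:
  "measure_pmf.prob p {x. P x \<or> Q x} \<le> measure_pmf.prob p {x. P x} + measure_pmf.prob p {x. Q x}"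
proof -
  have "{x. P x \<or> Q x} = {x. P x} \<union> {x. Q x}" by auto
  then show ?thesis using measure_Un_le[of "{x. P x}" p "{x. Q x}"] by simp
qed

lemma expectation_pair_finite:
  fixes F :: "'b \<times> 'c \<Rightarrow> real"
  assumes "finite (set_pmf p)" "finite (set_pmf r)"
  shows "measure_pmf.expectation (pair_pmf p r) F
    = measure_pmf.expectation p (\<lambda>x. measure_pmf.expectation r (\<lambda>y. F (x, y)))"
proof -
  have "pair_pmf p r = bind_pmf p (\<lambda>x. map_pmf (Pair x) r)"
    by (simp add: pair_pmf_def map_pmf_def)
  then have "measure_pmf.expectation (pair_pmf p r) F
    = (\<Sum>x\<in>set_pmf p. pmf p x *\<^sub>R measure_pmf.expectation (map_pmf (Pair x) r) F)"
    using assms by (simp only:) (rule pmf_expectation_bind, auto)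
  then show ?thesis using assms by (subst integral_measure_pmf[of "set_pmf p"]) auto
qed

text \<open>Conditioning on the first component: an exceptional set is paid for by its probability.\<close>

lemma prob_pair_le:
  assumes "finite (set_pmf p)" "finite (set_pmf r)" "0 \<le> \<eta>"
    and "\<And>x. x \<in> set_pmf p \<Longrightarrow> \<not> Bad x \<Longrightarrow> measure_pmf.prob r {y. P (x, y)} \<le> \<eta>"
  shows "measure_pmf.prob (pair_pmf p r) {z. P z} \<le> measure_pmf.prob p {x. Bad x} + \<eta>"
proof -
  have "measure_pmf.prob (pair_pmf p r) {z. P z}
     = measure_pmf.expectation p (\<lambda>x. measure_pmf.prob r {y. P (x, y)})"
    unfolding prob_expectation by (rule expectation_pair_finite[OF assms(1,2)])
  also have "\<dots> \<le> measure_pmf.expectation p (\<lambda>x. of_bool (Bad x) + \<eta>)"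
    using assms by (intro expectation_mono_finite) (auto intro: add_increasing2 measure_pmf.prob_le_1)
  also have "\<dots> = measure_pmf.prob p {x. Bad x} + \<eta>"
    unfolding prob_expectation using assms(1)
    by (subst Bochner_Integration.integral_add) (auto intro: integrable_measure_pmf_finite)
  finally show ?thesis .
qed

locale symmetric_generators = group G for G (structure) +
  fixes S :: "'a set"
  assumes fin_S: "finite S" and S_sub: "S \<subseteq> carrier G"
    and S_inv: "\<And>s. s \<in> S \<Longrightarrow> inv s \<in> S" and S_ne: "S \<noteq> {}"
begin

section \<open>Words and balls\<close>

text \<open>Words act on the left, like the steps of the walks; the first letter is the first step.\<close>

primrec endpt :: "'a \<Rightarrow> 'a list \<Rightarrow> 'a" where
  "endpt x [] = x"
| "endpt x (s # l) = endpt (s \<otimes> x) l"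

primrec positions :: "'a \<Rightarrow> 'a list \<Rightarrow> 'a list" where
  "positions x [] = [x]"
| "positions x (s # l) = x # positions (s \<otimes> x) l"

text \<open>The ball of the Cayley graph, described by words instead of walks; see \<open>cayley_ball_eq\<close> below.\<close>

definition wball :: "'a \<Rightarrow> nat \<Rightarrow> 'a set" where
  "wball x r = {endpt x l | l. set l \<subseteq> S \<and> length l \<le> r}"

lemma S_carrier: "s \<in> S \<Longrightarrow> s \<in> carrier G"
  using S_sub by auto

lemma card_S_pos: "card S > 0"
  using fin_S S_ne by (simp add: card_gt_0_iff)

lemma endpt_closed: "x \<in> carrier G \<Longrightarrow> set l \<subseteq> S \<Longrightarrow> endpt x l \<in> carrier G"
  by (induction l arbitrary: x) (auto simp: S_carrier)

lemma endpt_append: "endpt x (l @ l') = endpt (endpt x l) l'"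
  by (induction l arbitrary: x) auto

lemma endpt_mult:
  "x \<in> carrier G \<Longrightarrow> g \<in> carrier G \<Longrightarrow> set l \<subseteq> S \<Longrightarrow> endpt (x \<otimes> g) l = endpt x l \<otimes> g"
  by (induction l arbitrary: x) (auto simp: S_carrier m_assoc[symmetric])

lemma endpt_one: "x \<in> carrier G \<Longrightarrow> set l \<subseteq> S \<Longrightarrow> endpt x l = endpt \<one> l \<otimes> x"
  using endpt_mult[of \<one> x l] by simp

lemma endpt_rev:
  "x \<in> carrier G \<Longrightarrow> set l \<subseteq> S \<Longrightarrow> endpt (endpt x l) (rev (map (\<lambda>s. inv s) l)) = x"
proof (induction l arbitrary: x)
  case (Cons s l)
  then have "endpt (endpt x (s # l)) (rev (map (\<lambda>s. inv s) (s # l))) = inv s \<otimes> (s \<otimes> x)"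
    using Cons.IH[of "s \<otimes> x"] Cons.prems by (simp add: endpt_append S_carrier)
  then show ?case using Cons.prems by (simp add: S_carrier m_assoc[symmetric])
qed simp

lemma set_rev_inv: "set l \<subseteq> S \<Longrightarrow> set (rev (map (\<lambda>s. inv s) l)) \<subseteq> S"
  using S_inv by auto

lemma wball_sub: "x \<in> carrier G \<Longrightarrow> wball x r \<subseteq> carrier G"
  by (auto simp: wball_def endpt_closed)

lemma wball_mono: "r \<le> r' \<Longrightarrow> wball x r \<subseteq> wball x r'"
  by (force simp: wball_def)

lemma wball_self: "x \<in> wball x r"
  by (auto simp: wball_def intro!: exI[of _ "[]"])

lemma finite_wball: "finite (wball x r)"
proof -
  have "wball x r = endpt x ` {l. set l \<subseteq> S \<and> length l \<le> r}"
    by (auto simp: wball_def)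
  then show ?thesis using finite_lists_length_le[OF fin_S, of r] by simp
qed

lemma wball_trans: "y \<in> wball x r \<Longrightarrow> z \<in> wball y r' \<Longrightarrow> z \<in> wball x (r + r')"
proof -
  assume "y \<in> wball x r" "z \<in> wball y r'"
  then obtain l l' where "set l \<subseteq> S" "length l \<le> r" "set l' \<subseteq> S" "length l' \<le> r'"
    "z = endpt x (l @ l')" by (auto simp: wball_def endpt_append)
  then show ?thesis unfolding wball_def mem_Collect_eq by (intro exI[of _ "l @ l'"]) auto
qed

lemma wball_sym: "x \<in> carrier G \<Longrightarrow> y \<in> wball x r \<Longrightarrow> x \<in> wball y r"
proof -
  assume x: "x \<in> carrier G" and "y \<in> wball x r"
  then obtain l where l: "set l \<subseteq> S" "length l \<le> r" "y = endpt x l" by (auto simp: wball_def)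
  show ?thesis unfolding wball_def mem_Collect_eq
    by (rule exI[of _ "rev (map (\<lambda>s. inv s) l)"])
      (use endpt_rev[OF x l(1)] l set_rev_inv[OF l(1)] in auto)
qed

lemma wball_translate: "x \<in> carrier G \<Longrightarrow> wball x r = (\<lambda>g. g \<otimes> x) ` wball \<one> r"
  by (auto simp: wball_def image_def) (metis endpt_one)+

lemma card_wball: "x \<in> carrier G \<Longrightarrow> card (wball x r) = card (wball \<one> r)"
proof -
  assume x: "x \<in> carrier G"
  have "inj_on (\<lambda>g. g \<otimes> x) (wball \<one> r)"
    using x wball_sub[of \<one> r] by (intro inj_onI) (metis one_closed right_cancel subsetD)
  then show ?thesis using wball_translate[OF x] by (simp add: card_image)
qed

lemma wball_iff_quotient:
  "x \<in> carrier G \<Longrightarrow> y \<in> carrier G \<Longrightarrow> y \<in> wball x r \<longleftrightarrow> y \<otimes> inv x \<in> wball \<one> r"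
proof -
  assume x: "x \<in> carrier G" and y: "y \<in> carrier G"
  have "y \<in> wball x r \<longleftrightarrow> (\<exists>g\<in>wball \<one> r. y = g \<otimes> x)"
    using wball_translate[OF x] by auto
  also have "\<dots> \<longleftrightarrow> y \<otimes> inv x \<in> wball \<one> r"
    using x y wball_sub[of \<one> r] by (auto simp: m_assoc intro!: bexI[of _ "y \<otimes> inv x"])
  finally show ?thesis .
qed

lemma length_positions: "length (positions x l) = Suc (length l)"
  by (induction l arbitrary: x) auto

lemma nth_positions: "n \<le> length l \<Longrightarrow> positions x l ! n = endpt x (take n l)"
proof (induction l arbitrary: x n)
  case (Cons s l)
  then show ?case by (cases n) auto
qed simp

lemma set_positions: "set (positions x l) = (\<lambda>n. endpt x (take n l)) ` {..length l}"
proof -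
  have "set (positions x l) = (\<lambda>n. positions x l ! n) ` {..length l}"
    by (auto simp: set_conv_nth length_positions less_Suc_eq_le)
  then show ?thesis by (simp add: nth_positions)
qed

section \<open>The averaging operator\<close>

definition avg :: "('a \<Rightarrow> real) \<Rightarrow> 'a \<Rightarrow> real" where
  "avg f x = (\<Sum>s\<in>S. f (s \<otimes> x)) / card S"

lemma avg_add: "avg (\<lambda>x. f x + h x) = (\<lambda>x. avg f x + avg h x)"
  by (simp add: avg_def sum.distrib add_divide_distrib fun_eq_iff)

lemma avg_cmult: "avg (\<lambda>x. c * f x) = (\<lambda>x. c * avg f x)"
  by (simp add: avg_def sum_distrib_left[symmetric] fun_eq_iff)

lemma avg_diff: "avg (\<lambda>x. f x - h x) = (\<lambda>x. avg f x - avg h x)"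
  by (simp add: avg_def sum_subtractf diff_divide_distrib fun_eq_iff)

lemma avg_sum: "avg (\<lambda>x. \<Sum>i\<in>I. f i x) = (\<lambda>x. \<Sum>i\<in>I. avg (f i) x)"
  by (auto simp: avg_def fun_eq_iff sum_divide_distrib intro: sum.swap)

lemma avg_mono:
  "(\<And>x. x \<in> carrier G \<Longrightarrow> f x \<le> h x) \<Longrightarrow> x \<in> carrier G \<Longrightarrow> avg f x \<le> avg h x"
  by (auto simp: avg_def S_carrier intro!: divide_right_mono sum_mono)

lemma avg_cong:
  "(\<And>x. x \<in> carrier G \<Longrightarrow> f x = h x) \<Longrightarrow> x \<in> carrier G \<Longrightarrow> avg f x = avg h x"
  by (auto simp: avg_def S_carrier intro!: sum.cong)

lemma avg_const: "avg (\<lambda>_. c) = (\<lambda>_. c)"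
  using card_S_pos by (simp add: avg_def fun_eq_iff)

lemma avg_translate:
  "g \<in> carrier G \<Longrightarrow> x \<in> carrier G \<Longrightarrow> avg (\<lambda>x. f (x \<otimes> g)) x = avg f (x \<otimes> g)"
  by (auto simp: avg_def S_carrier m_assoc intro!: sum.cong)

lemma avgn_add: "(avg ^^ n) (\<lambda>x. f x + h x) = (\<lambda>x. (avg ^^ n) f x + (avg ^^ n) h x)"
  by (induction n) (auto simp: avg_add)

lemma avgn_cmult: "(avg ^^ n) (\<lambda>x. c * f x) = (\<lambda>x. c * (avg ^^ n) f x)"
  by (induction n) (auto simp: avg_cmult)

lemma avgn_diff: "(avg ^^ n) (\<lambda>x. f x - h x) = (\<lambda>x. (avg ^^ n) f x - (avg ^^ n) h x)"
  by (induction n) (auto simp: avg_diff)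

lemma avgn_sum: "(avg ^^ n) (\<lambda>x. \<Sum>i\<in>I. f i x) = (\<lambda>x. \<Sum>i\<in>I. (avg ^^ n) (f i) x)"
  by (induction n) (auto simp: avg_sum)

lemma avgn_mono:
  "(\<And>x. x \<in> carrier G \<Longrightarrow> f x \<le> h x) \<Longrightarrow> x \<in> carrier G \<Longrightarrow> (avg ^^ n) f x \<le> (avg ^^ n) h x"
  by (induction n arbitrary: x) (auto intro: avg_mono)

lemma avgn_cong:
  "(\<And>x. x \<in> carrier G \<Longrightarrow> f x = h x) \<Longrightarrow> x \<in> carrier G \<Longrightarrow> (avg ^^ n) f x = (avg ^^ n) h x"
  by (induction n arbitrary: x) (auto intro: avg_cong)

lemma avgn_const: "(avg ^^ n) (\<lambda>_. c) = (\<lambda>_. c)"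
  by (induction n) (auto simp: avg_const)

lemma avgn_nonneg:
  "(\<And>x. x \<in> carrier G \<Longrightarrow> 0 \<le> f x) \<Longrightarrow> x \<in> carrier G \<Longrightarrow> 0 \<le> (avg ^^ n) f x"
  using avgn_mono[of "\<lambda>_. 0" f x n] by (simp add: avgn_const)

lemma avgn_translate:
  "g \<in> carrier G \<Longrightarrow> x \<in> carrier G \<Longrightarrow> (avg ^^ n) (\<lambda>x. f (x \<otimes> g)) x = (avg ^^ n) f (x \<otimes> g)"
proof (induction n arbitrary: x)
  case (Suc n)
  have "(avg ^^ Suc n) (\<lambda>x. f (x \<otimes> g)) x = avg (\<lambda>x. (avg ^^ n) f (x \<otimes> g)) x"
    using Suc by (auto intro!: avg_cong)
  then show ?case using avg_translate[OF Suc.prems] by simp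
qed simp

section \<open>Summation over the group\<close>

definition fin_supp :: "('a \<Rightarrow> real) \<Rightarrow> bool" where
  "fin_supp f \<longleftrightarrow> finite {x \<in> carrier G. f x \<noteq> 0}"

definition group_sum :: "('a \<Rightarrow> real) \<Rightarrow> real" where
  "group_sum f = infsum f (carrier G)"

lemma fin_supp_summable: "fin_supp f \<Longrightarrow> f summable_on carrier G"
proof -
  assume "fin_supp f"
  then have "f summable_on {x \<in> carrier G. f x \<noteq> 0}" by (simp add: fin_supp_def)
  then show ?thesis
    by (subst summable_on_cong_neutral[where T = "{x \<in> carrier G. f x \<noteq> 0}" and g = f]) auto
qed

lemma fin_supp_subset: "fin_supp f \<Longrightarrow> (\<And>x. x \<in> carrier G \<Longrightarrow> f x = 0 \<Longrightarrow> h x = 0) \<Longrightarrow> fin_supp h"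
  unfolding fin_supp_def by (erule finite_subset[rotated]) auto

lemma fin_supp_add: "fin_supp f \<Longrightarrow> fin_supp h \<Longrightarrow> fin_supp (\<lambda>x. f x + h x)"
proof -
  assume "fin_supp f" "fin_supp h"
  then have "finite ({x \<in> carrier G. f x \<noteq> 0} \<union> {x \<in> carrier G. h x \<noteq> 0})" by (simp add: fin_supp_def)
  then show ?thesis unfolding fin_supp_def by (rule finite_subset[rotated]) auto
qed

lemma fin_supp_mult: "fin_supp f \<Longrightarrow> fin_supp (\<lambda>x. f x * h x)"
  by (erule fin_supp_subset) auto

lemma fin_supp_mult': "fin_supp h \<Longrightarrow> fin_supp (\<lambda>x. f x * h x)"
  by (erule fin_supp_subset) auto

lemma fin_supp_diff: "fin_supp f \<Longrightarrow> fin_supp h \<Longrightarrow> fin_supp (\<lambda>x. f x - h x)"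
  using fin_supp_add[of f "\<lambda>x. - 1 * h x"] fin_supp_mult'[of h "\<lambda>_. -1"] by simp

lemma fin_supp_pow2: "fin_supp f \<Longrightarrow> fin_supp (\<lambda>x. (f x)\<^sup>2)"
  by (erule fin_supp_subset) auto

lemma fin_supp_sum: "(\<And>i. i \<in> I \<Longrightarrow> fin_supp (f i)) \<Longrightarrow> fin_supp (\<lambda>x. \<Sum>i\<in>I. f i x)"
proof (induction I rule: infinite_finite_induct)
  case (insert i I) then show ?case by (auto intro!: fin_supp_add)
qed (auto simp: fin_supp_def)

lemma bij_left: "g \<in> carrier G \<Longrightarrow> bij_betw (\<lambda>x. g \<otimes> x) (carrier G) (carrier G)"
  by (rule bij_betw_byWitness[where f' = "\<lambda>x. inv g \<otimes> x"]) (auto simp: m_assoc[symmetric])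

lemma bij_right: "g \<in> carrier G \<Longrightarrow> bij_betw (\<lambda>x. x \<otimes> g) (carrier G) (carrier G)"
  by (rule bij_betw_byWitness[where f' = "\<lambda>x. x \<otimes> inv g"]) (auto simp: m_assoc)

lemma fin_supp_bij:
  assumes "bij_betw h (carrier G) (carrier G)" "fin_supp f"
  shows "fin_supp (\<lambda>x. f (h x))"
proof -
  have "bij_betw h {x \<in> carrier G. f (h x) \<noteq> 0} {x \<in> carrier G. f x \<noteq> 0}"
    using assms(1) unfolding bij_betw_def inj_on_def by auto
  then show ?thesis using assms(2) bij_betw_finite unfolding fin_supp_def by blast
qed

lemma fin_supp_left: "g \<in> carrier G \<Longrightarrow> fin_supp f \<Longrightarrow> fin_supp (\<lambda>x. f (g \<otimes> x))"
  by (rule fin_supp_bij[OF bij_left])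

lemma fin_supp_right: "g \<in> carrier G \<Longrightarrow> fin_supp f \<Longrightarrow> fin_supp (\<lambda>x. f (x \<otimes> g))"
  by (rule fin_supp_bij[OF bij_right])

lemma fin_supp_avg: "fin_supp f \<Longrightarrow> fin_supp (avg f)"
proof -
  assume f: "fin_supp f"
  have "fin_supp (\<lambda>x. (\<Sum>s\<in>S. f (s \<otimes> x)) * (1 / card S))"
    by (intro fin_supp_mult fin_supp_sum fin_supp_left f S_carrier)
  then show ?thesis by (simp add: avg_def[abs_def])
qed

lemma fin_supp_avgn: "fin_supp f \<Longrightarrow> fin_supp ((avg ^^ n) f)"
  by (induction n) (auto intro: fin_supp_avg)

lemma group_sum_add: "fin_supp f \<Longrightarrow> fin_supp h \<Longrightarrow> group_sum (\<lambda>x. f x + h x) = group_sum f + group_sum h"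
  unfolding group_sum_def by (intro infsum_add fin_supp_summable)

lemma group_sum_cmult: "group_sum (\<lambda>x. c * f x) = c * group_sum f"
  unfolding group_sum_def by (rule infsum_cmult_right')

lemma group_sum_diff: "fin_supp f \<Longrightarrow> fin_supp h \<Longrightarrow> group_sum (\<lambda>x. f x - h x) = group_sum f - group_sum h"
  using group_sum_add[of f "\<lambda>x. - 1 * h x"] fin_supp_mult'[of h "\<lambda>_. -1"] group_sum_cmult[of "-1" h] by simp

lemma group_sum_sum: "(\<And>i. i \<in> I \<Longrightarrow> fin_supp (f i)) \<Longrightarrow> group_sum (\<lambda>x. \<Sum>i\<in>I. f i x) = (\<Sum>i\<in>I. group_sum (f i))"
proof (induction I rule: infinite_finite_induct)
  case (insert i I) then show ?case by (simp add: group_sum_add fin_supp_sum)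
qed (auto simp: group_sum_def)

lemma group_sum_mono: "fin_supp f \<Longrightarrow> fin_supp h \<Longrightarrow> (\<And>x. x \<in> carrier G \<Longrightarrow> f x \<le> h x) \<Longrightarrow> group_sum f \<le> group_sum h"
  unfolding group_sum_def by (intro infsum_mono fin_supp_summable)

lemma group_sum_cong: "(\<And>x. x \<in> carrier G \<Longrightarrow> f x = h x) \<Longrightarrow> group_sum f = group_sum h"
  unfolding group_sum_def by (rule infsum_cong)

lemma group_sum_nonneg: "(\<And>x. x \<in> carrier G \<Longrightarrow> 0 \<le> f x) \<Longrightarrow> 0 \<le> group_sum f"
  unfolding group_sum_def by (rule infsum_nonneg)

lemma group_sum_left: "g \<in> carrier G \<Longrightarrow> group_sum (\<lambda>x. f (g \<otimes> x)) = group_sum f"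
  unfolding group_sum_def by (rule infsum_reindex_bij_betw[OF bij_left])

lemma group_sum_right: "g \<in> carrier G \<Longrightarrow> group_sum (\<lambda>x. f (x \<otimes> g)) = group_sum f"
  unfolding group_sum_def by (rule infsum_reindex_bij_betw[OF bij_right])

lemma group_sum_finite_le:
  assumes "fin_supp f" "\<And>x. x \<in> carrier G \<Longrightarrow> 0 \<le> f x" "finite F" "F \<subseteq> carrier G"
  shows "sum f F \<le> group_sum f"
proof -
  have "infsum f F \<le> infsum f (carrier G)" using assms by (intro infsum_mono2 fin_supp_summable) auto
  then show ?thesis using assms(3) by (simp add: group_sum_def)
qed

lemma group_sum_eq_sum:
  assumes "finite F" "F \<subseteq> carrier G" "\<And>x. x \<in> carrier G \<Longrightarrow> x \<notin> F \<Longrightarrow> f x = 0"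
  shows "group_sum f = sum f F"
proof -
  have "infsum f (carrier G) = infsum f F" using assms by (intro infsum_cong_neutral) auto
  then show ?thesis using assms(1) by (simp add: group_sum_def)
qed

lemma group_sum_avg: "fin_supp f \<Longrightarrow> group_sum (avg f) = group_sum f"
proof -
  assume f: "fin_supp f"
  have "group_sum (avg f) = group_sum (\<lambda>x. (1 / card S) * (\<Sum>s\<in>S. f (s \<otimes> x)))"
    by (simp add: avg_def[abs_def])
  also have "\<dots> = (1 / card S) * (\<Sum>s\<in>S. group_sum (\<lambda>x. f (s \<otimes> x)))"
    by (subst group_sum_cmult, subst group_sum_sum) (auto intro: fin_supp_left f S_carrier)
  also have "\<dots> = group_sum f" using card_S_pos by (simp add: group_sum_left S_carrier)
  finally show ?thesis .
qed

text \<open>This is where the symmetry of \<open>S\<close> enters: the shift by \<open>s\<close> has the shift by \<open>inv s\<close> as adjoint.\<close>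

lemma avg_selfadjoint:
  assumes "fin_supp f" "fin_supp h"
  shows "group_sum (\<lambda>x. avg f x * h x) = group_sum (\<lambda>x. f x * avg h x)"
proof -
  have *: "group_sum (\<lambda>x. f (s \<otimes> x) * h x) = group_sum (\<lambda>x. f x * h (inv s \<otimes> x))" if "s \<in> S" for s
  proof -
    have s: "s \<in> carrier G" using that by (rule S_carrier)
    have "group_sum (\<lambda>x. f (s \<otimes> x) * h x) = group_sum (\<lambda>x. (\<lambda>x. f x * h (inv s \<otimes> x)) (s \<otimes> x))"
      by (rule group_sum_cong) (simp add: s m_assoc[symmetric])
    also have "\<dots> = group_sum (\<lambda>x. f x * h (inv s \<otimes> x))" by (rule group_sum_left[OF s])
    finally show ?thesis .
  qed
  have bij: "bij_betw (\<lambda>s. inv s) S S"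
    by (rule bij_betw_byWitness[where f' = "\<lambda>s. inv s"]) (auto simp: S_inv S_carrier)
  have "group_sum (\<lambda>x. avg f x * h x) = group_sum (\<lambda>x. (1 / card S) * (\<Sum>s\<in>S. f (s \<otimes> x) * h x))"
    by (rule group_sum_cong) (simp add: avg_def sum_distrib_right)
  also have "\<dots> = (1 / card S) * (\<Sum>s\<in>S. group_sum (\<lambda>x. f (s \<otimes> x) * h x))"
    by (subst group_sum_cmult, subst group_sum_sum) (auto intro: fin_supp_mult' assms)
  also have "(\<Sum>s\<in>S. group_sum (\<lambda>x. f (s \<otimes> x) * h x)) = (\<Sum>s\<in>S. group_sum (\<lambda>x. f x * h (inv s \<otimes> x)))"
    by (rule sum.cong) (auto simp: *)
  also have "\<dots> = (\<Sum>s\<in>S. group_sum (\<lambda>x. f x * h (s \<otimes> x)))"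
    by (rule sum.reindex_bij_betw[OF bij])
  also have "(1 / card S) * (\<Sum>s\<in>S. group_sum (\<lambda>x. f x * h (s \<otimes> x)))
      = group_sum (\<lambda>x. (1 / card S) * (\<Sum>s\<in>S. f x * h (s \<otimes> x)))"
    by (subst group_sum_cmult, subst group_sum_sum) (auto intro: fin_supp_mult assms)
  also have "\<dots> = group_sum (\<lambda>x. f x * avg h x)"
    by (rule group_sum_cong) (simp add: avg_def sum_distrib_left[symmetric])
  finally show ?thesis .
qed

lemma avgn_selfadjoint:
  "fin_supp f \<Longrightarrow> fin_supp h \<Longrightarrow> group_sum (\<lambda>x. (avg ^^ n) f x * h x) = group_sum (\<lambda>x. f x * (avg ^^ n) h x)"
proof (induction n arbitrary: h)
  case (Suc n)
  have "group_sum (\<lambda>x. (avg ^^ Suc n) f x * h x) = group_sum (\<lambda>x. (avg ^^ n) f x * avg h x)"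
    using avg_selfadjoint[OF fin_supp_avgn[OF Suc.prems(1)] Suc.prems(2), of n] by simp
  also have "\<dots> = group_sum (\<lambda>x. f x * (avg ^^ n) (avg h) x)"
    by (rule Suc.IH[OF Suc.prems(1) fin_supp_avg[OF Suc.prems(2)]])
  finally show ?case by (simp add: funpow_swap1)
qed simp

lemma avg_contraction:
  assumes "fin_supp f"
  shows "group_sum (\<lambda>x. (avg f x)\<^sup>2) \<le> group_sum (\<lambda>x. (f x)\<^sup>2)"
proof -
  have "(avg f x)\<^sup>2 \<le> avg (\<lambda>x. (f x)\<^sup>2) x" for x
  proof -
    have "(\<Sum>s\<in>S. f (s \<otimes> x))\<^sup>2 \<le> card S * (\<Sum>s\<in>S. (f (s \<otimes> x))\<^sup>2)"
      using sum_squared_le_sum_of_squares[of "\<lambda>s. f (s \<otimes> x)" S] by (simp add: mult.commute)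
    then show ?thesis
      using card_S_pos by (simp add: avg_def power_divide power2_eq_square[of "real (card S)"] field_simps)
  qed
  then have "group_sum (\<lambda>x. (avg f x)\<^sup>2) \<le> group_sum (avg (\<lambda>x. (f x)\<^sup>2))"
    by (intro group_sum_mono fin_supp_pow2 fin_supp_avg assms)
  then show ?thesis using group_sum_avg[OF fin_supp_pow2[OF assms]] by simp
qed

lemma group_sum_square_add:
  assumes "fin_supp u" "fin_supp v" "(m::real) > 0"
  shows "group_sum (\<lambda>x. (u x + v x)\<^sup>2) \<le> (1 + 1 / m) * group_sum (\<lambda>x. (u x)\<^sup>2) + (1 + m) * group_sum (\<lambda>x. (v x)\<^sup>2)"
proof -
  have "group_sum (\<lambda>x. (u x + v x)\<^sup>2) \<le> group_sum (\<lambda>x. (1 + 1 / m) * (u x)\<^sup>2 + (1 + m) * (v x)\<^sup>2)"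
    by (intro group_sum_mono fin_supp_pow2 fin_supp_add fin_supp_mult' assms square_add_weighted)
  also have "\<dots> = (1 + 1 / m) * group_sum (\<lambda>x. (u x)\<^sup>2) + (1 + m) * group_sum (\<lambda>x. (v x)\<^sup>2)"
    by (subst group_sum_add) (auto simp: group_sum_cmult intro!: fin_supp_mult' fin_supp_pow2 assms)
  finally show ?thesis .
qed

end

context symmetric_generators
begin

section \<open>Transition probabilities\<close>

definition delta :: "'a \<Rightarrow> real" where
  "delta x = (if x = \<one> then 1 else 0)"

text \<open>\<open>q n g\<close> is the probability that a walk started at \<open>g\<close> is at the neutral element at time \<open>n\<close>. As right translations are
  automorphisms, the transition probability from \<open>x\<close> to \<open>y\<close> is \<open>q n (x \<otimes> inv y)\<close>.\<close>

definition q :: "nat \<Rightarrow> 'a \<Rightarrow> real" where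
  "q n = (avg ^^ n) delta"

abbreviation ret :: "nat \<Rightarrow> real" where
  "ret n \<equiv> q (2 * n) \<one>"

lemma fin_supp_delta: "fin_supp delta"
  unfolding fin_supp_def by (rule finite_subset[of _ "{\<one>}"]) (auto simp: delta_def)

lemma fin_supp_q: "fin_supp (q n)"
  unfolding q_def by (intro fin_supp_avgn fin_supp_delta)

lemma group_sum_square_diff:
  assumes "fin_supp f" "fin_supp h"
  shows "group_sum (\<lambda>x. (f x - h x)\<^sup>2) = group_sum (\<lambda>x. (f x)\<^sup>2) + group_sum (\<lambda>x. (h x)\<^sup>2) - 2 * group_sum (\<lambda>x. f x * h x)"
proof -
  have "group_sum (\<lambda>x. (f x - h x)\<^sup>2) = group_sum (\<lambda>x. ((f x)\<^sup>2 + (h x)\<^sup>2) - 2 * (f x * h x))"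
    by (intro group_sum_cong) (simp add: power2_eq_square algebra_simps)
  also have "\<dots> = group_sum (\<lambda>x. (f x)\<^sup>2 + (h x)\<^sup>2) - 2 * group_sum (\<lambda>x. f x * h x)"
    by (subst group_sum_diff) (auto intro!: fin_supp_add fin_supp_pow2 fin_supp_mult fin_supp_mult'[of _ "\<lambda>_. 2"] assms simp: group_sum_cmult)
  finally show ?thesis by (simp add: group_sum_add fin_supp_pow2 assms)
qed

lemma q_nonneg: "x \<in> carrier G \<Longrightarrow> 0 \<le> q n x"
  unfolding q_def by (rule avgn_nonneg) (auto simp: delta_def)

lemma q_Suc: "q (Suc n) = avg (q n)"
  by (simp add: q_def)

lemma q_plus: "q (m + n) = (avg ^^ m) (q n)"
  by (simp add: q_def funpow_add)

lemma delta_quotient: "x \<in> carrier G \<Longrightarrow> y \<in> carrier G \<Longrightarrow> delta (x \<otimes> inv y) = (if x = y then 1 else 0)"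
  by (auto simp: delta_def) (metis inv_closed inv_equality inv_inv)

lemma avgn_point:
  assumes "x \<in> carrier G" "y \<in> carrier G"
  shows "(avg ^^ n) (\<lambda>z. if z = y then 1 else 0) x = q n (x \<otimes> inv y)"
proof -
  have "(avg ^^ n) (\<lambda>z. if z = y then 1 else 0) x = (avg ^^ n) (\<lambda>z. delta (z \<otimes> inv y)) x"
    using assms by (intro avgn_cong) (auto simp: delta_quotient)
  then show ?thesis using assms avgn_translate[of "inv y" x n delta] by (simp add: q_def)
qed

lemma group_sum_point:
  assumes "y \<in> carrier G"
  shows "group_sum (\<lambda>x. f x * delta (x \<otimes> inv y)) = f y"
proof -
  have "group_sum (\<lambda>x. f x * delta (x \<otimes> inv y)) = (\<Sum>x\<in>{y}. f x * delta (x \<otimes> inv y))"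
    using assms by (intro group_sum_eq_sum) (auto simp: delta_quotient)
  then show ?thesis using assms by (simp add: delta_def)
qed

lemma group_sum_delta: "group_sum delta = 1"
proof -
  have "group_sum delta = sum delta {\<one>}" by (rule group_sum_eq_sum) (auto simp: delta_def)
  then show ?thesis by (simp add: delta_def)
qed

lemma group_sum_q: "group_sum (q n) = 1"
proof (induction n)
  case 0 then show ?case by (simp add: q_def group_sum_delta)
next
  case (Suc n) then show ?case by (simp add: q_Suc group_sum_avg fin_supp_q)
qed

lemma sum_q_le_1: "finite F \<Longrightarrow> F \<subseteq> carrier G \<Longrightarrow> sum (q n) F \<le> 1"
  using group_sum_finite_le[of "q n" F] by (simp add: fin_supp_q q_nonneg group_sum_q)

text \<open>The two halves of the walk, the second one reversed in time by self-adjointness.\<close>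

lemma q_convolution:
  assumes "g \<in> carrier G"
  shows "q (m + n) g = group_sum (\<lambda>x. q n x * q m (x \<otimes> inv g))"
proof -
  have fsd: "fin_supp (\<lambda>x. delta (x \<otimes> inv g))" using assms by (intro fin_supp_right fin_supp_delta) auto
  have "q (m + n) g = group_sum (\<lambda>x. (avg ^^ m) (q n) x * delta (x \<otimes> inv g))"
    using assms by (simp add: group_sum_point q_plus)
  also have "\<dots> = group_sum (\<lambda>x. q n x * (avg ^^ m) (\<lambda>x. delta (x \<otimes> inv g)) x)"
    by (rule avgn_selfadjoint[OF fin_supp_q fsd])
  also have "\<dots> = group_sum (\<lambda>x. q n x * q m (x \<otimes> inv g))"
    using assms by (intro group_sum_cong) (simp add: avgn_translate q_def)
  finally show ?thesis .
qed

lemma q_add_one: "q (m + n) \<one> = group_sum (\<lambda>x. q n x * q m x)"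
  by (subst q_convolution) (auto intro!: group_sum_cong)

lemma ret_eq: "ret n = group_sum (\<lambda>x. (q n x)\<^sup>2)"
  using q_add_one[of n n] by (simp add: power2_eq_square mult_2)

definition psi :: "nat \<Rightarrow> 'a \<Rightarrow> real" where
  "psi n g = ret n - q (2 * n) g"

text \<open>\<open>q (2 n) g\<close> is the inner product of \<open>q n\<close> with its right translate by \<open>inv g\<close>, which has the same norm.\<close>

lemma psi_eq:
  assumes "g \<in> carrier G"
  shows "2 * psi n g = group_sum (\<lambda>x. (q n x - q n (x \<otimes> inv g))\<^sup>2)"
proof -
  have fsr: "fin_supp (\<lambda>x. q n (x \<otimes> inv g))" using assms by (intro fin_supp_right fin_supp_q) auto
  have "group_sum (\<lambda>x. (q n x - q n (x \<otimes> inv g))\<^sup>2)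
    = (group_sum (\<lambda>x. (q n x)\<^sup>2) + group_sum (\<lambda>x. (q n (x \<otimes> inv g))\<^sup>2))
      - 2 * group_sum (\<lambda>x. q n x * q n (x \<otimes> inv g))"
    by (rule group_sum_square_diff[OF fin_supp_q fsr])
  also have "group_sum (\<lambda>x. (q n (x \<otimes> inv g))\<^sup>2) = group_sum (\<lambda>x. (q n x)\<^sup>2)"
    using assms by (intro group_sum_right[of "inv g" "\<lambda>x. (q n x)\<^sup>2"]) auto
  also have "group_sum (\<lambda>x. q n x * q n (x \<otimes> inv g)) = q (2 * n) g"
    using q_convolution[OF assms, of n n] by (simp add: mult_2)
  finally show ?thesis by (simp add: psi_def ret_eq)
qed

lemma psi_nonneg: "g \<in> carrier G \<Longrightarrow> 0 \<le> psi n g"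
  using psi_eq[of g n] group_sum_nonneg[of "\<lambda>x. (q n x - q n (x \<otimes> inv g))\<^sup>2"] by simp

lemma psi_one: "psi n \<one> = 0"
  by (simp add: psi_def)

text \<open>The right translations are isometries, so that \<open>sqrt (psi n (g \<otimes> h))\<close> is at most the sum of the square
  roots for \<open>g\<close> and \<open>h\<close>. The weight \<open>m\<close> avoids the square roots.\<close>

lemma psi_mult:
  assumes "g \<in> carrier G" "h \<in> carrier G" "(m::real) > 0"
  shows "psi n (g \<otimes> h) \<le> (1 + 1 / m) * psi n h + (1 + m) * psi n g"
proof -
  let ?u = "\<lambda>x. q n x - q n (x \<otimes> inv h)"
  let ?v = "\<lambda>x. q n x - q n (x \<otimes> inv g)"
  have fsu: "fin_supp ?u" and fsv: "fin_supp ?v" using assms by (auto intro!: fin_supp_diff fin_supp_right fin_supp_q)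
  then have fsv': "fin_supp (\<lambda>x. ?v (x \<otimes> inv h))" using assms by (intro fin_supp_right[of "inv h" ?v]) auto
  have "2 * psi n (g \<otimes> h) = group_sum (\<lambda>x. (?u x + ?v (x \<otimes> inv h))\<^sup>2)"
    using assms by (subst psi_eq) (auto intro!: group_sum_cong simp: inv_mult_group m_assoc)
  also have "\<dots> \<le> (1 + 1 / m) * group_sum (\<lambda>x. (?u x)\<^sup>2) + (1 + m) * group_sum (\<lambda>x. (?v (x \<otimes> inv h))\<^sup>2)"
    using fsu fsv' assms(3) by (rule group_sum_square_add)
  also have "group_sum (\<lambda>x. (?v (x \<otimes> inv h))\<^sup>2) = group_sum (\<lambda>x. (?v x)\<^sup>2)"
    using assms by (intro group_sum_right[of "inv h" "\<lambda>x. (?v x)\<^sup>2"]) auto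
  finally have "2 * psi n (g \<otimes> h) \<le> (1 + 1 / m) * (2 * psi n h) + (1 + m) * (2 * psi n g)"
    unfolding psi_eq[OF assms(1)] psi_eq[OF assms(2)] .
  then show ?thesis by (simp add: algebra_simps)
qed

text \<open>The mean of \<open>psi n (t \<otimes> s)\<close> over all pairs of generators is exactly \<open>ret n - ret (Suc n)\<close>.\<close>

lemma psi_pair:
  assumes "s \<in> S" "t \<in> S"
  shows "psi n (t \<otimes> s) \<le> (card S)\<^sup>2 * (ret n - ret (Suc n))"
proof -
  have "q (2 * Suc n) = avg (avg (q (2 * n)))" by (simp add: q_def)
  then have "ret n - ret (Suc n) = avg (avg (psi n)) \<one>"
    unfolding psi_def[abs_def] by (simp add: avg_diff avg_const)
  also have "\<dots> = (\<Sum>s\<in>S. \<Sum>t\<in>S. psi n (t \<otimes> s)) / (card S)\<^sup>2"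
    by (simp add: avg_def S_carrier power2_eq_square sum_divide_distrib[symmetric])
  finally have *: "(card S)\<^sup>2 * (ret n - ret (Suc n)) = (\<Sum>s\<in>S. \<Sum>t\<in>S. psi n (t \<otimes> s))"
    using card_S_pos by simp
  have nn: "0 \<le> psi n (t \<otimes> s)" if "s \<in> S" "t \<in> S" for s t
    using that by (intro psi_nonneg) (auto simp: S_carrier)
  have "psi n (t \<otimes> s) \<le> (\<Sum>t\<in>S. psi n (t \<otimes> s))"
    by (rule member_le_sum) (use assms fin_S nn in auto)
  also have "\<dots> \<le> (\<Sum>s\<in>S. \<Sum>t\<in>S. psi n (t \<otimes> s))"
    by (rule member_le_sum) (use assms fin_S nn in \<open>auto intro!: sum_nonneg\<close>)
  finally show ?thesis using * by simp
qed

lemma ret_antimono_Suc: "ret (Suc n) \<le> ret n"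
proof -
  obtain s where "s \<in> S" using S_ne by auto
  then have "0 \<le> (card S)\<^sup>2 * (ret n - ret (Suc n))"
    using psi_pair[of s s n] psi_nonneg[of "s \<otimes> s" n] by (auto simp: S_carrier)
  then show ?thesis using card_S_pos by (simp add: zero_le_mult_iff)
qed

lemma ret_antimono: "m \<le> n \<Longrightarrow> ret n \<le> ret m"
  by (rule lift_Suc_antimono_le[of ret]) (rule ret_antimono_Suc)

text \<open>A pseudo-Poincare inequality. It is stated for pairs of letters because \<open>psi n\<close> is not small on words of odd
  length when the Cayley graph is bipartite.\<close>

lemma psi_word:
  assumes "set l \<subseteq> S" "length l = 2 * m"
  shows "psi n (endpt \<one> l) \<le> (real m)\<^sup>2 * ((card S)\<^sup>2 * (ret n - ret (Suc n)))"
  using assms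
proof (induction m arbitrary: l)
  case 0 then show ?case by (simp add: psi_one)
next
  case (Suc m)
  then obtain s t l' where l: "l = s # t # l'" by (cases l; cases "tl l") auto
  with Suc.prems have st: "s \<in> S" "t \<in> S" and l': "set l' \<subseteq> S" "length l' = 2 * m" by auto
  let ?c = "(card S)\<^sup>2 * (ret n - ret (Suc n))"
  have c0: "0 \<le> ?c" using ret_antimono_Suc[of n] by simp
  have e: "endpt \<one> l = endpt \<one> l' \<otimes> (t \<otimes> s)"
    using st l' by (simp add: l S_carrier endpt_one[of "t \<otimes> s"])
  have ps: "psi n (t \<otimes> s) \<le> ?c" using psi_pair st by simp
  show ?case
  proof (cases "m = 0")
    case True
    then show ?thesis using ps l' st by (simp add: e S_carrier)
  next
    case False
    have "psi n (endpt \<one> l) \<le> (1 + 1 / (1 / real m)) * psi n (t \<otimes> s) + (1 + 1 / real m) * psi n (endpt \<one> l')"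
      unfolding e using False st l' by (intro psi_mult) (auto simp: S_carrier endpt_closed)
    also have "\<dots> \<le> (1 + real m) * ?c + (1 + 1 / real m) * ((real m)\<^sup>2 * ?c)"
      using Suc.IH[OF l'] ps by (intro add_mono mult_left_mono) auto
    also have "\<dots> = (real (Suc m))\<^sup>2 * ?c"
      using False by (simp add: field_simps power2_eq_square)
    finally show ?thesis .
  qed
qed

text \<open>The length is exactly \<open>2 * m\<close> because \<open>q (2 * n)\<close> vanishes on words of odd length when the Cayley graph is
  bipartite.\<close>

definition evens :: "nat \<Rightarrow> 'a set" where
  "evens m = {endpt \<one> l | l. set l \<subseteq> S \<and> length l = 2 * m}"

lemma evens_sub: "evens m \<subseteq> carrier G"
  by (auto simp: evens_def endpt_closed)

lemma evens_wball: "evens m \<subseteq> wball \<one> (2 * m)"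
  by (auto simp: evens_def wball_def)

lemma finite_evens: "finite (evens m)"
  using evens_wball finite_wball finite_subset by blast

lemma evens_ne: "evens m \<noteq> {}"
proof -
  obtain s where "s \<in> S" using S_ne by auto
  then show ?thesis by (auto simp: evens_def intro!: exI[of _ "replicate (2 * m) s"])
qed

lemma card_evens_pos: "card (evens m) > 0"
  using finite_evens evens_ne by (simp add: card_gt_0_iff)

text \<open>A word can be prolonged by two letters that cancel.\<close>

lemma evens_Suc: "evens m \<subseteq> evens (Suc m)"
proof
  fix g assume "g \<in> evens m"
  then obtain l where l: "set l \<subseteq> S" "length l = 2 * m" "g = endpt \<one> l" by (auto simp: evens_def)
  obtain s where s: "s \<in> S" using S_ne by auto
  have "endpt \<one> (s # inv s # l) = g" using s l by (simp add: S_carrier)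
  then show "g \<in> evens (Suc m)" using s l S_inv
    by (auto simp: evens_def intro!: exI[of _ "s # inv s # l"])
qed

lemma evens_mono: "m \<le> m' \<Longrightarrow> evens m \<subseteq> evens m'"
  by (rule lift_Suc_mono_le[of evens]) (rule evens_Suc)

lemma word_evens: "set l \<subseteq> S \<Longrightarrow> even (length l) \<Longrightarrow> length l \<le> 2 * m \<Longrightarrow> endpt \<one> l \<in> evens m"
  by (rule subsetD[OF evens_mono[of "length l div 2"]]) (auto simp: evens_def)

lemma wball_evens:
  assumes "s \<in> S" "g \<in> wball \<one> r" "r < 2 * m"
  shows "g \<in> evens m \<or> s \<otimes> g \<in> evens m"
proof -
  obtain l where l: "set l \<subseteq> S" "length l \<le> r" "g = endpt \<one> l" using assms by (auto simp: wball_def)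
  show ?thesis
  proof (cases "even (length l)")
    case True then show ?thesis using word_evens[of l m] l assms by auto
  next
    case False then show ?thesis using word_evens[of "l @ [s]" m] l assms by (auto simp: endpt_append)
  qed
qed

text \<open>By \<open>wball_evens\<close>, the ball is covered by \<open>evens m\<close> and one of its translates.\<close>

lemma card_evens: 
  assumes "r < 2 * m"
  shows "card (wball \<one> r) \<le> 2 * card (evens m)"
proof -
  obtain s where s: "s \<in> S" using S_ne by auto
  have sub: "wball \<one> r \<subseteq> evens m \<union> (\<lambda>g. inv s \<otimes> g) ` evens m"
  proof
    fix g assume g: "g \<in> wball \<one> r"
    then have "g \<in> carrier G" using wball_sub by auto
    then have "g = inv s \<otimes> (s \<otimes> g)" using s by (simp add: m_assoc[symmetric] S_carrier)
    then show "g \<in> evens m \<union> (\<lambda>g. inv s \<otimes> g) ` evens m"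
      using wball_evens[OF s g assms] by blast
  qed
  have "card (wball \<one> r) \<le> card (evens m \<union> (\<lambda>g. inv s \<otimes> g) ` evens m)"
    by (rule card_mono[OF _ sub]) (simp add: finite_evens)
  also have "\<dots> \<le> card (evens m) + card ((\<lambda>g. inv s \<otimes> g) ` evens m)" by (rule card_Un_le)
  also have "\<dots> \<le> 2 * card (evens m)" using card_image_le[OF finite_evens, of "\<lambda>g. inv s \<otimes> g" m] by simp
  finally show ?thesis .
qed

lemma evens_psi:
  "g \<in> evens m \<Longrightarrow> ret n - (real m)\<^sup>2 * ((card S)\<^sup>2 * (ret n - ret (Suc n))) \<le> q (2 * n) g"
proof -
  assume "g \<in> evens m"
  then obtain l where "set l \<subseteq> S" "length l = 2 * m" "g = endpt \<one> l" by (auto simp: evens_def)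
  then show ?thesis using psi_word[of l m n] by (simp add: psi_def)
qed

text \<open>Average \<open>psi n\<close> over the even ball \<open>evens m\<close>, on which the total mass of \<open>q (2 n)\<close> is at most one.\<close>

lemma nash:
  "ret n \<le> 1 / card (evens m) + (real m)\<^sup>2 * ((card S)\<^sup>2 * (ret n - ret (Suc n)))"
proof -
  let ?c = "(real m)\<^sup>2 * ((card S)\<^sup>2 * (ret n - ret (Suc n)))"
  have "card (evens m) * (ret n - ?c) = (\<Sum>g\<in>evens m. ret n - ?c)" by simp
  also have "\<dots> \<le> (\<Sum>g\<in>evens m. q (2 * n) g)" by (intro sum_mono evens_psi)
  also have "\<dots> \<le> 1" by (rule sum_q_le_1[OF finite_evens evens_sub])
  finally have "ret n - ?c \<le> 1 / card (evens m)"
    using card_evens_pos[of m] by (simp add: field_simps)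
  then show ?thesis by simp
qed

lemma ret_nonneg: "0 \<le> ret n"
  by (simp add: q_nonneg)

lemma ret_0: "ret 0 = 1"
  by (simp add: q_def delta_def)

text \<open>As long as the return probability exceeds \<open>2 / card (evens m)\<close>, the inequality \<open>nash\<close> makes it decrease
  by a fixed factor in each step.\<close>

lemma ret_decay:
  assumes m: "m \<ge> 1"
  shows "ret n \<le> 2 / card (evens m) + exp (- (real n / (2 * (real m)\<^sup>2 * (card S)\<^sup>2)))"
proof (cases "ret n \<le> 2 / card (evens m)")
  case False
  define b where "b = 1 / (2 * (real m)\<^sup>2 * (card S)\<^sup>2)"
  have b: "0 < b" "b \<le> 1"
  proof -
    have "1 \<le> (real m)\<^sup>2" "1 \<le> (real (card S))\<^sup>2" using m card_S_pos by simp_all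
    then have "1 \<le> 2 * (real m)\<^sup>2 * (real (card S))\<^sup>2"
      using mult_mono[of 1 "(real m)\<^sup>2" 1 "(real (card S))\<^sup>2"] by simp
    then show "b \<le> 1" by (simp add: b_def)
    show "0 < b" using m card_S_pos by (simp add: b_def)
  qed
  have step: "ret (Suc k) \<le> (1 - b) * ret k" if "k \<le> n" for k
  proof -
    have "2 / card (evens m) < ret k" using False ret_antimono[OF that] by linarith
    with nash[of k m] have "ret k / 2 \<le> (real m)\<^sup>2 * ((card S)\<^sup>2 * (ret k - ret (Suc k)))" by simp
    then have "ret k \<le> 2 * ((real m)\<^sup>2 * ((card S)\<^sup>2 * (ret k - ret (Suc k))))" by linarith
    then have "ret k \<le> 2 * (real m)\<^sup>2 * (card S)\<^sup>2 * (ret k - ret (Suc k))" by (simp only: mult.assoc)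
    then have "b * ret k \<le> b * (2 * (real m)\<^sup>2 * (card S)\<^sup>2 * (ret k - ret (Suc k)))"
      using b by (intro mult_left_mono) auto
    also have "\<dots> = b * (2 * (real m)\<^sup>2 * (card S)\<^sup>2) * (ret k - ret (Suc k))" by (simp add: mult.assoc)
    also have "b * (2 * (real m)\<^sup>2 * (card S)\<^sup>2) = 1" using m card_S_pos by (simp add: b_def)
    finally show ?thesis by (simp add: algebra_simps)
  qed
  have "ret k \<le> (1 - b) ^ k" if "k \<le> n" for k
    using that
  proof (induction k)
    case 0 then show ?case by (simp add: ret_0[simplified])
  next
    case (Suc k)
    have "ret (Suc k) \<le> (1 - b) * ret k" using Suc.prems by (intro step) auto
    also have "\<dots> \<le> (1 - b) * (1 - b) ^ k" using Suc b by (intro mult_left_mono) auto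
    finally show ?case by simp
  qed
  then have "ret n \<le> (1 - b) ^ n" by simp
  also have "\<dots> \<le> exp (- b) ^ n" using b exp_ge_add_one_self[of "- b"] by (intro power_mono) auto
  also have "\<dots> = exp (- (real n / (2 * (real m)\<^sup>2 * (card S)\<^sup>2)))"
    by (simp add: exp_of_nat_mult[symmetric] b_def)
  finally show ?thesis by (simp add: add_increasing)
qed (simp add: add_increasing2)

lemma q_le_a:
  assumes "g \<in> carrier G"
  shows "q n g \<le> ret (n div 2)"
proof -
  have ev: "q (2 * k) g \<le> ret k" if "g \<in> carrier G" for k g
    using psi_nonneg[OF that, of k] by (simp add: psi_def)
  show ?thesis
  proof (cases "even n")
    case True then show ?thesis using ev[OF assms, of "n div 2"] by simp
  next
    case False
    then have n: "n = Suc (2 * (n div 2))" by presburger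
    have "q n g = avg (q (2 * (n div 2))) g" by (subst n) (rule q_Suc[THEN fun_cong])
    also have "\<dots> \<le> avg (\<lambda>_. ret (n div 2)) g" by (rule avg_mono[OF ev assms])
    finally show ?thesis by (simp add: avg_const)
  qed
qed

text \<open>\<open>ret n - 2 * ret (Suc n) + ret (Suc (Suc n))\<close> is the squared norm of \<open>q n - q (n + 2)\<close>.\<close>

lemma ret_convex: "ret (Suc n) - ret (Suc (Suc n)) \<le> ret n - ret (Suc n)"
proof -
  have 1: "ret (Suc n) = group_sum (\<lambda>x. q n x * q (n + 2) x)"
    using q_add_one[of "n + 2" n] by (simp add: mult_2)
  have "0 \<le> group_sum (\<lambda>x. (q n x - q (n + 2) x)\<^sup>2)" by (rule group_sum_nonneg) simp
  also have "\<dots> = (group_sum (\<lambda>x. (q n x)\<^sup>2) + group_sum (\<lambda>x. (q (n + 2) x)\<^sup>2)) - 2 * group_sum (\<lambda>x. q n x * q (n + 2) x)"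
    by (rule group_sum_square_diff[OF fin_supp_q fin_supp_q])
  finally show ?thesis using 1 ret_eq[of n] ret_eq[of "n + 2"] by simp
qed

lemma ret_diff_antimono: "k \<le> n \<Longrightarrow> ret n - ret (Suc n) \<le> ret k - ret (Suc k)"
  by (rule lift_Suc_antimono_le[of "\<lambda>n. ret n - ret (Suc n)"]) (rule ret_convex)

text \<open>By convexity, the decrement at \<open>n\<close> is at most the mean of the decrements between \<open>k\<close> and \<open>n\<close>.\<close>

lemma ret_diff:
  assumes "k \<le> n"
  shows "real (n - k) * (ret n - ret (Suc n)) \<le> ret k"
proof -
  have "real (n - k) * (ret n - ret (Suc n)) = (\<Sum>i = k..<n. ret n - ret (Suc n))" by simp
  also have "\<dots> \<le> (\<Sum>i = k..<n. ret i - ret (Suc i))" by (intro sum_mono ret_diff_antimono) auto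
  also have "\<dots> = ret k - ret n"
    using sum_Suc_diff'[OF assms, of "\<lambda>i. - ret i"] by simp
  finally show ?thesis using ret_nonneg[of n] by simp
qed

section \<open>The Carne--Varopoulos bound\<close>

lemma step_wball:
  assumes "x \<in> carrier G" "g \<in> carrier G" "s \<in> S" "s \<otimes> g \<in> wball x k"
  shows "g \<in> wball x (Suc k)"
proof -
  obtain l where l: "set l \<subseteq> S" "length l \<le> k" "s \<otimes> g = endpt x l" using assms by (auto simp: wball_def)
  have "endpt x (l @ [inv s]) = g"
    using assms l(3)[symmetric] by (simp add: endpt_append m_assoc[symmetric] S_carrier)
  then show ?thesis using l assms(3) S_inv unfolding wball_def mem_Collect_eq
    by (intro exI[of _ "l @ [inv s]"]) auto
qed

lemma avg_vanish:
  assumes "\<And>x. x \<in> carrier G \<Longrightarrow> x \<notin> wball \<one> k \<Longrightarrow> f x = 0" "g \<in> carrier G" "g \<notin> wball \<one> (Suc k)"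
  shows "avg f g = 0"
proof -
  have "f (s \<otimes> g) = 0" if "s \<in> S" for s
    using assms(2,3) step_wball[of \<one> g s k] that by (intro assms(1)) (auto simp: S_carrier)
  then show ?thesis by (simp add: avg_def)
qed

lemma q_vanish: "g \<in> carrier G \<Longrightarrow> g \<notin> wball \<one> n \<Longrightarrow> q n g = 0"
proof (induction n arbitrary: g)
  case 0 then show ?case using wball_self[of \<one> 0] by (auto simp: q_def delta_def)
next
  case (Suc n) then show ?case using avg_vanish[of n "q n" g] by (simp add: q_Suc)
qed

text \<open>The Chebyshev polynomials of the first kind in the operator \<open>avg\<close>, applied to the point mass.\<close>

fun cheb :: "nat \<Rightarrow> 'a \<Rightarrow> real" where
  "cheb 0 = delta"
| "cheb (Suc 0) = avg delta"
| "cheb (Suc (Suc k)) = (\<lambda>x. 2 * avg (cheb (Suc k)) x - cheb k x)"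

lemma fin_supp_cheb: "fin_supp (cheb k)"
proof (induction k rule: cheb.induct)
  case (3 k)
  then show ?case by (auto intro!: fin_supp_diff fin_supp_mult'[of _ "\<lambda>_. 2"] fin_supp_avg)
qed (auto intro: fin_supp_delta fin_supp_avg)

lemma cheb_vanish: "g \<in> carrier G \<Longrightarrow> g \<notin> wball \<one> k \<Longrightarrow> cheb k g = 0"
proof (induction k arbitrary: g rule: cheb.induct)
  case 1 then show ?case using wball_self[of \<one> 0] by (auto simp: delta_def)
next
  case 2
  then show ?case using wball_self[of \<one> 0] by (auto intro!: avg_vanish[of 0 delta g] simp: delta_def)
next
  case (3 k)
  have "g \<notin> wball \<one> k" using 3(4) wball_mono[of k "Suc (Suc k)" \<one>] by auto
  moreover have "avg (cheb (Suc k)) g = 0" by (rule avg_vanish[OF 3(1)]) (use 3 in auto)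
  ultimately show ?case using 3 by simp
qed

lemma avg_cheb: "avg (cheb (Suc k)) x = (cheb (Suc (Suc k)) x + cheb k x) / 2"
  by simp

text \<open>The recursion of \<open>cheb\<close> is the discrete wave equation, and this quadratic form is its energy.\<close>

definition energy :: "nat \<Rightarrow> real" where
  "energy k = group_sum (\<lambda>x. (cheb (Suc k) x)\<^sup>2) + group_sum (\<lambda>x. (cheb k x)\<^sup>2)
     - 2 * group_sum (\<lambda>x. avg (cheb k) x * cheb (Suc k) x)"

lemma energy_Suc: "energy (Suc k) = energy k"
proof -
  let ?f = "cheb k" and ?h = "cheb (Suc k)"
  have fsf: "fin_supp ?f" and fsh: "fin_supp ?h" and fsa: "fin_supp (avg ?h)" by (auto intro: fin_supp_cheb fin_supp_avg)
  have "group_sum (\<lambda>x. (cheb (Suc (Suc k)) x)\<^sup>2)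
    = group_sum (\<lambda>x. (2 * avg ?h x - ?f x)\<^sup>2)"
    by (intro group_sum_cong) simp
  also have "\<dots> = group_sum (\<lambda>x. (?f x)\<^sup>2) + 4 * group_sum (\<lambda>x. (avg ?h x)\<^sup>2) - 4 * group_sum (\<lambda>x. avg ?h x * ?f x)"
    using fsf fsa by (subst group_sum_square_diff)
      (auto intro!: fin_supp_mult'[of _ "\<lambda>_. 2"] simp: group_sum_cmult power_mult_distrib mult.assoc)
  finally have 1: "group_sum (\<lambda>x. (cheb (Suc (Suc k)) x)\<^sup>2) =
    group_sum (\<lambda>x. (?f x)\<^sup>2) + 4 * group_sum (\<lambda>x. (avg ?h x)\<^sup>2) - 4 * group_sum (\<lambda>x. avg ?h x * ?f x)" .
  have "group_sum (\<lambda>x. avg ?h x * cheb (Suc (Suc k)) x)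
    = group_sum (\<lambda>x. 2 * (avg ?h x)\<^sup>2 - avg ?h x * ?f x)"
    by (intro group_sum_cong) (simp add: power2_eq_square algebra_simps)
  also have "\<dots> = 2 * group_sum (\<lambda>x. (avg ?h x)\<^sup>2) - group_sum (\<lambda>x. avg ?h x * ?f x)"
    using fsf fsa by (subst group_sum_diff) (auto intro!: fin_supp_pow2 fin_supp_mult fin_supp_mult'[of _ "\<lambda>_. 2"] simp: group_sum_cmult)
  finally have 2: "group_sum (\<lambda>x. avg ?h x * cheb (Suc (Suc k)) x)
    = 2 * group_sum (\<lambda>x. (avg ?h x)\<^sup>2) - group_sum (\<lambda>x. avg ?h x * ?f x)" .
  have 3: "group_sum (\<lambda>x. avg ?f x * ?h x) = group_sum (\<lambda>x. avg ?h x * ?f x)"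
    using avg_selfadjoint[OF fsf fsh] by (simp add: mult.commute)
  show ?thesis unfolding energy_def 1 2 3 by simp
qed

lemma energy_le: "energy k \<le> 1"
proof (induction k)
  case 0
  have "group_sum (\<lambda>x. (delta x)\<^sup>2) = 1"
    using group_sum_delta group_sum_cong[of "\<lambda>x. (delta x)\<^sup>2" delta] by (simp add: delta_def)
  moreover have "group_sum (\<lambda>x. avg delta x * avg delta x) = group_sum (\<lambda>x. (avg delta x)\<^sup>2)"
    by (simp add: power2_eq_square)
  moreover have "0 \<le> group_sum (\<lambda>x. (avg delta x)\<^sup>2)" by (rule group_sum_nonneg) simp
  ultimately show ?case by (simp add: energy_def)
qed (simp add: energy_Suc)

text \<open>Conservation of energy bounds the norm of \<open>cheb (Suc k) - avg (cheb k)\<close> by one, and \<open>avg\<close> is a contraction;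
  so the norm grows by at most one in each step.\<close>

lemma cheb_norm: "group_sum (\<lambda>x. (cheb k x)\<^sup>2) \<le> (real (Suc k))\<^sup>2"
proof (induction k)
  case 0
  show ?case
    using group_sum_delta group_sum_cong[of "\<lambda>x. (delta x)\<^sup>2" delta] by (simp add: delta_def)
next
  case (Suc k)
  let ?f = "cheb k" and ?h = "cheb (Suc k)"
  have fsf: "fin_supp ?f" and fsh: "fin_supp ?h" and fsa: "fin_supp (avg ?f)" by (auto intro: fin_supp_cheb fin_supp_avg)
  have "group_sum (\<lambda>x. (?h x - avg ?f x)\<^sup>2)
    = group_sum (\<lambda>x. (?h x)\<^sup>2) + group_sum (\<lambda>x. (avg ?f x)\<^sup>2) - 2 * group_sum (\<lambda>x. avg ?f x * ?h x)"
    by (subst group_sum_square_diff[OF fsh fsa]) (simp add: mult.commute)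
  also have "\<dots> = energy k + (group_sum (\<lambda>x. (avg ?f x)\<^sup>2) - group_sum (\<lambda>x. (?f x)\<^sup>2))"
    by (simp add: energy_def)
  also have "\<dots> \<le> 1" using energy_le[of k] avg_contraction[OF fsf] by simp
  finally have v: "group_sum (\<lambda>x. (?h x - avg ?f x)\<^sup>2) \<le> 1" .
  have "group_sum (\<lambda>x. (avg ?f x + (?h x - avg ?f x))\<^sup>2)
     \<le> (1 + 1 / real (Suc k)) * group_sum (\<lambda>x. (avg ?f x)\<^sup>2) + (1 + real (Suc k)) * group_sum (\<lambda>x. (?h x - avg ?f x)\<^sup>2)"
    by (intro group_sum_square_add fsa fin_supp_diff fsh) auto
  also have "\<dots> \<le> (1 + 1 / real (Suc k)) * (real (Suc k))\<^sup>2 + (1 + real (Suc k)) * 1"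
    using avg_contraction[OF fsf] Suc.IH v by (intro add_mono mult_left_mono) auto
  also have "\<dots> = (real (Suc (Suc k)))\<^sup>2"
    by (simp add: field_simps power2_eq_square)
  finally show ?case by simp
qed

lemma cheb_bound: "g \<in> carrier G \<Longrightarrow> \<bar>cheb k g\<bar> \<le> real (Suc k)"
proof -
  assume g: "g \<in> carrier G"
  have "(cheb k g)\<^sup>2 \<le> group_sum (\<lambda>x. (cheb k x)\<^sup>2)"
    using group_sum_finite_le[of "\<lambda>x. (cheb k x)\<^sup>2" "{g}"] g by (simp add: fin_supp_pow2 fin_supp_cheb)
  then have "(cheb k g)\<^sup>2 \<le> (real (Suc k))\<^sup>2" using cheb_norm[of k] by linarith
  then show ?thesis by (simp add: power2_le_iff_abs_le)
qed

text \<open>Averaging acts on the functions \<open>cheb k\<close> like a step of the simple random walk on the integers acts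
  on \<open>k\<close>, and \<open>cheb k\<close> vanishes outside the ball of radius \<open>k\<close>. The factor with \<open>cosh\<close> is the exponential moment
  of that walk; it replaces the binomial coefficients.\<close>

lemma avgn_cheb_bound:
  assumes "g \<in> carrier G" "g \<notin> wball \<one> R" "lam \<ge> 0"
  shows "\<bar>(avg ^^ n) (cheb k) g\<bar>
     \<le> 2 * (real k + real n + 1) * exp (- lam * R) * cosh lam ^ n * cosh (lam * k)"
proof (induction n arbitrary: k)
  case 0
  show ?case
  proof (cases "k \<le> R")
    case True
    then have "g \<notin> wball \<one> k" using assms wball_mono by blast
    then show ?thesis using cheb_vanish[of g k] assms by simp
  next
    case False
    have "exp (lam * R) \<le> exp (lam * k)" using False assms by (simp add: mult_left_mono)
    also have "\<dots> \<le> 2 * cosh (lam * k)" by (simp add: cosh_field_def)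
    finally have "1 \<le> 2 * exp (- lam * R) * cosh (lam * k)"
      by (simp add: exp_minus field_simps)
    then have "(real k + 1) * 1 \<le> (real k + 1) * (2 * exp (- lam * R) * cosh (lam * k))"
      by (intro mult_left_mono) auto
    then show ?thesis using cheb_bound[OF assms(1), of k] by (simp add: algebra_simps)
  qed
next
  case (Suc n)
  let ?b = "2 * (real k + real n + 2) * exp (- lam * R) * cosh lam ^ n"
  have b0: "0 \<le> ?b" by simp
  have *: "(avg ^^ Suc n) (cheb k) g = (avg ^^ n) (avg (cheb k)) g" by (simp add: funpow_swap1)
  show ?case
  proof (cases k)
    case 0
    have "\<bar>(avg ^^ n) (cheb 1) g\<bar> \<le> 2 * (real 1 + real n + 1) * exp (- lam * R) * cosh lam ^ n * cosh (lam * real 1)"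
      by (rule Suc.IH)
    then show ?thesis unfolding * using 0 by (simp add: algebra_simps)
  next
    case (Suc k')
    have "avg (cheb k) = (\<lambda>x. (1/2) * cheb (Suc k) x + (1/2) * cheb k' x)"
      unfolding Suc by (rule ext) (simp add: avg_cheb del: cheb.simps)
    then have e: "(avg ^^ Suc n) (cheb k) g = (1/2) * (avg ^^ n) (cheb (Suc k)) g + (1/2) * (avg ^^ n) (cheb k') g"
      unfolding * by (simp only: avgn_add avgn_cmult)
    have "\<bar>(avg ^^ n) (cheb (Suc k)) g\<bar> \<le> ?b * cosh (lam * Suc k)"
      using Suc.IH[of "Suc k"] by (simp add: algebra_simps del: cheb.simps)
    moreover have "\<bar>(avg ^^ n) (cheb k') g\<bar> \<le> ?b * cosh (lam * k')"
    proof -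
      have "\<bar>(avg ^^ n) (cheb k') g\<bar> \<le> (2 * (real k' + real n + 1) * exp (- lam * R) * cosh lam ^ n) * cosh (lam * k')"
        by (rule Suc.IH)
      also have "\<dots> \<le> ?b * cosh (lam * k')"
        using Suc by (intro mult_right_mono) auto
      finally show ?thesis .
    qed
    ultimately have "\<bar>(avg ^^ Suc n) (cheb k) g\<bar> \<le> ?b * ((cosh (lam * Suc k) + cosh (lam * k')) / 2)"
      unfolding e distrib_left add_divide_distrib times_divide_eq_right by linarith
    also have "(cosh (lam * Suc k) + cosh (lam * k')) / 2 = cosh lam * cosh (lam * k)"
    proof -
      have "lam * Suc k = lam * k + lam" "lam * k' = lam * k - lam" using Suc by (auto simp: algebra_simps)
      then show ?thesis by (simp only: cosh_add cosh_diff) simp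
    qed
    finally show ?thesis by (simp add: algebra_simps)
  qed
qed

text \<open>The preceding bound with \<open>k = 0\<close> and \<open>lam = R / (2 n)\<close>, which minimises the exponent.\<close>

lemma q_carne_varopoulos:
  assumes "g \<in> carrier G" "g \<notin> wball \<one> R" "n \<ge> 1" "n \<le> N"
  shows "q n g \<le> 2 * (real N + 1) * exp (- ((real R)\<^sup>2 / (4 * real N)))"
proof (cases "R < n")
  case False
  then have "g \<notin> wball \<one> n" using assms wball_mono[of n R \<one>] by auto
  then show ?thesis using q_vanish assms by simp
next
  case True
  define lam where "lam = real R / (2 * real n)"
  have lam: "0 \<le> lam" "lam \<le> 1" using True by (auto simp: lam_def)
  have "q n g \<le> 2 * (real n + 1) * exp (- lam * R) * cosh lam ^ n"
    using avgn_cheb_bound[OF assms(1,2) lam(1), of n 0] by (simp add: q_def)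
  also have "\<dots> \<le> 2 * (real n + 1) * exp (- lam * R) * exp (lam\<^sup>2) ^ n"
    by (intro mult_left_mono power_mono cosh_le_exp_square lam) auto
  also have "\<dots> = 2 * (real n + 1) * exp (- ((real R)\<^sup>2 / (4 * real n)))"
  proof -
    have "- lam * R + real n * lam\<^sup>2 = - ((real R)\<^sup>2 / (4 * real n))"
      using assms(3) by (simp add: lam_def field_simps power2_eq_square)
    then show ?thesis by (simp add: exp_of_nat_mult[symmetric] exp_add[symmetric] mult.assoc)
  qed
  also have "\<dots> \<le> 2 * (real N + 1) * exp (- ((real R)\<^sup>2 / (4 * real N)))"
    using assms by (intro mult_mono) (auto intro!: divide_left_mono)
  finally show ?thesis .
qed

text \<open>The Carne--Varopoulos bound summed over the ball of radius \<open>N\<close>, outside of which the walk cannot be.\<close>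

definition tail :: "nat \<Rightarrow> nat \<Rightarrow> real" where
  "tail N R = card (wball \<one> N) * (2 * (real N + 1) * exp (- ((real R)\<^sup>2 / (4 * real N))))"

lemma tail_bound:
  assumes "n \<le> N"
  shows "group_sum (\<lambda>g. if g \<in> wball \<one> R then 0 else q n g) \<le> tail N R"
proof -
  let ?e = "2 * (real N + 1) * exp (- ((real R)\<^sup>2 / (4 * real N)))"
  have sub: "wball \<one> N \<subseteq> carrier G" by (simp add: wball_sub)
  have "group_sum (\<lambda>g. if g \<in> wball \<one> R then 0 else q n g)
      = (\<Sum>g\<in>wball \<one> N. if g \<in> wball \<one> R then 0 else q n g)"
    using assms wball_mono[of n N \<one>] by (intro group_sum_eq_sum finite_wball sub) (auto intro!: q_vanish)
  also have "\<dots> \<le> (\<Sum>g\<in>wball \<one> N. ?e)"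
  proof (intro sum_mono)
    fix g assume g: "g \<in> wball \<one> N"
    show "(if g \<in> wball \<one> R then 0 else q n g) \<le> ?e"
    proof (cases "g \<in> wball \<one> R \<or> n = 0")
      case True
      then show ?thesis using wball_self[of \<one> R] by (auto simp: q_def delta_def)
    next
      case False
      then show ?thesis using q_carne_varopoulos[of g R n N] g sub assms by auto
    qed
  qed
  also have "\<dots> = tail N R" by (simp add: tail_def)
  finally show ?thesis .
qed

lemma card_wball_pos: "0 < card (wball x R)"
  using wball_self[of x R] finite_wball[of x R] by (auto simp: card_gt_0_iff)

text \<open>The return probability is the squared \<open>\<ell>\<^sup>2\<close>-norm of \<open>q n\<close>. By the Cauchy--Schwarz inequality it
  is bounded below as soon as \<open>q n\<close> puts at least half of its mass on a ball.\<close>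

lemma ret_lower:
  assumes "tail n R \<le> 1 / 2"
  shows "1 / (4 * card (wball \<one> R)) \<le> ret n"
proof -
  let ?B = "wball \<one> R"
  have sub: "?B \<subseteq> carrier G" by (simp add: wball_sub)
  have fs1: "fin_supp (\<lambda>g. if g \<in> ?B then 0 else q n g)" by (rule fin_supp_subset[OF fin_supp_q[of n]]) auto
  have fs2: "fin_supp (\<lambda>g. if g \<in> ?B then q n g else 0)" by (rule fin_supp_subset[OF fin_supp_q[of n]]) auto
  have "1 = group_sum (\<lambda>g. (if g \<in> ?B then 0 else q n g) + (if g \<in> ?B then q n g else 0))"
    unfolding group_sum_q[of n, symmetric] by (rule group_sum_cong) auto
  also have "\<dots> \<le> 1/2 + group_sum (\<lambda>g. if g \<in> ?B then q n g else 0)"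
    using tail_bound[of n n R] assms by (simp add: group_sum_add fs1 fs2)
  also have "group_sum (\<lambda>g. if g \<in> ?B then q n g else 0) = (\<Sum>g\<in>?B. q n g)"
    by (subst group_sum_eq_sum[OF finite_wball sub]) auto
  finally have h: "1/2 \<le> (\<Sum>g\<in>?B. q n g)" by simp
  have "1/4 = (1/2 :: real)\<^sup>2" by (simp add: power2_eq_square)
  also have "\<dots> \<le> (\<Sum>g\<in>?B. q n g)\<^sup>2" using h by (intro power_mono) auto
  also have "\<dots> \<le> (\<Sum>g\<in>?B. (q n g)\<^sup>2) * card ?B" by (rule sum_squared_le_sum_of_squares)
  also have "\<dots> \<le> ret n * card ?B"
    using group_sum_finite_le[of "\<lambda>g. (q n g)\<^sup>2" ?B] sub
    by (intro mult_right_mono) (auto simp: ret_eq fin_supp_pow2 fin_supp_q finite_wball)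
  finally show ?thesis
    using card_wball_pos[of \<one> R] by (simp add: field_simps)
qed

end

section \<open>A single walk\<close>

context symmetric_generators
begin

primrec steps :: "nat \<Rightarrow> 'a list pmf" where
  "steps 0 = return_pmf []"
| "steps (Suc n) = bind_pmf (pmf_of_set S) (\<lambda>s. map_pmf ((#) s) (steps n))"

lemma set_steps: "set_pmf (steps n) = {l. set l \<subseteq> S \<and> length l = n}"
proof (induction n)
  case (Suc n)
  have "set_pmf (steps (Suc n)) = (\<Union>s\<in>S. (#) s ` {l. set l \<subseteq> S \<and> length l = n})"
    using fin_S S_ne by (simp add: Suc)
  also have "\<dots> = {l. set l \<subseteq> S \<and> length l = Suc n}"
    by (auto simp: length_Suc_conv image_iff)
  finally show ?case .
qed auto

lemma finite_set_steps: "finite (set_pmf (steps n))"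
  unfolding set_steps using finite_lists_length_eq[OF fin_S, of n] by simp

lemma expectation_steps_Suc:
  fixes F :: "'a list \<Rightarrow> real"
  shows "measure_pmf.expectation (steps (Suc n)) F
    = (\<Sum>s\<in>S. measure_pmf.expectation (steps n) (\<lambda>l. F (s # l))) / card S"
proof -
  have "measure_pmf.expectation (steps (Suc n)) F
    = (\<Sum>s\<in>S. measure_pmf.expectation (map_pmf ((#) s) (steps n)) F /\<^sub>R real (card S))"
    unfolding steps.simps by (rule pmf_expectation_bind_pmf_of_set[OF S_ne fin_S]) (simp add: finite_set_steps)
  then show ?thesis by (simp add: sum_divide_distrib divide_inverse mult.commute sum_distrib_left del: steps.simps)
qed

lemma steps_take: "k \<le> n \<Longrightarrow> map_pmf (take k) (steps n) = steps k"
proof (induction k arbitrary: n)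
  case 0
  have "map_pmf (take 0) (steps n) = map_pmf (\<lambda>_. []) (steps n)" by (rule map_pmf_cong) auto
  then show ?case by (simp add: map_pmf_const)
next
  case (Suc k)
  then obtain m where m: "n = Suc m" "k \<le> m" by (cases n) auto
  have "map_pmf (take (Suc k)) (steps n) = bind_pmf (pmf_of_set S) (\<lambda>s. map_pmf ((#) s) (map_pmf (take k) (steps m)))"
    unfolding m by (simp add: map_bind_pmf pmf.map_comp o_def)
  then show ?case using Suc.IH[OF m(2)] by simp
qed

lemma expectation_take:
  fixes F :: "'a list \<Rightarrow> real"
  shows "k \<le> n \<Longrightarrow> measure_pmf.expectation (steps n) (\<lambda>l. F (take k l)) = measure_pmf.expectation (steps k) F"
  by (subst steps_take[symmetric]) auto

lemma prob_take:
  "k \<le> n \<Longrightarrow> measure_pmf.prob (steps n) {l. P (take k l)} = measure_pmf.prob (steps k) {l. P l}"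
  unfolding prob_expectation by (rule expectation_take)

lemma expectation_endpt:
  "measure_pmf.expectation (steps n) (\<lambda>l. f (endpt x l)) = (avg ^^ n) f x"
proof (induction n arbitrary: x)
  case (Suc n)
  then show ?case by (simp only: expectation_steps_Suc endpt.simps) (simp add: avg_def)
qed simp

text \<open>The Green operator, truncated at time \<open>n\<close>.\<close>

definition green :: "nat \<Rightarrow> ('a \<Rightarrow> real) \<Rightarrow> 'a \<Rightarrow> real" where
  "green n f x = (\<Sum>i\<le>n. (avg ^^ i) f x)"

lemma green_0: "green 0 f x = f x"
  by (simp add: green_def)

lemma green_Suc: "green (Suc n) f x = f x + avg (green n f) x"
proof -
  have "green (Suc n) f x = (avg ^^ 0) f x + (\<Sum>i\<le>n. (avg ^^ Suc i) f x)"
    unfolding green_def by (rule sum.atMost_Suc_shift)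
  also have "(\<Sum>i\<le>n. (avg ^^ Suc i) f x) = avg (green n f) x"
    unfolding green_def[abs_def] avg_sum by simp
  finally show ?thesis by simp
qed

lemma green_nonneg:
  "(\<And>x. x \<in> carrier G \<Longrightarrow> 0 \<le> f x) \<Longrightarrow> x \<in> carrier G \<Longrightarrow> 0 \<le> green n f x"
  unfolding green_def by (intro sum_nonneg avgn_nonneg)

lemma green_mono_n:
  "(\<And>x. x \<in> carrier G \<Longrightarrow> 0 \<le> f x) \<Longrightarrow> x \<in> carrier G \<Longrightarrow> m \<le> n \<Longrightarrow> green m f x \<le> green n f x"
  unfolding green_def by (intro sum_mono2 avgn_nonneg) auto

text \<open>Condition on the first step. The hypothesis on \<open>2 \<theta> green n f\<close> absorbs the quadratic error.\<close>

lemma khasminskii: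
  assumes "0 \<le> \<theta>" "\<And>x. x \<in> carrier G \<Longrightarrow> 0 \<le> f x"
    and "\<And>x. x \<in> carrier G \<Longrightarrow> 2 * \<theta> * green n f x \<le> 1" and "x \<in> carrier G"
  shows "measure_pmf.expectation (steps n) (\<lambda>l. exp (\<theta> * sum_list (map f (positions x l))))
    \<le> 1 + 2 * \<theta> * green n f x"
  using assms(3,4)
proof (induction n arbitrary: x)
  case 0
  have "exp (\<theta> * f x) * (1 + (2 * \<theta> * f x - 2 * (\<theta> * f x))) \<le> 1 + 2 * \<theta> * f x"
    using 0 assms(1,2) by (intro exp_weight_le) (auto simp: green_0)
  then show ?case by (simp add: green_0)
next
  case (Suc n)
  have hyp: "2 * \<theta> * green n f z \<le> 1" if "z \<in> carrier G" for z
  proof -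
    have "2 * \<theta> * green n f z \<le> 2 * \<theta> * green (Suc n) f z"
      using assms(1,2) that by (intro mult_left_mono green_mono_n) auto
    then show ?thesis using Suc.prems(1)[OF that] by linarith
  qed
  let ?phi = "\<lambda>x. measure_pmf.expectation (steps n) (\<lambda>l. exp (\<theta> * sum_list (map f (positions x l))))"
  have "measure_pmf.expectation (steps (Suc n)) (\<lambda>l. exp (\<theta> * sum_list (map f (positions x l))))
     = exp (\<theta> * f x) * avg ?phi x"
    by (simp only: expectation_steps_Suc positions.simps list.map sum_list.Cons)
      (simp add: avg_def distrib_left exp_add sum_distrib_left)
  also have "avg ?phi x \<le> avg (\<lambda>z. 1 + 2 * \<theta> * green n f z) x"
    using Suc.IH[OF hyp] Suc.prems(2) by (intro avg_mono) auto
  also have "\<dots> = 1 + (2 * \<theta> * green (Suc n) f x - 2 * (\<theta> * f x))"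
    by (simp add: avg_add avg_cmult avg_const green_Suc algebra_simps)
  finally have "measure_pmf.expectation (steps (Suc n)) (\<lambda>l. exp (\<theta> * sum_list (map f (positions x l))))
     \<le> exp (\<theta> * f x) * (1 + (2 * \<theta> * green (Suc n) f x - 2 * (\<theta> * f x)))" by simp
  also have "\<dots> \<le> 1 + 2 * \<theta> * green (Suc n) f x"
    using assms(1,2) Suc.prems by (intro exp_weight_le mult_nonneg_nonneg green_nonneg) auto
  finally show ?case .
qed

definition pt :: "'a \<Rightarrow> 'a \<Rightarrow> real" where
  "pt y x = (if x = y then 1 else 0)"

lemma green_pt:
  "x \<in> carrier G \<Longrightarrow> y \<in> carrier G \<Longrightarrow> green n (pt y) x = (\<Sum>i\<le>n. q i (x \<otimes> inv y))"
  unfolding green_def pt_def[abs_def] by (simp add: avgn_point)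

text \<open>The expected number of visits to \<open>y\<close> is at most the probability of a visit times the expected number of visits
  after the first one.\<close>

lemma hit_lower:
  assumes "x \<in> carrier G" "y \<in> carrier G"
  shows "green n (pt y) x \<le> measure_pmf.prob (steps n) {l. y \<in> set (positions x l)} * green n (pt y) y"
  using assms(1)
proof (induction n arbitrary: x)
  case 0 then show ?case by (simp add: green_0 pt_def)
next
  case (Suc n)
  let ?h = "\<lambda>n x. measure_pmf.prob (steps n) {l. y \<in> set (positions x l)}"
  have gn: "0 \<le> green k (pt y) z" if "z \<in> carrier G" for k z
    using that by (intro green_nonneg) (auto simp: pt_def)
  show ?case
  proof (cases "x = y")
    case True
    have "{l. y \<in> set (positions y l)} = UNIV"
    proof -
      have "y \<in> set (positions y l)" for l by (cases l) auto
      then show ?thesis by auto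
    qed
    then show ?thesis using True by simp
  next
    case False
    have h: "?h (Suc n) x = avg (?h n) x"
      unfolding prob_expectation using False by (simp only: expectation_steps_Suc) (simp add: avg_def)
    have "green (Suc n) (pt y) x = avg (green n (pt y)) x" using False by (simp add: green_Suc pt_def)
    also have "\<dots> \<le> avg (\<lambda>z. green n (pt y) y * ?h n z) x"
      using Suc.IH Suc.prems by (intro avg_mono) (auto simp: mult.commute)
    also have "\<dots> = green n (pt y) y * ?h (Suc n) x" by (simp add: avg_cmult h del: steps.simps)
    also have "\<dots> \<le> green (Suc n) (pt y) y * ?h (Suc n) x"
      using assms(2) by (intro mult_right_mono green_mono_n) (auto simp: pt_def)
    finally show ?thesis by (simp add: mult.commute)
  qed
qed

lemma prob_displacement:
  assumes "x \<in> carrier G" "n \<le> N"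
  shows "measure_pmf.prob (steps n) {l. endpt x l \<notin> wball x R} \<le> tail N R"
proof -
  define h where "h g = (if g \<in> wball \<one> R then 1 else 0 :: real)" for g
  have fsh: "fin_supp h" unfolding fin_supp_def by (rule finite_subset[OF _ finite_wball[of \<one> R]]) (auto simp: h_def)
  have "measure_pmf.prob (steps n) {l. endpt x l \<notin> wball x R}
      = measure_pmf.expectation (steps n) (\<lambda>l. 1 - h (endpt \<one> l))"
    unfolding prob_expectation
  proof (rule integral_cong_AE)
    show "AE l in steps n. of_bool (endpt x l \<notin> wball x R) = 1 - h (endpt \<one> l)"
      unfolding AE_measure_pmf_iff
    proof
      fix l assume "l \<in> set_pmf (steps n)"
      then have l: "set l \<subseteq> S" by (simp add: set_steps)
      then have "endpt x l \<in> wball x R \<longleftrightarrow> endpt x l \<otimes> inv x \<in> wball \<one> R"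
        using assms(1) by (intro wball_iff_quotient endpt_closed)
      also have "endpt x l \<otimes> inv x = endpt \<one> l"
        using assms(1) l by (subst endpt_one) (auto simp: m_assoc endpt_closed)
      finally show "of_bool (endpt x l \<notin> wball x R) = 1 - h (endpt \<one> l)" by (simp add: h_def)
    qed
  qed auto
  also have "\<dots> = (avg ^^ n) (\<lambda>g. 1 - h g) \<one>" by (rule expectation_endpt)
  also have "\<dots> = 1 - (avg ^^ n) h \<one>" by (simp add: avgn_diff avgn_const)
  also have "(avg ^^ n) h \<one> = group_sum (\<lambda>x. (avg ^^ n) h x * delta x)"
    using group_sum_point[of \<one> "(avg ^^ n) h"] group_sum_cong[of "\<lambda>x. (avg ^^ n) h x * delta x" "\<lambda>x. (avg ^^ n) h x * delta (x \<otimes> inv \<one>)"]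
    by simp
  also have "\<dots> = group_sum (\<lambda>x. h x * q n x)" unfolding q_def by (rule avgn_selfadjoint[OF fsh fin_supp_delta])
  also have "1 - group_sum (\<lambda>x. h x * q n x) = group_sum (\<lambda>x. q n x - h x * q n x)"
    using group_sum_q[of n] by (subst group_sum_diff) (auto intro: fin_supp_q fin_supp_mult' )
  also have "\<dots> = group_sum (\<lambda>g. if g \<in> wball \<one> R then 0 else q n g)" by (rule group_sum_cong) (simp add: h_def)
  also have "\<dots> \<le> tail N R" by (rule tail_bound[OF assms(2)])
  finally show ?thesis .
qed

lemma prob_exit:
  assumes "x \<in> carrier G" "\<tau> \<le> N"
  shows "measure_pmf.prob (steps N) {l. \<exists>z\<in>set (positions x (take \<tau> l)). z \<notin> wball x R} \<le> (real \<tau> + 1) * tail \<tau> R"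
proof -
  have "measure_pmf.prob (steps N) {l. \<exists>z\<in>set (positions x (take \<tau> l)). z \<notin> wball x R}
     \<le> measure_pmf.prob (steps N) {l. \<exists>n\<in>{..\<tau>}. endpt x (take n l) \<notin> wball x R}"
    by (rule prob_mono_support) (use assms(2) in \<open>auto simp: set_positions set_steps min_def split: if_splits\<close>)
  also have "\<dots> \<le> (\<Sum>n\<in>{..\<tau>}. measure_pmf.prob (steps N) {l. endpt x (take n l) \<notin> wball x R})"
    by (rule prob_UN_le) simp
  also have "\<dots> \<le> (\<Sum>n\<in>{..\<tau>}. tail \<tau> R)"
  proof (rule sum_mono)
    fix n assume "n \<in> {..\<tau>}"
    then have n: "n \<le> \<tau>" by simp
    have "measure_pmf.prob (steps N) {l. endpt x (take n l) \<notin> wball x R}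
       = measure_pmf.prob (steps n) {l. endpt x l \<notin> wball x R}"
      using prob_take[of n N "\<lambda>l. endpt x l \<notin> wball x R"] n assms(2) by simp
    then show "measure_pmf.prob (steps N) {l. endpt x (take n l) \<notin> wball x R} \<le> tail \<tau> R"
      using prob_displacement[OF assms(1) n, of R] by simp
  qed
  also have "\<dots> = (real \<tau> + 1) * tail \<tau> R" by simp
  finally show ?thesis .
qed

end

context symmetric_generators
begin

section \<open>The field of frogs\<close>

text \<open>Each frog in \<open>X\<close> has an independent list of \<open>N\<close> steps; the frogs outside \<open>X\<close> do not move.\<close>

definition Omega :: "'a set \<Rightarrow> nat \<Rightarrow> ('a \<Rightarrow> 'a list) pmf" where
  "Omega X N = Pi_pmf X [] (\<lambda>_. steps N)"

text \<open>\<open>wakes \<omega> x y k\<close>: starting from a woken frog at \<open>x\<close>, the site \<open>y\<close> is reached through a chain of frogs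
  whose walking times add up to at most \<open>k\<close>.\<close>

inductive wakes :: "('a \<Rightarrow> 'a list) \<Rightarrow> 'a \<Rightarrow> 'a \<Rightarrow> nat \<Rightarrow> bool" for \<omega> where
  wakes_refl: "wakes \<omega> y y k"
| wakes_step: "n \<le> length (\<omega> x) \<Longrightarrow> wakes \<omega> (endpt x (take n (\<omega> x))) y k \<Longrightarrow> wakes \<omega> x y (n + k)"

lemma wakes_le: "wakes \<omega> x y k \<Longrightarrow> k \<le> k' \<Longrightarrow> wakes \<omega> x y k'"
proof (induction arbitrary: k' rule: wakes.induct)
  case (wakes_refl y k) show ?case by (rule wakes.wakes_refl)
next
  case (wakes_step n x y k)
  have "wakes \<omega> x y (n + (k' - n))"
    by (rule wakes.wakes_step[OF wakes_step(1) wakes_step.IH]) (use wakes_step.prems in auto)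
  then show ?case using wakes_step.prems by simp
qed

lemma wakes_trans: "wakes \<omega> x z k \<Longrightarrow> wakes \<omega> z y k' \<Longrightarrow> wakes \<omega> x y (k + k')"
proof (induction rule: wakes.induct)
  case (wakes_refl z k) then show ?case by (rule wakes_le) simp
next
  case (wakes_step n x z k)
  then show ?case using wakes.wakes_step[of n \<omega> x y "k + k'"] by (simp add: add.assoc)
qed

lemma wakes_prefix:
  assumes "wakes \<omega> x y k" "\<And>z. \<exists>n. \<omega> z = take n (\<omega>' z)"
  shows "wakes \<omega>' x y k"
  using assms(1)
proof (induction rule: wakes.induct)
  case (wakes_refl y k) show ?case by (rule wakes.wakes_refl)
next
  case (wakes_step n x y k)
  obtain m where m: "\<omega> x = take m (\<omega>' x)" using assms(2) by blast
  have n: "n \<le> length (\<omega>' x)" "take n (\<omega> x) = take n (\<omega>' x)"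
    using wakes_step(1) by (auto simp: m min_def split: if_splits)
  then show ?case using wakes.wakes_step[of n \<omega>' x y k] wakes_step.IH by simp
qed

lemma wakes_hop:
  assumes "z \<in> set (positions x (take K (\<omega> x)))"
  shows "wakes \<omega> x z K"
proof -
  obtain n where n: "n \<le> length (take K (\<omega> x))" "z = endpt x (take n (take K (\<omega> x)))"
    using assms by (auto simp: set_positions)
  have "wakes \<omega> x z (n + 0)"
    using n by (intro wakes.wakes_step) (auto simp: min_def intro: wakes.wakes_refl split: if_splits)
  then show ?thesis by (rule wakes_le) (use n in simp)
qed

lemma finite_set_Omega: "finite X \<Longrightarrow> finite (set_pmf (Omega X N))"
  unfolding Omega_def by (subst set_Pi_pmf) (auto intro!: finite_PiE_dflt simp: finite_set_steps)

lemma in_set_Omega: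
  assumes "finite X" "\<omega> \<in> set_pmf (Omega X N)"
  shows "x \<in> X \<Longrightarrow> set (\<omega> x) \<subseteq> S" "x \<in> X \<Longrightarrow> length (\<omega> x) = N" "x \<notin> X \<Longrightarrow> \<omega> x = []"
  using assms unfolding Omega_def by (auto simp: set_Pi_pmf PiE_dflt_def set_steps o_def)

lemma Omega_component:
  "finite X \<Longrightarrow> x \<in> X \<Longrightarrow> measure_pmf.prob (Omega X N) {\<omega>. P (\<omega> x)} = measure_pmf.prob (steps N) {l. P l}"
proof -
  assume "finite X" "x \<in> X"
  then have "map_pmf (\<lambda>\<omega>. \<omega> x) (Omega X N) = steps N"
    unfolding Omega_def by (simp add: Pi_pmf_component)
  then show ?thesis by (metis (no_types) vimage_Collect_eq measure_map_pmf)
qed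

definition merge :: "'a set \<Rightarrow> ('a \<Rightarrow> 'a list) \<Rightarrow> ('a \<Rightarrow> 'a list) \<Rightarrow> 'a \<Rightarrow> 'a list" where
  "merge A f g x = (if x \<in> A then f x else g x)"

lemma Omega_split:
  assumes "finite X" "A \<subseteq> X"
  shows "Omega X N = map_pmf (\<lambda>(f, g). merge A f g) (pair_pmf (Omega A N) (Omega (X - A) N))"
proof -
  have "X = A \<union> (X - A)" using assms by auto
  then have "Omega X N = Pi_pmf (A \<union> (X - A)) [] (\<lambda>_. steps N)" by (simp add: Omega_def)
  also have "\<dots> = map_pmf (\<lambda>(f, g) x. if x \<in> A then f x else g x)
      (pair_pmf (Pi_pmf A [] (\<lambda>_. steps N)) (Pi_pmf (X - A) [] (\<lambda>_. steps N)))"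
    using assms by (intro Pi_pmf_union) (auto intro: finite_subset)
  finally show ?thesis by (simp add: Omega_def merge_def[abs_def])
qed

lemma Omega_split_prob:
  assumes "finite X" "A \<subseteq> X" "0 \<le> \<eta>"
    and "\<And>f. f \<in> set_pmf (Omega A N) \<Longrightarrow> \<not> Bad f \<Longrightarrow>
      measure_pmf.prob (Omega (X - A) N) {g. P (merge A f g)} \<le> \<eta>"
  shows "measure_pmf.prob (Omega X N) {\<omega>. P \<omega>} \<le> measure_pmf.prob (Omega A N) {f. Bad f} + \<eta>"
proof -
  have "measure_pmf.prob (Omega X N) {\<omega>. P \<omega>}
     = measure_pmf.prob (pair_pmf (Omega A N) (Omega (X - A) N)) {z. P (merge A (fst z) (snd z))}"
    by (subst Omega_split[OF assms(1,2)]) (simp add: vimage_def case_prod_beta)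
  also have "\<dots> \<le> measure_pmf.prob (Omega A N) {f. Bad f} + \<eta>"
    using assms finite_subset[OF assms(2,1)] by (intro prob_pair_le) (auto intro: finite_set_Omega)
  finally show ?thesis .
qed

lemma Omega_restrict:
  assumes "finite X" "A \<subseteq> X"
  shows "Omega A N = map_pmf (\<lambda>\<omega> x. if x \<in> A then \<omega> x else []) (Omega X N)"
  unfolding Omega_def by (rule Pi_pmf_subset[OF assms])

lemma Omega_expectation_prod:
  fixes F :: "'a \<Rightarrow> 'a list \<Rightarrow> real"
  assumes "finite A" "\<And>x l. x \<in> A \<Longrightarrow> 0 \<le> F x l"
  shows "measure_pmf.expectation (Omega A N) (\<lambda>\<omega>. \<Prod>x\<in>A. F x (\<omega> x))
    = (\<Prod>x\<in>A. measure_pmf.expectation (steps N) (F x))"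
  unfolding Omega_def using assms
  by (intro expectation_prod_Pi_pmf) (auto intro: integrable_measure_pmf_finite finite_set_steps)

section \<open>Occupation of sites\<close>

text \<open>Khasminskii's inequality for independent walks, followed by Markov's inequality. The factor \<open>3\<close> beats the
  factor \<open>2\<close> from the exponential moment.\<close>

lemma sum_functional_tail:
  assumes "finite A" "A \<subseteq> carrier G" "\<tau> \<le> N" "0 < \<Lambda>"
    and f: "\<And>x. x \<in> carrier G \<Longrightarrow> 0 \<le> f x"
    and bound: "\<And>x. x \<in> carrier G \<Longrightarrow> green \<tau> f x \<le> \<Lambda>"
    and total: "(\<Sum>x\<in>A. green \<tau> f x) \<le> M"
  shows "measure_pmf.prob (Omega A N)
      {\<omega>. 3 * M \<le> (\<Sum>x\<in>A. sum_list (map f (positions x (take \<tau> (\<omega> x)))))} \<le> exp (- (M / (2 * \<Lambda>)))"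
proof -
  define \<theta> where "\<theta> = 1 / (2 * \<Lambda>)"
  have \<theta>: "0 < \<theta>" "2 * \<theta> * \<Lambda> = 1" using assms(4) by (auto simp: \<theta>_def)
  let ?F = "\<lambda>\<omega>. \<Sum>x\<in>A. sum_list (map f (positions x (take \<tau> (\<omega> x))))"
  have *: "measure_pmf.expectation (steps N) (\<lambda>l. exp (\<theta> * sum_list (map f (positions x (take \<tau> l)))))
      \<le> exp (2 * \<theta> * green \<tau> f x)" if "x \<in> A" for x
  proof -
    have le1: "2 * \<theta> * green \<tau> f z \<le> 1" if "z \<in> carrier G" for z
      using mult_left_mono[OF bound[OF that], of "2 * \<theta>"] \<theta> by simp
    have "measure_pmf.expectation (steps N) (\<lambda>l. exp (\<theta> * sum_list (map f (positions x (take \<tau> l)))))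
      = measure_pmf.expectation (steps \<tau>) (\<lambda>l. exp (\<theta> * sum_list (map f (positions x l))))"
      by (rule expectation_take[OF assms(3)])
    also have "\<dots> \<le> 1 + 2 * \<theta> * green \<tau> f x"
      using that assms(2) \<theta> f le1 by (intro khasminskii) auto
    also have "\<dots> \<le> exp (2 * \<theta> * green \<tau> f x)" by (rule exp_ge_add_one_self)
    finally show ?thesis .
  qed
  have "measure_pmf.prob (Omega A N) {\<omega>. 3 * M \<le> ?F \<omega>}
     \<le> measure_pmf.expectation (Omega A N) (\<lambda>\<omega>. exp (- 3 * \<theta> * M) * exp (\<theta> * ?F \<omega>))"
    unfolding prob_expectation
  proof (intro expectation_mono_finite finite_set_Omega assms(1))
    fix \<omega>
    show "of_bool (3 * M \<le> ?F \<omega>) \<le> exp (- 3 * \<theta> * M) * exp (\<theta> * ?F \<omega>)"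
    proof (cases "3 * M \<le> ?F \<omega>")
      case True
      then have "\<theta> * (3 * M) \<le> \<theta> * ?F \<omega>" using \<theta> by (intro mult_left_mono) auto
      then have "0 \<le> - 3 * \<theta> * M + \<theta> * ?F \<omega>" by simp
      then have "1 \<le> exp (- 3 * \<theta> * M + \<theta> * ?F \<omega>)" by (simp only: one_le_exp_iff)
      then show ?thesis using True by (simp only: exp_add of_bool_eq)
    qed simp
  qed
  also have "\<dots> = exp (- 3 * \<theta> * M) * measure_pmf.expectation (Omega A N) (\<lambda>\<omega>. exp (\<theta> * ?F \<omega>))"
    by simp
  also have "measure_pmf.expectation (Omega A N) (\<lambda>\<omega>. exp (\<theta> * ?F \<omega>))
     = measure_pmf.expectation (Omega A N) (\<lambda>\<omega>. \<Prod>x\<in>A. exp (\<theta> * sum_list (map f (positions x (take \<tau> (\<omega> x))))))"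
    by (simp add: sum_distrib_left exp_sum[OF assms(1)])
  also have "\<dots> = (\<Prod>x\<in>A. measure_pmf.expectation (steps N) (\<lambda>l. exp (\<theta> * sum_list (map f (positions x (take \<tau> l))))))"
    by (rule Omega_expectation_prod[OF assms(1)]) simp
  also have "\<dots> \<le> (\<Prod>x\<in>A. exp (2 * \<theta> * green \<tau> f x))"
    by (rule prod_mono) (auto intro: * integral_nonneg_AE)
  also have "\<dots> = exp (2 * \<theta> * (\<Sum>x\<in>A. green \<tau> f x))"
    by (simp add: sum_distrib_left exp_sum[OF assms(1)])
  also have "\<dots> \<le> exp (2 * \<theta> * M)" using total \<theta> by simp
  finally have "measure_pmf.prob (Omega A N) {\<omega>. 3 * M \<le> ?F \<omega>} \<le> exp (- 3 * \<theta> * M) * exp (2 * \<theta> * M)"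
    by simp
  also have "\<dots> = exp (- (M / (2 * \<Lambda>)))" by (simp add: exp_add[symmetric] \<theta>_def)
  finally show ?thesis .
qed

text \<open>\<open>green_iter \<tau> j y x\<close> is the expected number of visits to \<open>y\<close> in the \<open>j\<close>-th generation of a branching process
  in which a new walk of length \<open>\<tau>\<close> starts at each visit of a walk.\<close>

definition green_iter :: "nat \<Rightarrow> nat \<Rightarrow> 'a \<Rightarrow> 'a \<Rightarrow> real" where
  "green_iter \<tau> j y = (green \<tau> ^^ j) (pt y)"

lemma green_iter_0: "green_iter \<tau> 0 y = pt y"
  by (simp add: green_iter_def)

lemma green_iter_Suc: "green_iter \<tau> (Suc j) y = green \<tau> (green_iter \<tau> j y)"
  by (simp add: green_iter_def)

lemma green_iter_nonneg: "x \<in> carrier G \<Longrightarrow> 0 \<le> green_iter \<tau> j y x"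
proof (induction j arbitrary: x)
  case 0 then show ?case by (simp add: green_iter_0 pt_def)
next
  case (Suc j) then show ?case by (simp add: green_iter_Suc green_nonneg)
qed

lemma sum_pt: "finite V \<Longrightarrow> set l \<subseteq> V \<Longrightarrow> (\<Sum>z\<in>V. sum_list (map (pt z) l)) = length l"
proof (induction l)
  case (Cons u l)
  have "(\<Sum>z\<in>V. pt z u) = 1" using Cons.prems by (simp add: pt_def)
  then show ?case using Cons by (simp add: sum.distrib)
qed simp

text \<open>Independent attempts, and \<open>1 - h \<le> exp (- h)\<close>.\<close>

lemma no_hit_prob:
  fixes h :: real
  assumes X: "finite X" and A: "A \<subseteq> X" and "0 \<le> h" "K \<le> N"
    and hm: "\<And>u. u \<in> A \<Longrightarrow> h \<le> measure_pmf.prob (steps K) {l. y \<in> set (positions u l)}"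
  shows "measure_pmf.prob (Omega X N) {\<omega>. \<forall>u\<in>A. y \<notin> set (positions u (take K (\<omega> u)))}
    \<le> exp (- (card A * h))"
proof -
  have finA: "finite A" using A X by (rule finite_subset)
  let ?Q = "\<lambda>u l. y \<notin> set (positions u (take K l))"
  have "measure_pmf.prob (Omega X N) {\<omega>. \<forall>u\<in>A. ?Q u (\<omega> u)}
     = measure_pmf.prob (Omega A N) {\<omega>. \<forall>u\<in>A. ?Q u (\<omega> u)}"
    unfolding Omega_restrict[OF X A] by (simp add: vimage_def)
  also have "\<dots> = measure_pmf.prob (Omega A N) (Pi A (\<lambda>u. {l. ?Q u l}))"
    by (rule arg_cong[of _ _ "measure_pmf.prob (Omega A N)"]) auto
  also have "\<dots> = (\<Prod>u\<in>A. measure_pmf.prob (steps N) {l. ?Q u l})"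
    unfolding Omega_def by (rule measure_Pi_pmf_Pi[OF finA])
  also have "\<dots> \<le> (\<Prod>u\<in>A. exp (- h))"
  proof (rule prod_mono)
    fix u assume u: "u \<in> A"
    have "measure_pmf.prob (steps N) {l. ?Q u l} = measure_pmf.prob (steps K) {l. y \<notin> set (positions u l)}"
      by (rule prob_take[OF assms(4)])
    also have "{l. y \<notin> set (positions u l)} = space (measure_pmf (steps K)) - {l. y \<in> set (positions u l)}"
      by auto
    also have "measure_pmf.prob (steps K) \<dots> = 1 - measure_pmf.prob (steps K) {l. y \<in> set (positions u l)}"
      by (rule measure_pmf.prob_compl) simp
    also have "\<dots> \<le> 1 - h" using hm[OF u] by simp
    also have "\<dots> \<le> exp (- h)" using exp_ge_add_one_self[of "- h"] by simp
    finally show "0 \<le> measure_pmf.prob (steps N) {l. ?Q u l} \<and> measure_pmf.prob (steps N) {l. ?Q u l} \<le> exp (- h)"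
      by simp
  qed
  also have "\<dots> = exp (- (card A * h))" by (simp add: exp_of_nat_mult[symmetric])
  finally show ?thesis .
qed

section \<open>Generations of woken frogs\<close>

text \<open>The exceptional event for one generation: either a frog leaves the ball of radius \<open>R\<close> around its start, or
  one of the functionals \<open>green_iter \<tau> j z\<close> summed over all visits exceeds three times its bound. The case \<open>j = 0\<close>
  counts visits to \<open>z\<close>; the cases \<open>j > 0\<close> control the later generations.\<close>

lemma generations_bad:
  assumes "finite A" "A \<subseteq> Z" "finite Z" "Z \<subseteq> carrier G" "\<tau> \<le> N" "0 < \<Lambda>" "0 \<le> M" "M \<le> M'" "m \<le> J"
    and bound: "\<And>j u z. j < m \<Longrightarrow> z \<in> Z \<Longrightarrow> u \<in> carrier G \<Longrightarrow> green_iter \<tau> (Suc j) z u \<le> \<Lambda>"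
    and total: "\<And>j z. j < m \<Longrightarrow> z \<in> Z \<Longrightarrow> (\<Sum>u\<in>A. green_iter \<tau> (Suc j) z u) \<le> M'"
  shows "measure_pmf.prob (Omega A N) {f.
      (\<exists>u\<in>A. \<exists>z\<in>set (positions u (take \<tau> (f u))). z \<notin> wball u R) \<or>
      (\<exists>j\<in>{..<m}. \<exists>z\<in>Z. 3 * M' \<le> (\<Sum>u\<in>A. sum_list (map (green_iter \<tau> j z) (positions u (take \<tau> (f u))))))}
    \<le> card Z * ((real \<tau> + 1) * tail \<tau> R) + J * card Z * exp (- (M / (2 * \<Lambda>)))"
proof -
  have sub: "A \<subseteq> carrier G" using assms(2,4) by auto
  have tail0: "0 \<le> (real \<tau> + 1) * tail \<tau> R" by (simp add: tail_def)
  have 1: "measure_pmf.prob (Omega A N) {f. \<exists>u\<in>A. \<exists>z\<in>set (positions u (take \<tau> (f u))). z \<notin> wball u R}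
    \<le> card Z * ((real \<tau> + 1) * tail \<tau> R)"
  proof -
    have "measure_pmf.prob (Omega A N) {f. \<exists>u\<in>A. \<exists>z\<in>set (positions u (take \<tau> (f u))). z \<notin> wball u R}
      \<le> (\<Sum>u\<in>A. measure_pmf.prob (Omega A N) {f. \<exists>z\<in>set (positions u (take \<tau> (f u))). z \<notin> wball u R})"
      by (rule prob_UN_le[OF assms(1)])
    also have "\<dots> \<le> (\<Sum>u\<in>A. (real \<tau> + 1) * tail \<tau> R)"
    proof (rule sum_mono)
      fix u assume u: "u \<in> A"
      have "measure_pmf.prob (Omega A N) {f. \<exists>z\<in>set (positions u (take \<tau> (f u))). z \<notin> wball u R}
        = measure_pmf.prob (steps N) {l. \<exists>z\<in>set (positions u (take \<tau> l)). z \<notin> wball u R}"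
        by (rule Omega_component[OF assms(1) u])
      also have "\<dots> \<le> (real \<tau> + 1) * tail \<tau> R" using u sub by (intro prob_exit assms(5)) auto
      finally show "measure_pmf.prob (Omega A N) {f. \<exists>z\<in>set (positions u (take \<tau> (f u))). z \<notin> wball u R}
         \<le> (real \<tau> + 1) * tail \<tau> R" .
    qed
    also have "\<dots> = card A * ((real \<tau> + 1) * tail \<tau> R)" by simp
    also have "\<dots> \<le> card Z * ((real \<tau> + 1) * tail \<tau> R)"
      using card_mono[OF assms(3,2)] tail0 by (intro mult_right_mono) auto
    finally show ?thesis .
  qed
  let ?P = "\<lambda>j z f. 3 * M' \<le> (\<Sum>u\<in>A. sum_list (map (green_iter \<tau> j z) (positions u (take \<tau> (f u)))))"
  have "measure_pmf.prob (Omega A N) {f. \<exists>j\<in>{..<m}. \<exists>z\<in>Z. ?P j z f}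
     \<le> (\<Sum>j<m. measure_pmf.prob (Omega A N) {f. \<exists>z\<in>Z. ?P j z f})"
    by (rule prob_UN_le) simp
  also have "\<dots> \<le> (\<Sum>j<m. \<Sum>z\<in>Z. measure_pmf.prob (Omega A N) {f. ?P j z f})"
    by (intro sum_mono prob_UN_le assms(3))
  also have "\<dots> \<le> (\<Sum>j<m. \<Sum>z\<in>Z. exp (- (M / (2 * \<Lambda>))))"
  proof (intro sum_mono)
    fix j z assume jz: "j \<in> {..<m}" "z \<in> Z"
    have "measure_pmf.prob (Omega A N) {f. ?P j z f} \<le> exp (- (M' / (2 * \<Lambda>)))"
      using jz bound[of j z] total[of j z] assms(1,5,6) sub
      by (intro sum_functional_tail) (auto simp: green_iter_Suc green_iter_nonneg)
    also have "\<dots> \<le> exp (- (M / (2 * \<Lambda>)))" using assms(6,8) by (simp add: divide_right_mono)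
    finally show "measure_pmf.prob (Omega A N) {f. ?P j z f} \<le> exp (- (M / (2 * \<Lambda>)))" .
  qed
  also have "\<dots> = (m * card Z) * exp (- (M / (2 * \<Lambda>)))" by simp
  also have "\<dots> \<le> (J * card Z) * exp (- (M / (2 * \<Lambda>)))"
    using assms(9) by (intro mult_right_mono) (auto simp: mult_right_mono)
  finally have 2: "measure_pmf.prob (Omega A N) {f. \<exists>j\<in>{..<m}. \<exists>z\<in>Z. ?P j z f}
     \<le> J * card Z * exp (- (M / (2 * \<Lambda>)))" by simp
  show ?thesis using prob_disj_le[of "Omega A N"] 1 2 by (rule order_trans[OF _ add_mono])
qed

text \<open>Count the visits twice: by frogs, and by sites.\<close>

lemma next_generation_card:
  assumes A: "finite A" and V: "V = (\<Union>u\<in>A. set (positions u (L u)))"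
    and len: "\<And>u. u \<in> A \<Longrightarrow> length (L u) = \<tau>"
    and few: "\<And>z. z \<in> V \<Longrightarrow> (\<Sum>u\<in>A. sum_list (map (pt z) (positions u (L u)))) \<le> c"
  shows "(real \<tau> + 1) * card A \<le> c * card V"
proof -
  have finV: "finite V" using A by (simp add: V)
  have "(real \<tau> + 1) * card A = (\<Sum>u\<in>A. real (length (positions u (L u))))"
    by (simp add: length_positions len)
  also have "\<dots> = (\<Sum>u\<in>A. \<Sum>z\<in>V. sum_list (map (pt z) (positions u (L u))))"
    by (intro sum.cong refl sum_pt[symmetric] finV) (auto simp: V)
  also have "\<dots> = (\<Sum>z\<in>V. \<Sum>u\<in>A. sum_list (map (pt z) (positions u (L u))))" by (rule sum.swap)
  also have "\<dots> \<le> (\<Sum>z\<in>V. c)" by (intro sum_mono few)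
  finally show ?thesis by (simp add: mult.commute)
qed

text \<open>Induction from the last generation backwards. \<open>X\<close> is the set of sites whose frogs have not walked yet,
  \<open>A\<close> the generation that is about to walk, and \<open>U\<close> the sites used before. The frogs of \<open>A\<close> and those of \<open>X - A\<close> are independent, so the
  induction hypothesis applies to \<open>X - A\<close> and the set of newly visited sites, conditionally on the walks from \<open>A\<close>. The
  hypothesis on the sums of \<open>green_iter\<close> says that no site is going to be visited often in the
  generations to come.\<close>

lemma generations:
  fixes x y :: 'a and \<tau> K N R J :: nat and \<Lambda> M \<rho> h \<eta> :: real
  assumes x: "x \<in> carrier G" and tauK: "\<tau> \<le> K" and KN: "K \<le> N" and L0: "0 < \<Lambda>" and M0: "0 < M"
    and bound: "\<And>j u z. 1 \<le> j \<Longrightarrow> j \<le> J \<Longrightarrow> u \<in> carrier G \<Longrightarrow> z \<in> carrier G \<Longrightarrow> green_iter \<tau> j z u \<le> \<Lambda>"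
    and rho: "1 \<le> \<rho>" "3 ^ J * M * (\<rho> + J + 1) \<le> real \<tau> + 1"
    and h0: "0 \<le> h"
    and hm: "\<And>u. u \<in> wball x (J * R) \<Longrightarrow> h \<le> measure_pmf.prob (steps K) {l. y \<in> set (positions u l)}"
  defines "Z \<equiv> wball x (J * R)"
  defines "\<eta> \<equiv> card Z * ((real \<tau> + 1) * tail \<tau> R) + J * card Z * exp (- (M / (2 * \<Lambda>)))"
  assumes "i \<le> J"
  shows "\<forall>X A U. finite X \<longrightarrow> X \<subseteq> carrier G \<longrightarrow> A \<subseteq> X \<longrightarrow> A \<subseteq> wball x (i * R) \<longrightarrow> finite U \<longrightarrow> Z \<subseteq> X \<union> U \<longrightarrow>
     card U \<le> i * card A \<longrightarrow> \<rho> ^ i \<le> card A \<longrightarrow>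
     (\<forall>j\<in>{1..J - i}. \<forall>z\<in>Z. (\<Sum>u\<in>A. green_iter \<tau> j z u) \<le> 3 ^ i * M) \<longrightarrow>
     measure_pmf.prob (Omega X N) {\<omega>. \<not> (\<exists>u\<in>A. wakes \<omega> u y ((J + 1 - i) * K))}
       \<le> real (J - i) * \<eta> + exp (- (\<rho> ^ J * h))"
  using \<open>i \<le> J\<close>
proof (induction i rule: inc_induct)
  case base
  show ?case
  proof (intro allI impI)
    fix X A U
    assume X: "finite X" "X \<subseteq> carrier G" and A: "A \<subseteq> X" "A \<subseteq> wball x (J * R)" "\<rho> ^ J \<le> card A"
    have "measure_pmf.prob (Omega X N) {\<omega>. \<not> (\<exists>u\<in>A. wakes \<omega> u y ((J + 1 - J) * K))}
       \<le> measure_pmf.prob (Omega X N) {\<omega>. \<forall>u\<in>A. y \<notin> set (positions u (take K (\<omega> u)))}"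
      by (rule prob_mono_support) (auto dest: wakes_hop)
    also have "\<dots> \<le> exp (- (card A * h))"
      by (rule no_hit_prob[OF X(1) A(1) h0 KN]) (use A hm in auto)
    also have "\<dots> \<le> exp (- (\<rho> ^ J * h))" using A(3) h0 by (simp add: mult_right_mono)
    finally show "measure_pmf.prob (Omega X N) {\<omega>. \<not> (\<exists>u\<in>A. wakes \<omega> u y ((J + 1 - J) * K))}
       \<le> real (J - J) * \<eta> + exp (- (\<rho> ^ J * h))" by simp
  qed
next
  case (step i)
  have Zfin: "finite Z" and Zsub: "Z \<subseteq> carrier G" using x by (auto simp: Z_def finite_wball dest: subsetD[OF wball_sub])
  have eta0: "0 \<le> \<eta>" using M0 by (simp add: \<eta>_def tail_def)
  show ?case
  proof (intro allI impI)
    fix X A U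
    assume X: "finite X" "X \<subseteq> carrier G" and A: "A \<subseteq> X" "A \<subseteq> wball x (i * R)"
      and U: "finite U" "Z \<subseteq> X \<union> U" "card U \<le> i * card A" and cA: "\<rho> ^ i \<le> card A"
      and group_sum: "\<forall>j\<in>{1..J - i}. \<forall>z\<in>Z. (\<Sum>u\<in>A. green_iter \<tau> j z u) \<le> 3 ^ i * M"
    have finA: "finite A" using A(1) X(1) by (rule finite_subset)
    have "i * R \<le> J * R" using step.hyps by simp
    then have AZ: "A \<subseteq> Z" using A(2) wball_mono[of "i * R" "J * R" x] by (auto simp: Z_def)
    let ?B1 = "\<lambda>f. \<exists>u\<in>A. \<exists>z\<in>set (positions u (take \<tau> (f u))). z \<notin> wball u R"
    let ?B2 = "\<lambda>f. \<exists>j\<in>{..<J - i}. \<exists>z\<in>Z. 3 * (3 ^ i * M) \<le>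
       (\<Sum>u\<in>A. sum_list (map (green_iter \<tau> j z) (positions u (take \<tau> (f u)))))"
    let ?P = "\<lambda>\<omega>. \<not> (\<exists>u\<in>A. wakes \<omega> u y ((J + 1 - i) * K))"
    let ?rest = "real (J - Suc i) * \<eta> + exp (- (\<rho> ^ J * h))"
    have bad: "measure_pmf.prob (Omega A N) {f. ?B1 f \<or> ?B2 f} \<le> \<eta>"
      unfolding \<eta>_def
    proof (rule generations_bad)
      show "M \<le> 3 ^ i * M" using M0 by simp
    qed (use finA AZ Zfin Zsub tauK KN L0 M0 group_sum step.hyps in \<open>auto intro!: bound\<close>)
    have good: "measure_pmf.prob (Omega (X - A) N) {g. ?P (merge A f g)} \<le> ?rest"
      if f: "f \<in> set_pmf (Omega A N)" and nb: "\<not> (?B1 f \<or> ?B2 f)" for f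
    proof -
      \<comment> \<open>The visited sites, and among them those with a frog that has not been used yet.\<close>
      define V where "V = (\<Union>u\<in>A. set (positions u (take \<tau> (f u))))"
      define A' where "A' = V - (U \<union> A)"
      have fS: "set (take \<tau> (f u)) \<subseteq> S" "length (take \<tau> (f u)) = \<tau>" if "u \<in> A" for u
        using in_set_Omega(1,2)[OF finA f that] tauK KN set_take_subset[of \<tau> "f u"] by auto
      have finV: "finite V" using finA by (simp add: V_def)
      have Vball: "V \<subseteq> wball x (Suc i * R)"
      proof
        fix v assume "v \<in> V"
        then obtain u where u: "u \<in> A" "v \<in> set (positions u (take \<tau> (f u)))" by (auto simp: V_def)
        then have "v \<in> wball u R" using nb by auto
        then have "v \<in> wball x (i * R + R)" using u A(2) wball_trans by blast
        then show "v \<in> wball x (Suc i * R)" by (simp add: add.commute)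
      qed
      have "Suc i * R \<le> J * R" using step.hyps by (intro mult_right_mono) auto
      then have VZ: "V \<subseteq> Z" using Vball wball_mono[of "Suc i * R" "J * R" x] by (auto simp: Z_def)
      then have Vsub: "V \<subseteq> carrier G" using Zsub by auto
      have nb2: "(\<Sum>u\<in>A. sum_list (map (green_iter \<tau> j z) (positions u (take \<tau> (f u))))) \<le> 3 ^ Suc i * M"
        if "j < J - i" "z \<in> Z" for j z
        using nb that by (force simp: not_le)
      have "(real \<tau> + 1) * card A \<le> (3 ^ Suc i * M) * card V"
      proof (rule next_generation_card[OF finA V_def])
        fix z assume "z \<in> V"
        then show "(\<Sum>u\<in>A. sum_list (map (pt z) (positions u (take \<tau> (f u))))) \<le> 3 ^ Suc i * M"
          using nb2[of 0 z] VZ step.hyps by (auto simp: green_iter_0)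
      qed (use fS in auto)
      also have "\<dots> \<le> (3 ^ J * M) * card V"
        using M0 step.hyps by (intro mult_right_mono power_increasing) auto
      finally have V1: "(real \<tau> + 1) * card A \<le> (3 ^ J * M) * card V" .
      have "(3 ^ J * M) * ((\<rho> + J + 1) * card A) \<le> (3 ^ J * M) * card V"
        using order_trans[OF mult_right_mono[OF rho(2), of "real (card A)"] V1] by (simp only: mult.assoc)
      then have V2: "(\<rho> + J + 1) * card A \<le> card V" using M0 by (simp add: mult_le_cancel_left_pos)
      have "card V \<le> card (V - (U \<union> A)) + card (U \<union> A)"
        using card_Un_le[of "V - (U \<union> A)" "U \<union> A"] card_mono[of "V - (U \<union> A) \<union> (U \<union> A)" V] finV U(1) finA by auto
      moreover have UA: "card (U \<union> A) \<le> Suc i * card A" using card_Un_le[of U A] U(3) by simp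
      ultimately have "real (card V) \<le> card A' + real (Suc i * card A)"
        unfolding A'_def of_nat_add[symmetric] of_nat_le_iff by linarith
      moreover have "real (Suc i * card A) \<le> (J + 1) * card A"
        using step.hyps by (simp add: mult_right_mono)
      ultimately have A'1: "\<rho> * card A \<le> card A'" using V2 by (simp add: algebra_simps)
      have "1 * real (card A) \<le> \<rho> * card A" using rho(1) by (intro mult_right_mono) auto
      then have A'2: "card A \<le> card A'" using A'1 by simp
      have A'3: "\<rho> ^ Suc i \<le> card A'"
        using order_trans[OF mult_left_mono[OF cA, of \<rho>] A'1] rho(1) by simp
      have A'X: "A' \<subseteq> X - A" using VZ U(2) by (auto simp: A'_def)
      have A'group_sum: "\<forall>j\<in>{1..J - Suc i}. \<forall>z\<in>Z. (\<Sum>u\<in>A'. green_iter \<tau> j z u) \<le> 3 ^ Suc i * M"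
      proof (intro ballI)
        fix j z assume j: "j \<in> {1..J - Suc i}" and z: "z \<in> Z"
        have "(\<Sum>u\<in>A'. green_iter \<tau> j z u) \<le> (\<Sum>u\<in>V. green_iter \<tau> j z u)"
          using finV Vsub by (intro sum_mono2) (auto simp: A'_def intro: green_iter_nonneg)
        also have "\<dots> \<le> (\<Sum>u\<in>A. sum (green_iter \<tau> j z) (set (positions u (take \<tau> (f u)))))"
          unfolding V_def using Vsub by (intro sum_UN_le finA green_iter_nonneg) (auto simp: V_def)
        also have "\<dots> \<le> (\<Sum>u\<in>A. sum_list (map (green_iter \<tau> j z) (positions u (take \<tau> (f u)))))"
          using Vsub by (intro sum_mono sum_set_le_sum_list green_iter_nonneg) (auto simp: V_def)
        also have "\<dots> \<le> 3 ^ Suc i * M" using j z step.hyps by (intro nb2) auto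
        finally show "(\<Sum>u\<in>A'. green_iter \<tau> j z u) \<le> 3 ^ Suc i * M" .
      qed
      have "measure_pmf.prob (Omega (X - A) N) {g. ?P (merge A f g)}
        \<le> measure_pmf.prob (Omega (X - A) N) {g. \<not> (\<exists>u\<in>A'. wakes g u y ((J + 1 - Suc i) * K))}"
      proof (rule prob_mono_support, rule notI)
        fix g assume g: "g \<in> set_pmf (Omega (X - A) N)" and P: "?P (merge A f g)"
          and "\<exists>u\<in>A'. wakes g u y ((J + 1 - Suc i) * K)"
        then obtain v where v: "v \<in> A'" "wakes g v y ((J + 1 - Suc i) * K)" by auto
        \<comment> \<open>The walks from \<open>A\<close> are empty in \<open>g\<close>, so passing to the merged configuration only prolongs walks.\<close>
        have "wakes (merge A f g) v y ((J + 1 - Suc i) * K)"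
        proof (rule wakes_prefix[OF v(2)])
          fix z
          have "z \<in> A \<Longrightarrow> g z = []" using in_set_Omega(3)[OF _ g] X(1) by auto
          then show "\<exists>n. g z = take n (merge A f g z)"
            by (cases "z \<in> A") (auto simp: merge_def intro: exI[of _ 0] exI[of _ "length (g z)"])
        qed
        moreover obtain u where u: "u \<in> A" "v \<in> set (positions u (take \<tau> (f u)))"
          using v(1) by (auto simp: A'_def V_def)
        have "wakes (merge A f g) u v \<tau>"
          using u by (intro wakes_hop) (simp add: merge_def)
        ultimately have "wakes (merge A f g) u y (\<tau> + (J + 1 - Suc i) * K)" by (rule wakes_trans[rotated])
        moreover have "\<tau> + (J + 1 - Suc i) * K \<le> (J + 1 - i) * K"
        proof -
          have "J + 1 - i = Suc (J + 1 - Suc i)" using step.hyps by simp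
          then show ?thesis using tauK by simp
        qed
        ultimately have "wakes (merge A f g) u y ((J + 1 - i) * K)" by (rule wakes_le)
        then show False using P u(1) by auto
      qed
      also have "\<dots> \<le> ?rest"
      proof (rule step.IH[rule_format, of "X - A" A' "U \<union> A"])
        show "A' \<subseteq> wball x (Suc i * R)" using Vball by (auto simp: A'_def)
        show "Z \<subseteq> X - A \<union> (U \<union> A)" using U(2) by auto
        show "card (U \<union> A) \<le> Suc i * card A'" by (rule order_trans[OF UA mult_le_mono2[OF A'2]])
        show "(\<Sum>u\<in>A'. green_iter \<tau> j z u) \<le> 3 ^ Suc i * M" if "j \<in> {1..J - Suc i}" "z \<in> Z" for j z
          using A'group_sum that by blast
      qed (use X A'X U(1) finA A'3 in auto)
      finally show ?thesis .
    qed
    have "measure_pmf.prob (Omega X N) {\<omega>. ?P \<omega>} \<le> measure_pmf.prob (Omega A N) {f. ?B1 f \<or> ?B2 f} + ?rest"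
      using eta0 by (intro Omega_split_prob X A good) auto
    also have "\<dots> \<le> \<eta> + ?rest" using bad by simp
    also have "\<dots> = real (J - i) * \<eta> + exp (- (\<rho> ^ J * h))"
    proof -
      have "J - i = Suc (J - Suc i)" using step.hyps by simp
      then show ?thesis by (simp add: algebra_simps)
    qed
    finally show "measure_pmf.prob (Omega X N) {\<omega>. ?P \<omega>} \<le> real (J - i) * \<eta> + exp (- (\<rho> ^ J * h))" .
  qed
qed

text \<open>The first generation consists of the frog at \<open>x\<close>.\<close>

lemma one_step:
  fixes x y :: 'a and \<tau> K N R J :: nat and \<Lambda> M \<rho> h :: real
  assumes x: "x \<in> carrier G" and tauK: "\<tau> \<le> K" and KN: "K \<le> N" and L0: "0 < \<Lambda>" and LM: "\<Lambda> \<le> M"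
    and bound: "\<And>j u z. 1 \<le> j \<Longrightarrow> j \<le> J \<Longrightarrow> u \<in> carrier G \<Longrightarrow> z \<in> carrier G \<Longrightarrow> green_iter \<tau> j z u \<le> \<Lambda>"
    and rho: "1 \<le> \<rho>" "3 ^ J * M * (\<rho> + J + 1) \<le> real \<tau> + 1"
    and h0: "0 \<le> h"
    and hm: "\<And>u. u \<in> wball x (J * R) \<Longrightarrow> h \<le> measure_pmf.prob (steps K) {l. y \<in> set (positions u l)}"
    and X: "finite X" "X \<subseteq> carrier G" "wball x (J * R) \<subseteq> X"
  shows "measure_pmf.prob (Omega X N) {\<omega>. \<not> wakes \<omega> x y ((J + 1) * K)}
     \<le> J * (card (wball x (J * R)) * ((real \<tau> + 1) * tail \<tau> R) + J * card (wball x (J * R)) * exp (- (M / (2 * \<Lambda>))))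
       + exp (- (\<rho> ^ J * h))"
proof -
  have M0: "0 < M" using L0 LM by linarith
  have c: "\<forall>j\<in>{1..J - 0}. \<forall>z\<in>wball x (J * R). (\<Sum>u\<in>{x}. green_iter \<tau> j z u) \<le> 3 ^ 0 * M"
  proof (intro ballI)
    fix j z assume "j \<in> {1..J - 0}" "z \<in> wball x (J * R)"
    then show "(\<Sum>u\<in>{x}. green_iter \<tau> j z u) \<le> 3 ^ 0 * M"
      using bound[of j x z] x LM wball_sub[OF x, of "J * R"] by force
  qed
  have "x \<in> X" using X(3) wball_self[of x] by auto
  note gen = generations[OF x tauK KN L0 M0 bound rho h0 hm, where i = 0]
  have "measure_pmf.prob (Omega X N) {\<omega>. \<not> (\<exists>u\<in>{x}. wakes \<omega> u y ((J + 1 - 0) * K))}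
     \<le> real (J - 0) * (card (wball x (J * R)) * ((real \<tau> + 1) * tail \<tau> R) + J * card (wball x (J * R)) * exp (- (M / (2 * \<Lambda>))))
       + exp (- (\<rho> ^ J * h))"
    by (rule gen[rule_format, where U = "{}"]) (use \<open>x \<in> X\<close> X wball_self[of x] c in auto)
  then show ?thesis by simp
qed

end

section \<open>Transition probabilities under polynomial growth\<close>

locale polynomial_growth = symmetric_generators +
  fixes D c :: real
  assumes D3: "3 \<le> D" and c0: "0 < c"
    and vol_lower: "\<And>r. 1 \<le> r \<Longrightarrow> real r powr D / c \<le> card (wball \<one> r)"
    and vol_upper: "\<And>r. 1 \<le> r \<Longrightarrow> card (wball \<one> r) \<le> c * real r powr D"
begin

text \<open>Apply \<open>ret_decay\<close> at a scale \<open>m\<close> slightly below \<open>sqrt n\<close>: the exponential term becomes negligible, and the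
  volume term loses only \<open>n powr \<delta>\<close>.\<close>

lemma ret_upper:
  assumes "0 < \<delta>" "\<delta> < D / 2"
  shows "\<exists>C>0. \<forall>n. ret n \<le> C * (real n + 1) powr (\<delta> - D / 2)"
proof -
  define \<epsilon> where "\<epsilon> = \<delta> / D"
  have \<epsilon>: "0 < \<epsilon>" "\<epsilon> < 1 / 2" "D * \<epsilon> = \<delta>" using assms D3 by (auto simp: \<epsilon>_def field_simps)
  define b where "b = 1 / (2 * (real (card S))\<^sup>2)"
  have b: "0 < b" using card_S_pos by (simp add: b_def)
  obtain C1 where C1: "C1 > 0" "\<And>n::nat. n \<ge> 1 \<Longrightarrow> exp (- (b * real n powr (2 * \<epsilon>))) \<le> C1 * real n powr (\<delta> - D / 2)"
    using exp_le_powr[OF b, of "2 * \<epsilon>" "\<delta> - D / 2"] \<epsilon> by auto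
  have main: "ret n \<le> (4 * c * 2 powr D + C1) * real n powr (\<delta> - D / 2)" if n: "n \<ge> 1" for n
  proof -
    define m where "m = nat \<lfloor>real n powr (1 / 2 - \<epsilon>)\<rfloor>"
    have n1: "1 \<le> real n powr (1 / 2 - \<epsilon>)" using n \<epsilon> by (simp add: ge_one_powr_ge_zero)
    then have m1: "1 \<le> m" by (simp add: m_def le_nat_floor)
    have mu: "real m \<le> real n powr (1 / 2 - \<epsilon>)" using n1 by (simp add: m_def)
    have ml: "real n powr (1 / 2 - \<epsilon>) / 2 \<le> real m"
    proof -
      have "real n powr (1 / 2 - \<epsilon>) < real m + 1" using n1 by (simp add: m_def)
      then show ?thesis using m1 by linarith
    qed
    have ev: "real m powr D / (2 * c) \<le> card (evens m)"
      using vol_lower[OF m1] card_evens[of m m] m1 by (simp add: field_simps)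
    have "2 / card (evens m) \<le> 2 / (real m powr D / (2 * c))"
      using ev m1 c0 card_evens_pos[of m] by (intro divide_left_mono) auto
    also have "\<dots> = 4 * c * real m powr (- D)" by (simp add: powr_minus field_simps)
    also have "\<dots> \<le> 4 * c * (real n powr (1 / 2 - \<epsilon>) / 2) powr (- D)"
      using ml n n1 c0 D3 by (intro mult_left_mono powr_mono2') auto
    also have "(real n powr (1 / 2 - \<epsilon>) / 2) powr (- D) = 2 powr D * real n powr (\<delta> - D / 2)"
    proof -
      have "(1 / 2 - \<epsilon>) * - D = \<delta> - D / 2" using \<epsilon>(3) by (simp add: algebra_simps)
      then have "(real n powr (1 / 2 - \<epsilon>)) powr (- D) = real n powr (\<delta> - D / 2)"
        by (simp only: powr_powr)
      moreover have "(x / 2) powr (- D) = 2 powr D * x powr (- D)" if "0 \<le> x" for x :: real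
        using that by (simp add: powr_divide powr_minus divide_simps)
      ultimately show ?thesis by simp
    qed
    finally have 1: "2 / card (evens m) \<le> 4 * c * 2 powr D * real n powr (\<delta> - D / 2)" by (simp add: mult.assoc)
    have "exp (- (real n / (2 * (real m)\<^sup>2 * (card S)\<^sup>2))) \<le> exp (- (b * real n powr (2 * \<epsilon>)))"
    proof -
      have "(real m)\<^sup>2 \<le> (real n powr (1 / 2 - \<epsilon>))\<^sup>2" using mu by (intro power_mono) auto
      also have "\<dots> = real n powr (1 - 2 * \<epsilon>)"
        by (simp add: power2_eq_square powr_add[symmetric])
      finally have "real n powr (2 * \<epsilon>) * (real m)\<^sup>2 \<le> real n powr (2 * \<epsilon>) * real n powr (1 - 2 * \<epsilon>)"
        by (intro mult_left_mono) auto
      also have "\<dots> = real n" using n by (simp add: powr_add[symmetric])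
      finally have "b * (real n powr (2 * \<epsilon>) * (real m)\<^sup>2) \<le> b * real n" using b by (intro mult_left_mono) auto
      then have "b * real n powr (2 * \<epsilon>) \<le> b * real n / (real m)\<^sup>2" using m1 by (simp add: field_simps)
      then show ?thesis by (simp add: b_def field_simps)
    qed
    also have "\<dots> \<le> C1 * real n powr (\<delta> - D / 2)" using C1(2) n by simp
    finally show ?thesis using ret_decay[OF m1, of n] 1 by (simp add: algebra_simps)
  qed
  define C where "C = 1 + (4 * c * 2 powr D + C1) * 2 powr (D / 2 - \<delta>)"
  have C0: "0 < 4 * c * 2 powr D + C1" using C1 c0 by (simp add: add_pos_pos)
  have "ret n \<le> C * (real n + 1) powr (\<delta> - D / 2)" for n
  proof (cases "n = 0")
    case True
    then show ?thesis using C0 ret_0 by (simp add: C_def)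
  next
    case False
    then have "ret n \<le> (4 * c * 2 powr D + C1) * real n powr (\<delta> - D / 2)" using main by simp
    also have "\<dots> \<le> (4 * c * 2 powr D + C1) * ((real n + 1) / 2) powr (\<delta> - D / 2)"
      using False C0 assms by (intro mult_left_mono powr_mono2') auto
    also have "((real n + 1) / 2) powr (\<delta> - D / 2) = 2 powr (D / 2 - \<delta>) * (real n + 1) powr (\<delta> - D / 2)"
    proof -
      have "2 powr (D / 2 - \<delta>) * 2 powr (\<delta> - D / 2) = (1::real)" by (simp add: powr_add[symmetric])
      then show ?thesis by (simp add: powr_divide field_simps)
    qed
    finally have "ret n \<le> (C - 1) * (real n + 1) powr (\<delta> - D / 2)" by (simp add: C_def mult.assoc)
    moreover have "(C - 1) * (real n + 1) powr (\<delta> - D / 2) \<le> C * (real n + 1) powr (\<delta> - D / 2)"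
      by (intro mult_right_mono) auto
    ultimately show ?thesis by linarith
  qed
  moreover have "0 < C" using C0 by (simp add: C_def add_pos_pos)
  ultimately show ?thesis by blast
qed

lemma q_upper:
  assumes "0 < \<delta>" "\<delta> < D / 2"
  shows "\<exists>C>0. \<forall>n. \<forall>g\<in>carrier G. q n g \<le> C * (real n + 1) powr (\<delta> - D / 2)"
proof -
  obtain C where C: "C > 0" "\<And>n. ret n \<le> C * (real n + 1) powr (\<delta> - D / 2)" using ret_upper[OF assms] by auto
  have "q n g \<le> C * 2 powr (D / 2 - \<delta>) * (real n + 1) powr (\<delta> - D / 2)" if "g \<in> carrier G" for n g
  proof -
    have "n + 1 \<le> 2 * (n div 2 + 1)" by presburger
    then have n: "(real n + 1) / 2 \<le> real (n div 2) + 1" by (simp only: of_nat_le_iff[symmetric, where 'a = real]) simp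
    have "q n g \<le> C * (real (n div 2) + 1) powr (\<delta> - D / 2)"
      using q_le_a[OF that, of n] C(2)[of "n div 2"] by linarith
    also have "\<dots> \<le> C * ((real n + 1) / 2) powr (\<delta> - D / 2)"
      using n C(1) assms by (intro mult_left_mono powr_mono2') auto
    also have "((real n + 1) / 2) powr (\<delta> - D / 2) = 2 powr (D / 2 - \<delta>) * (real n + 1) powr (\<delta> - D / 2)"
    proof -
      have "2 powr (D / 2 - \<delta>) * 2 powr (\<delta> - D / 2) = (1::real)" by (simp add: powr_add[symmetric])
      then show ?thesis by (simp add: powr_divide field_simps)
    qed
    finally show ?thesis by (simp add: mult.assoc)
  qed
  then show ?thesis using C(1) by (intro exI[of _ "C * 2 powr (D / 2 - \<delta>)"]) auto
qed

lemma tail_upper: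
  assumes "1 \<le> n"
  shows "tail n R \<le> 4 * c * real n powr (D + 1) * exp (- ((real R)\<^sup>2 / (4 * real n)))"
proof -
  have "tail n R \<le> (c * real n powr D) * (4 * real n * exp (- ((real R)\<^sup>2 / (4 * real n))))"
    unfolding tail_def
  proof (rule mult_mono[OF vol_upper[OF assms]])
    show "2 * (real n + 1) * exp (- ((real R)\<^sup>2 / (4 * real n))) \<le> 4 * real n * exp (- ((real R)\<^sup>2 / (4 * real n)))"
      using assms by (intro mult_right_mono) auto
  qed (use c0 in auto)
  then show ?thesis using assms by (simp add: powr_add algebra_simps)
qed

text \<open>The walk stays with high probability in a ball of radius slightly above \<open>sqrt n\<close>.\<close>

lemma ret_lower_powr:
  assumes "0 < \<delta>"
  shows "\<exists>c'>0. \<forall>\<^sub>F n in sequentially. c' * real n powr (- D / 2 - \<delta>) \<le> ret n"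
proof -
  define \<epsilon> where "\<epsilon> = \<delta> / D"
  have \<epsilon>: "0 < \<epsilon>" "D * \<epsilon> = \<delta>" using assms D3 by (auto simp: \<epsilon>_def)
  have "\<forall>\<^sub>F n::nat in sequentially. (8 * c) * real n powr (D + 1) * exp (- (1 / 4 * real n powr (2 * \<epsilon>))) \<le> exp (- (real n powr \<epsilon>))"
    using \<epsilon> by (intro eventually_poly_exp_le) auto
  then have "\<forall>\<^sub>F n in sequentially. 1 / (4 * c * 2 powr D) * real n powr (- D / 2 - \<delta>) \<le> ret n"
    using eventually_ge_at_top[of 1]
  proof eventually_elim
    case (elim n)
    define R where "R = nat \<lceil>real n powr (1 / 2 + \<epsilon>)\<rceil>"
    have n1: "1 \<le> real n powr (1 / 2 + \<epsilon>)" using elim \<epsilon> by (simp add: ge_one_powr_ge_zero)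
    have Rl: "real n powr (1 / 2 + \<epsilon>) \<le> real R" unfolding R_def by linarith
    have Ru: "real R \<le> 2 * real n powr (1 / 2 + \<epsilon>)" using n1 unfolding R_def by linarith
    have R1: "1 \<le> R" using Rl n1 by linarith
    have "real n powr (2 * \<epsilon>) / 4 \<le> (real R)\<^sup>2 / (4 * real n)"
    proof -
      have "real n powr (2 * \<epsilon>) * real n = (real n powr (1 / 2 + \<epsilon>))\<^sup>2"
        using elim by (simp add: power2_eq_square powr_add[symmetric] powr_mult_base mult.commute)
      also have "\<dots> \<le> (real R)\<^sup>2" using Rl by (intro power_mono) auto
      finally show ?thesis using elim by (simp add: field_simps)
    qed
    then have "exp (- ((real R)\<^sup>2 / (4 * real n))) \<le> exp (- (1 / 4 * real n powr (2 * \<epsilon>)))" by simp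
    then have "tail n R \<le> 4 * c * real n powr (D + 1) * exp (- (1 / 4 * real n powr (2 * \<epsilon>)))"
      by (intro order_trans[OF tail_upper[OF elim(2), of R]] mult_left_mono) (use c0 in auto)
    also have "\<dots> \<le> 1 / 2 * exp (- (real n powr \<epsilon>))" using elim(1) by simp
    also have "\<dots> \<le> 1 / 2" by simp
    finally have "1 / (4 * card (wball \<one> R)) \<le> ret n" by (rule ret_lower)
    moreover have "1 / (4 * c * 2 powr D) * real n powr (- D / 2 - \<delta>) \<le> 1 / (4 * card (wball \<one> R))"
    proof -
      have "card (wball \<one> R) \<le> c * real R powr D" by (rule vol_upper[OF R1])
      also have "\<dots> \<le> c * (2 * real n powr (1 / 2 + \<epsilon>)) powr D"
        using Ru c0 D3 by (intro mult_left_mono powr_mono2) auto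
      also have "(2 * real n powr (1 / 2 + \<epsilon>)) powr D = 2 powr D * real n powr (D / 2 + \<delta>)"
      proof -
        have "(1 / 2 + \<epsilon>) * D = D / 2 + \<delta>" using \<epsilon>(2) by (simp add: algebra_simps)
        then show ?thesis by (simp add: powr_mult powr_powr)
      qed
      finally have "1 / (4 * (c * (2 powr D * real n powr (D / 2 + \<delta>)))) \<le> 1 / (4 * card (wball \<one> R))"
        using card_wball_pos[of \<one> R] elim(2) c0 by (intro divide_left_mono mult_pos_pos) auto
      moreover have "1 / (4 * c * 2 powr D) * real n powr (- D / 2 - \<delta>) = 1 / (4 * (c * (2 powr D * real n powr (D / 2 + \<delta>))))"
      proof -
        have "- D / 2 - \<delta> = - (D / 2 + \<delta>)" by simp
        then show ?thesis by (simp only: powr_minus) (simp add: field_simps)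
      qed
      ultimately show ?thesis by simp
    qed
    ultimately show ?case by linarith
  qed
  moreover have "0 < 1 / (4 * c * 2 powr D)" using c0 by simp
  ultimately show ?thesis by blast
qed

end

context symmetric_generators
begin

section \<open>Iterated Green functions\<close>

lemma green_sum_q:
  assumes "u \<in> carrier G" "z \<in> carrier G"
    and f: "\<And>u. u \<in> carrier G \<Longrightarrow> f u \<le> (\<Sum>m\<le>N. w m * q m (u \<otimes> inv z))"
  shows "green \<tau> f u \<le> (\<Sum>i\<le>\<tau>. \<Sum>m\<le>N. w m * q (i + m) (u \<otimes> inv z))"
  unfolding green_def
proof (rule sum_mono)
  fix i
  have "(avg ^^ i) f u \<le> (avg ^^ i) (\<lambda>u. \<Sum>m\<le>N. w m * q m (u \<otimes> inv z)) u"
    by (rule avgn_mono[OF f assms(1)])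
  also have "\<dots> = (\<Sum>m\<le>N. w m * (avg ^^ i) (\<lambda>u. q m (u \<otimes> inv z)) u)"
    by (simp add: avgn_sum avgn_cmult)
  also have "\<dots> = (\<Sum>m\<le>N. w m * q (i + m) (u \<otimes> inv z))"
    using assms by (simp add: avgn_translate q_plus)
  finally show "(avg ^^ i) f u \<le> (\<Sum>m\<le>N. w m * q (i + m) (u \<otimes> inv z))" .
qed

text \<open>The \<open>(j + 1)\<close>-fold composition of the Green operator counts each time \<open>m\<close> with the number of ways to write it as
  an ordered sum of \<open>j + 1\<close> terms.\<close>

lemma green_iter_le:
  assumes "u \<in> carrier G" "z \<in> carrier G"
  shows "green_iter \<tau> (Suc j) z u \<le> (\<Sum>m\<le>Suc j * \<tau>. (real m + 1) ^ j * q m (u \<otimes> inv z))"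
  using assms(1)
proof (induction j arbitrary: u)
  case 0
  then show ?case using assms(2) by (simp add: green_iter_Suc green_iter_0 green_pt)
next
  case (Suc j)
  have nn: "0 \<le> q l (u \<otimes> inv z)" for l using Suc.prems assms(2) by (simp add: q_nonneg)
  have "green_iter \<tau> (Suc (Suc j)) z u \<le> (\<Sum>i\<le>\<tau>. \<Sum>m\<le>Suc j * \<tau>. (real m + 1) ^ j * q (i + m) (u \<otimes> inv z))"
    by (subst green_iter_Suc) (rule green_sum_q[OF Suc.prems assms(2) Suc.IH])
  also have "\<dots> \<le> (\<Sum>l\<le>\<tau> + Suc j * \<tau>. (real l + 1) ^ Suc j * q l (u \<otimes> inv z))"
    by (rule sum_diagonals_le) (rule nn)
  finally show ?case by simp
qed

end

context polynomial_growth
begin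

text \<open>The number of generations: the largest one for which the iterated Green functions stay almost bounded.\<close>

definition J :: nat where
  "J = nat \<lfloor>D / 2\<rfloor>"

lemma J_bounds: "1 \<le> J" "real J \<le> D / 2" "D / 2 < real J + 1"
  using D3 unfolding J_def by linarith+

text \<open>The weight \<open>(m + 1) ^ (j - 1)\<close> is compensated by the decay of \<open>q m\<close> up to a factor \<open>1 / (m + 1)\<close>, since \<open>j \<le> D / 2\<close>.\<close>

lemma green_iter_upper:
  assumes "0 < \<delta>" "\<delta> \<le> 1"
  shows "\<exists>C>0. \<forall>\<tau>\<ge>1. \<forall>j\<in>{1..J}. \<forall>u\<in>carrier G. \<forall>z\<in>carrier G.
     green_iter \<tau> j z u \<le> C * real \<tau> powr \<delta>"
proof -
  obtain C where C: "C > 0" "\<And>n g. g \<in> carrier G \<Longrightarrow> q n g \<le> C * (real n + 1) powr (\<delta> - D / 2)"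
    using q_upper[of \<delta>] assms D3 by auto
  let ?C = "C / \<delta> * (real J + 1) powr \<delta>"
  have "green_iter \<tau> j z u \<le> ?C * real \<tau> powr \<delta>"
    if \<tau>: "1 \<le> \<tau>" and j: "j \<in> {1..J}" and uz: "u \<in> carrier G" "z \<in> carrier G" for \<tau> j z u
  proof -
    obtain i where i: "j = Suc i" using j by (cases j) auto
    have ij: "real i + 1 \<le> D / 2" using J_bounds(2) j i by auto
    have "green_iter \<tau> j z u \<le> (\<Sum>m\<le>j * \<tau>. (real m + 1) ^ i * q m (u \<otimes> inv z))"
      unfolding i by (rule green_iter_le[OF uz])
    also have "\<dots> \<le> (\<Sum>m\<le>j * \<tau>. C * (real m + 1) powr (\<delta> - 1))"
    proof (rule sum_mono)
      fix m
      have "(real m + 1) ^ i * q m (u \<otimes> inv z) \<le> (real m + 1) powr (real i) * (C * (real m + 1) powr (\<delta> - D / 2))"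
        using uz by (subst powr_realpow) (auto intro!: mult_left_mono C(2))
      also have "\<dots> = C * (real m + 1) powr (real i + (\<delta> - D / 2))" by (simp add: powr_add)
      also have "\<dots> \<le> C * (real m + 1) powr (\<delta> - 1)"
        using C(1) ij by (intro mult_left_mono powr_mono) auto
      finally show "(real m + 1) ^ i * q m (u \<otimes> inv z) \<le> C * (real m + 1) powr (\<delta> - 1)" .
    qed
    also have "\<dots> = C * (\<Sum>m\<le>j * \<tau>. (real m + 1) powr (\<delta> - 1))" by (rule sum_distrib_left[symmetric])
    also have "\<dots> \<le> C * ((real (j * \<tau>) + 1) powr \<delta> / \<delta>)"
      using C(1) by (intro mult_left_mono sum_powr_le assms) auto
    also have "(real (j * \<tau>) + 1) powr \<delta> \<le> ((real J + 1) * real \<tau>) powr \<delta>"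
    proof (rule powr_mono2)
      have "real j * real \<tau> \<le> real J * real \<tau>" using j by (intro mult_right_mono) auto
      then show "real (j * \<tau>) + 1 \<le> (real J + 1) * real \<tau>"
        unfolding of_nat_mult distrib_right using \<tau> by linarith
    qed (use assms in auto)
    finally show ?thesis using C(1) assms by (simp add: powr_mult divide_right_mono mult_left_mono)
  qed
  moreover have "0 < ?C" using C(1) assms by simp
  ultimately show ?thesis by blast
qed

text \<open>The lower bound on the return probability extends to the elements of even length up to slightly below
  \<open>sqrt K\<close>, by \<open>evens_psi\<close> and \<open>ret_diff\<close>. An element of odd length is reached by one more step. The sum over
  times between \<open>K / 4\<close> and \<open>K\<close> gains a factor \<open>K\<close>.\<close>

lemma green_lower:
  assumes "0 < \<delta>" "\<delta> < 1 / 2"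
  shows "\<exists>c'>0. \<forall>\<^sub>F K in sequentially. \<forall>r g. g \<in> wball \<one> r \<longrightarrow> real r \<le> real K powr (1 / 2 - \<delta>) \<longrightarrow>
      c' * real K powr (1 - D / 2 - \<delta>) \<le> (\<Sum>i\<le>K. q i g)"
proof -
  define \<epsilon> where "\<epsilon> = \<delta> / 4"
  have \<epsilon>: "0 < \<epsilon>" "\<epsilon> < D / 2" "\<delta> = 4 * \<epsilon>" using assms D3 by (auto simp: \<epsilon>_def)
  obtain C where C: "C > 0" "\<And>n. ret n \<le> C * (real n + 1) powr (\<epsilon> - D / 2)"
    using ret_upper[OF \<epsilon>(1,2)] by auto
  obtain c1 where c1: "c1 > 0" "\<forall>\<^sub>F n in sequentially. c1 * real n powr (- D / 2 - \<epsilon>) \<le> ret n"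
    using ret_lower_powr[OF \<epsilon>(1)] by auto
  obtain n1 where n1: "\<And>n. n \<ge> n1 \<Longrightarrow> c1 * real n powr (- D / 2 - \<epsilon>) \<le> ret n"
    using c1(2) by (auto simp: eventually_sequentially)
  define s where "s = real (card S)"
  have s: "1 \<le> s" using card_S_pos by (simp add: s_def)
  define C2 where "C2 = 64 * s\<^sup>2 * C * 16 powr (D / 2 - \<epsilon>)"
  define c' where "c' = c1 / (16 * s)"
  have "\<forall>\<^sub>F K::nat in sequentially. (2 * C2 / c1) * real K powr (- 2 * \<delta> + \<epsilon> - D / 2) \<le> real K powr (- D / 2 - \<epsilon>)"
    using \<epsilon> by (intro eventually_powr_le) auto
  then have "\<forall>\<^sub>F K in sequentially. \<forall>r g. g \<in> wball \<one> r \<longrightarrow> real r \<le> real K powr (1 / 2 - \<delta>) \<longrightarrow>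
      c' * real K powr (1 - D / 2 - \<delta>) \<le> (\<Sum>i\<le>K. q i g)"
    using eventually_ge_at_top[of "8 + 4 * n1 + 4"]
  proof eventually_elim
    case (elim K)
    show ?case
    proof (intro allI impI)
      fix r g assume g: "g \<in> wball \<one> r" and r: "real r \<le> real K powr (1 / 2 - \<delta>)"
      then have gc: "g \<in> carrier G" using wball_sub by auto
      obtain t where t: "t \<in> S" using S_ne by auto
      define m where "m = Suc r"
      have K1: "1 \<le> real K powr (1 / 2 - \<delta>)" using elim(2) assms by (simp add: ge_one_powr_ge_zero)
      have m2: "(real m)\<^sup>2 \<le> 4 * real K powr (1 - 2 * \<delta>)"
      proof -
        have "real m \<le> 2 * real K powr (1 / 2 - \<delta>)" using r K1 by (simp add: m_def)
        then have "(real m)\<^sup>2 \<le> (2 * real K powr (1 / 2 - \<delta>))\<^sup>2" by (intro power_mono) auto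
        also have "\<dots> = 4 * real K powr (1 - 2 * \<delta>)"
          by (simp add: power2_eq_square powr_add[symmetric])
        finally show ?thesis .
      qed
      \<comment> \<open>The times \<open>2 n\<close> and \<open>2 n + 1\<close> with \<open>n0 \<le> n < 2 n0\<close> are at most \<open>K\<close> and of order \<open>K\<close>.\<close>
      define n0 where "n0 = K div 4"
      have n0: "n1 \<le> n0" "1 \<le> n0" "real K / 8 \<le> real n0" "4 * n0 \<le> K"
        using elim(2) unfolding n0_def by linarith+
      have lower: "c1 / 2 * real K powr (- D / 2 - \<epsilon>) \<le> q (2 * n) h"
        if n: "n0 \<le> n" "n < 2 * n0" and h: "h \<in> evens m" for n h
      proof -
        have A: "c1 * real K powr (- D / 2 - \<epsilon>) \<le> ret n"
        proof -
          have "c1 * real K powr (- D / 2 - \<epsilon>) \<le> c1 * real n powr (- D / 2 - \<epsilon>)"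
            using n n0 D3 \<epsilon> c1(1) by (intro mult_left_mono powr_mono2') auto
          also have "\<dots> \<le> ret n" using n n0(1) by (intro n1) auto
          finally show ?thesis .
        qed
        define k where "k = n0 div 2"
        have k: "real n0 / 2 \<le> real k + 1" "k \<le> n" "real n0 / 2 \<le> real (n - k)"
          using n n0(2) unfolding k_def by linarith+
        have ak: "ret k \<le> C * (real K / 16) powr (\<epsilon> - D / 2)"
        proof -
          have "C * (real k + 1) powr (\<epsilon> - D / 2) \<le> C * (real K / 16) powr (\<epsilon> - D / 2)"
            using k(1) n0 elim(2) \<epsilon>(2) C(1) by (intro mult_left_mono powr_mono2') auto
          then show ?thesis using C(2)[of k] by linarith
        qed
        have d0: "0 \<le> ret n - ret (Suc n)" using ret_antimono_Suc[of n] by simp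
        have "real K / 16 * (ret n - ret (Suc n)) \<le> real (n - k) * (ret n - ret (Suc n))"
          using k(3) n0(3) d0 by (intro mult_right_mono) auto
        also have "\<dots> \<le> ret k" by (rule ret_diff[OF k(2)])
        also have "\<dots> \<le> C * (real K / 16) powr (\<epsilon> - D / 2)" by (rule ak)
        finally have diff: "ret n - ret (Suc n) \<le> 16 * C * (real K / 16) powr (\<epsilon> - D / 2) / real K"
          using elim(2) by (simp add: field_simps)
        have "(real m)\<^sup>2 * (s\<^sup>2 * (ret n - ret (Suc n)))
          \<le> (4 * real K powr (1 - 2 * \<delta>)) * (s\<^sup>2 * (16 * C * (real K / 16) powr (\<epsilon> - D / 2) / real K))"
          using m2 diff d0 by (intro mult_mono) auto
        also have "\<dots> = C2 * real K powr (- 2 * \<delta> + \<epsilon> - D / 2)"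
        proof -
          have e: "- 2 * \<delta> + \<epsilon> - D / 2 = (1 - 2 * \<delta>) + (\<epsilon> - D / 2) - 1" by simp
          have "(real K / 16) powr (\<epsilon> - D / 2) = 16 powr (D / 2 - \<epsilon>) * real K powr (\<epsilon> - D / 2)"
          proof -
            have "16 powr (D / 2 - \<epsilon>) * 16 powr (\<epsilon> - D / 2) = (1::real)" by (simp add: powr_add[symmetric])
            then show ?thesis by (simp add: powr_divide field_simps)
          qed
          moreover have "real K powr (- 2 * \<delta> + \<epsilon> - D / 2)
            = real K powr (1 - 2 * \<delta>) * real K powr (\<epsilon> - D / 2) / real K"
            unfolding e powr_diff powr_add using elim(2) by simp
          ultimately show ?thesis by (simp add: C2_def)
        qed
        also have "\<dots> \<le> c1 / 2 * real K powr (- D / 2 - \<epsilon>)"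
          using elim(1) c1(1) by (simp add: field_simps)
        finally have "(real m)\<^sup>2 * ((card S)\<^sup>2 * (ret n - ret (Suc n))) \<le> c1 / 2 * real K powr (- D / 2 - \<epsilon>)"
          by (simp add: s_def)
        then show ?thesis using evens_psi[OF h, of n] A by simp
      qed
      have pair: "c1 / (2 * s) * real K powr (- D / 2 - \<epsilon>) \<le> q (2 * n) g + q (2 * n + 1) g"
        if n: "n0 \<le> n" "n < 2 * n0" for n
      proof -
        have q0: "0 \<le> q i g" for i using gc by (rule q_nonneg)
        have s1: "c1 / (2 * s) * real K powr (- D / 2 - \<epsilon>) = (c1 / 2 * real K powr (- D / 2 - \<epsilon>)) / s" by simp
        have pos: "0 \<le> c1 / 2 * real K powr (- D / 2 - \<epsilon>)" using c1(1) by simp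
        consider "g \<in> evens m" | "t \<otimes> g \<in> evens m"
          using wball_evens[OF t g, of m] by (auto simp: m_def)
        then show ?thesis
        proof cases
          case 1
          have "(c1 / 2 * real K powr (- D / 2 - \<epsilon>)) / s \<le> (c1 / 2 * real K powr (- D / 2 - \<epsilon>)) / 1"
            using s pos by (intro divide_left_mono) auto
          then show ?thesis using lower[OF n 1] q0[of "2 * n + 1"] unfolding s1 by linarith
        next
          case 2
          have "q (2 * n) (t \<otimes> g) \<le> (\<Sum>t\<in>S. q (2 * n) (t \<otimes> g))"
            using t fin_S gc by (intro member_le_sum) (auto simp: q_nonneg S_carrier)
          then have "q (2 * n) (t \<otimes> g) / s \<le> q (2 * n + 1) g"
            using s by (simp add: q_Suc avg_def s_def divide_right_mono)
          moreover have "(c1 / 2 * real K powr (- D / 2 - \<epsilon>)) / s \<le> q (2 * n) (t \<otimes> g) / s"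
            using lower[OF n 2] s by (intro divide_right_mono) auto
          ultimately show ?thesis using q0[of "2 * n"] unfolding s1 by linarith
        qed
      qed
      have "c' * real K powr (1 - D / 2 - \<delta>) \<le> c' * real K powr (1 - D / 2 - \<epsilon>)"
        using elim(2) \<epsilon> c1(1) s by (intro mult_left_mono powr_mono) (auto simp: c'_def)
      also have "\<dots> = real K / 8 * (c1 / (2 * s) * real K powr (- D / 2 - \<epsilon>))"
      proof -
        have "1 - D / 2 - \<epsilon> = 1 + (- D / 2 - \<epsilon>)" by simp
        then show ?thesis using elim(2) by (simp only: powr_add) (simp add: c'_def)
      qed
      also have "\<dots> \<le> real n0 * (c1 / (2 * s) * real K powr (- D / 2 - \<epsilon>))"
        using n0(3) c1(1) s by (intro mult_right_mono) auto
      also have "\<dots> = (\<Sum>n = n0..<2 * n0. c1 / (2 * s) * real K powr (- D / 2 - \<epsilon>))" by simp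
      also have "\<dots> \<le> (\<Sum>n = n0..<2 * n0. q (2 * n) g + q (2 * n + 1) g)"
        by (intro sum_mono pair) auto
      also have "\<dots> \<le> (\<Sum>n = 0..<2 * n0. q (2 * n) g + q (2 * n + 1) g)"
        using gc by (intro sum_mono2) (auto simp: q_nonneg)
      also have "\<dots> = (\<Sum>i<2 * (2 * n0). q i g)"
        by (rule sum_pairs)
      also have "\<dots> \<le> (\<Sum>i\<le>K. q i g)"
        using gc n0(4) by (intro sum_mono2) (auto simp: q_nonneg)
      finally show "c' * real K powr (1 - D / 2 - \<delta>) \<le> (\<Sum>i\<le>K. q i g)" .
    qed
  qed
  moreover have "0 < c'" using c1(1) s by (simp add: c'_def)
  ultimately show ?thesis by blast
qed

end

context polynomial_growth
begin

section \<open>Waking a neighbour\<close>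

text \<open>Here all exponents are fixed. With \<open>\<delta>\<close> small, \<open>\<tau>\<close> is about \<open>K powr (1 - 4 \<delta>)\<close> and \<open>R\<close> about
  \<open>K powr (1 / 2 - 3 \<delta> / 2)\<close>. Then \<open>R\<^sup>2 / \<tau>\<close> is at least \<open>K powr \<delta>\<close>, so walks of length \<open>\<tau>\<close> rarely leave a ball of radius \<open>R\<close>,
  while \<open>J R\<close> stays below \<open>K powr (1 / 2 - \<delta>)\<close>, the range of \<open>green_lower\<close>.\<close>

lemma one_step_tail:
  "\<exists>\<kappa>>0. \<forall>\<^sub>F K in sequentially. \<forall>N X x s. K \<le> N \<longrightarrow> x \<in> carrier G \<longrightarrow> s \<in> S \<longrightarrow>
     finite X \<longrightarrow> X \<subseteq> carrier G \<longrightarrow> wball x K \<subseteq> X \<longrightarrow>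
     measure_pmf.prob (Omega X N) {\<omega>. \<not> wakes \<omega> x (s \<otimes> x) ((J + 1) * K)} \<le> exp (- (real K powr \<kappa>))"
proof -
  define \<gamma> where "\<gamma> = real J + 1 - D / 2"
  \<comment> \<open>The final exponent is \<open>\<gamma> - (7 J + 2) \<delta>\<close>; this choice makes it equal to \<open>\<delta>\<close>.\<close>
  define \<delta> where "\<delta> = \<gamma> / (7 * real J + 3)"
  have \<gamma>: "0 < \<gamma>" "\<gamma> \<le> 1" using J_bounds by (auto simp: \<gamma>_def)
  have \<delta>0: "0 < \<delta>" using \<gamma> by (simp add: \<delta>_def)
  have \<delta>1: "\<delta> \<le> 1 / 10"
  proof -
    have "\<gamma> / (7 * real J + 3) \<le> 1 / 10" using \<gamma> J_bounds(1) by (intro frac_le) auto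
    then show ?thesis by (simp add: \<delta>_def)
  qed
  have \<delta>\<gamma>: "\<gamma> = (7 * real J + 3) * \<delta>" by (simp add: \<delta>_def)
  obtain C where C: "C > 0" "\<And>\<tau> j u z. 1 \<le> \<tau> \<Longrightarrow> j \<in> {1..J} \<Longrightarrow> u \<in> carrier G \<Longrightarrow> z \<in> carrier G \<Longrightarrow>
      green_iter \<tau> j z u \<le> C * real \<tau> powr \<delta>"
    using green_iter_upper[of \<delta>] \<delta>0 \<delta>1 by auto
  obtain c' where c': "c' > 0" "\<forall>\<^sub>F K in sequentially. \<forall>r g. g \<in> wball \<one> r \<longrightarrow> real r \<le> real K powr (1 / 2 - \<delta>) \<longrightarrow>
      c' * real K powr (1 - D / 2 - \<delta>) \<le> (\<Sum>i\<le>K. q i g)"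
    using green_lower[of \<delta>] \<delta>0 \<delta>1 by auto
  define c2 where "c2 = c' / C"
  have c2: "0 < c2" using c' C by (simp add: c2_def)
  define b where "b = min (1 / 4) c2"
  have b: "0 < b" "b \<le> 1 / 4" "b \<le> c2" using c2 by (auto simp: b_def)
  define P where "P = real J * (c * (real J * 2) powr D * (8 * c) + real J * (c * (real J * 2) powr D)) + 1"
  have JR: "\<forall>\<^sub>F K::nat in sequentially. (real J * 2 + 1) * real K powr (1 / 2 - 3 / 2 * \<delta>) \<le> real K powr (1 / 2 - \<delta>)"
    using \<delta>0 by (intro eventually_powr_le) auto
  have RHO: "\<forall>\<^sub>F K::nat in sequentially. (3 ^ J * C * (real J + 2)) * real K powr (1 - 5 * \<delta>) \<le> real K powr (1 - 4 * \<delta>)"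
    using \<delta>0 by (intro eventually_powr_le) auto
  have LM: "\<forall>\<^sub>F K::nat in sequentially. 1 * real K powr 0 \<le> real K powr \<delta>"
    using \<delta>0 by (intro eventually_powr_le) auto
  have FIN: "\<forall>\<^sub>F K::nat in sequentially. P * real K powr (2 * D + 2) * exp (- (b * real K powr \<delta>)) \<le> exp (- (real K powr (\<delta> / 2)))"
    using \<delta>0 b by (intro eventually_poly_exp_le) auto
  have "\<forall>\<^sub>F K in sequentially. \<forall>N X x s. K \<le> N \<longrightarrow> x \<in> carrier G \<longrightarrow> s \<in> S \<longrightarrow>
     finite X \<longrightarrow> X \<subseteq> carrier G \<longrightarrow> wball x K \<subseteq> X \<longrightarrow>
     measure_pmf.prob (Omega X N) {\<omega>. \<not> wakes \<omega> x (s \<otimes> x) ((J + 1) * K)} \<le> exp (- (real K powr (\<delta> / 2)))"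
    using c'(2) JR RHO LM FIN eventually_ge_at_top[of 1]
  proof eventually_elim
    case (elim K)
    have K1: "1 \<le> real K" using elim(6) by simp
    have Kge1: "1 \<le> real K powr e" if "0 \<le> e" for e using K1 that by (rule ge_one_powr_ge_zero)
    \<comment> \<open>\<open>M\<close> exceeds \<open>\<Lambda>\<close> by the factor \<open>K powr \<delta>\<close>, which becomes the exponent of the tail.\<close>
    define \<tau> where "\<tau> = nat \<lfloor>real K powr (1 - 4 * \<delta>)\<rfloor>"
    define R where "R = nat \<lceil>real K powr (1 / 2 - 3 / 2 * \<delta>)\<rceil>"
    define \<Lambda> where "\<Lambda> = C * real K powr \<delta>"
    define M where "M = C * real K powr (2 * \<delta>)"
    define \<rho> where "\<rho> = real K powr (1 - 7 * \<delta>)"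
    define h where "h = c2 * real K powr (1 - D / 2 - 2 * \<delta>)"
    have t1: "1 \<le> real K powr (1 - 4 * \<delta>)" using \<delta>1 by (intro Kge1) auto
    have tau1: "1 \<le> \<tau>" unfolding \<tau>_def using t1 by (simp add: le_nat_floor)
    have tauu: "real \<tau> \<le> real K powr (1 - 4 * \<delta>)" unfolding \<tau>_def using t1 by simp
    have taul: "real K powr (1 - 4 * \<delta>) \<le> real \<tau> + 1" unfolding \<tau>_def by linarith
    have "real K powr (1 - 4 * \<delta>) \<le> real K powr 1" using K1 \<delta>0 by (intro powr_mono) auto
    then have tauK: "\<tau> \<le> K" using tauu K1 by simp
    have r1: "1 \<le> real K powr (1 / 2 - 3 / 2 * \<delta>)" using \<delta>1 by (intro Kge1) auto
    have Rl: "real K powr (1 / 2 - 3 / 2 * \<delta>) \<le> real R" unfolding R_def by linarith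
    have Ru: "real R \<le> 2 * real K powr (1 / 2 - 3 / 2 * \<delta>)" unfolding R_def using r1 by linarith
    have JR1: "real (J * R + 1) \<le> real K powr (1 / 2 - \<delta>)"
    proof -
      have "real (J * R + 1) \<le> real J * (2 * real K powr (1 / 2 - 3 / 2 * \<delta>)) + real K powr (1 / 2 - 3 / 2 * \<delta>)"
        using mult_left_mono[OF Ru, of "real J"] r1 by simp
      also have "\<dots> = (real J * 2 + 1) * real K powr (1 / 2 - 3 / 2 * \<delta>)" by (simp add: algebra_simps)
      finally show ?thesis using elim(2) by linarith
    qed
    have "real K powr (1 / 2 - \<delta>) \<le> real K powr 1" using K1 \<delta>0 by (intro powr_mono) auto
    then have "real (J * R) \<le> real K" using JR1 K1 by simp
    then have JRK: "J * R \<le> K" by (simp only: of_nat_le_iff)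
    have L0: "0 < \<Lambda>" using C(1) K1 by (simp add: \<Lambda>_def)
    have LM: "\<Lambda> \<le> M" unfolding \<Lambda>_def M_def using C(1) K1 \<delta>0 by (intro mult_left_mono powr_mono) auto
    have rho1: "1 \<le> \<rho>" unfolding \<rho>_def using \<delta>1 by (intro Kge1) auto
    \<comment> \<open>The loss of \<open>2 \<delta>\<close> from \<open>M\<close> and of \<open>4 \<delta>\<close> from \<open>\<tau>\<close> leaves room for \<open>\<rho>\<close> with a loss of \<open>7 \<delta>\<close>.\<close>
    have rho2: "3 ^ J * M * (\<rho> + J + 1) \<le> real \<tau> + 1"
    proof -
      have "\<rho> + J + 1 \<le> (real J + 2) * \<rho>"
        using mult_left_mono[OF rho1, of "real J + 1"] by (simp add: algebra_simps)
      then have "3 ^ J * M * (\<rho> + J + 1) \<le> 3 ^ J * M * ((real J + 2) * \<rho>)"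
        using C(1) by (intro mult_left_mono) (auto simp: M_def)
      also have "\<dots> = (3 ^ J * C * (real J + 2)) * (real K powr (2 * \<delta>) * real K powr (1 - 7 * \<delta>))"
        by (simp add: M_def \<rho>_def)
      also have "real K powr (2 * \<delta>) * real K powr (1 - 7 * \<delta>) = real K powr (1 - 5 * \<delta>)"
        by (simp add: powr_add[symmetric])
      finally show ?thesis using elim(3) taul by linarith
    qed
    have h0: "0 \<le> h" using c2 by (simp add: h_def)
    have hit: "h \<le> measure_pmf.prob (steps K) {l. s \<otimes> x \<in> set (positions u l)}"
      if x: "x \<in> carrier G" and s: "s \<in> S" and u: "u \<in> wball x (J * R)" for x s u
    proof -
      let ?y = "s \<otimes> x"
      let ?p = "measure_pmf.prob (steps K) {l. ?y \<in> set (positions u l)}"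
      have uc: "u \<in> carrier G" using u wball_sub[OF x] by auto
      have yc: "?y \<in> carrier G" using x s by (simp add: S_carrier)
      have "x \<in> wball ?y 1"
        using step_wball[OF yc x s wball_self[of ?y 0]] by simp
      then have "u \<in> wball ?y (1 + J * R)" using u by (rule wball_trans)
      then have "u \<otimes> inv ?y \<in> wball \<one> (J * R + 1)" using wball_iff_quotient[OF yc uc] by simp
      then have "c' * real K powr (1 - D / 2 - \<delta>) \<le> (\<Sum>i\<le>K. q i (u \<otimes> inv ?y))"
        using elim(1) JR1 by blast
      also have "\<dots> = green K (pt ?y) u" using green_pt[OF uc yc] by simp
      also have "\<dots> \<le> ?p * green K (pt ?y) ?y" by (rule hit_lower[OF uc yc])
      also have "\<dots> \<le> ?p * (C * real K powr \<delta>)"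
        using C(2)[of K 1 ?y ?y] elim(6) J_bounds(1) yc
        by (intro mult_left_mono) (auto simp: green_iter_Suc green_iter_0)
      finally have "c' * real K powr (1 - D / 2 - \<delta>) / (C * real K powr \<delta>) \<le> ?p"
        using C(1) K1 by (simp add: field_simps)
      moreover have "c' * real K powr (1 - D / 2 - \<delta>) / (C * real K powr \<delta>) = h"
      proof -
        have "1 - D / 2 - 2 * \<delta> = (1 - D / 2 - \<delta>) - \<delta>" by simp
        then show ?thesis unfolding h_def c2_def by (simp only: powr_diff) simp
      qed
      ultimately show ?thesis by simp
    qed
    have tailb: "(real \<tau> + 1) * tail \<tau> R \<le> 8 * c * real K powr (D + 2) * exp (- (b * real K powr \<delta>))"
    proof -
      have e: "exp (- ((real R)\<^sup>2 / (4 * real \<tau>))) \<le> exp (- (b * real K powr \<delta>))"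
      proof -
        have "real K powr \<delta> * real \<tau> \<le> real K powr \<delta> * real K powr (1 - 4 * \<delta>)"
          using tauu by (intro mult_left_mono) auto
        also have "\<dots> = (real K powr (1 / 2 - 3 / 2 * \<delta>))\<^sup>2"
          by (simp add: power2_eq_square powr_add[symmetric])
        also have "\<dots> \<le> (real R)\<^sup>2" using Rl by (intro power_mono) auto
        finally have "1 / 4 * real K powr \<delta> \<le> (real R)\<^sup>2 / (4 * real \<tau>)" using tau1 by (simp add: field_simps)
        moreover have "b * real K powr \<delta> \<le> 1 / 4 * real K powr \<delta>" using b by (intro mult_right_mono) auto
        ultimately show ?thesis by simp
      qed
      have "tail \<tau> R \<le> 4 * c * real \<tau> powr (D + 1) * exp (- ((real R)\<^sup>2 / (4 * real \<tau>)))"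
        by (rule tail_upper[OF tau1])
      also have "\<dots> \<le> 4 * c * real K powr (D + 1) * exp (- (b * real K powr \<delta>))"
        using e tauK c0 D3 by (intro mult_mono powr_mono2) auto
      finally have "(real \<tau> + 1) * tail \<tau> R \<le> (2 * real K) * (4 * c * real K powr (D + 1) * exp (- (b * real K powr \<delta>)))"
        using tauK K1 c0 by (intro mult_mono) (auto simp: tail_def)
      also have "\<dots> = 8 * c * real K powr (D + 2) * exp (- (b * real K powr \<delta>))"
      proof -
        have "D + 2 = 1 + (D + 1)" by simp
        then have "real K powr (D + 2) = real K * real K powr (D + 1)" using K1 by (simp only: powr_add) simp
        then show ?thesis by simp
      qed
      finally show ?thesis .
    qed
    have Zb: "card (wball x (J * R)) \<le> c * (real J * 2) powr D * real K powr D" if x: "x \<in> carrier G" for x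
    proof -
      have JRpos: "1 \<le> J * R" using J_bounds(1) Rl r1 by (cases "J * R") auto
      have "card (wball x (J * R)) \<le> c * real (J * R) powr D"
        using vol_upper[OF JRpos] card_wball[OF x, of "J * R"] by simp
      also have "real (J * R) powr D \<le> ((real J * 2) * real K) powr D"
      proof (rule powr_mono2)
        have "real R \<le> 2 * real K powr 1"
          by (rule order_trans[OF Ru]) (use K1 \<delta>0 in \<open>intro mult_left_mono powr_mono, auto\<close>)
        then have "real J * real R \<le> real J * (2 * real K)" using K1 by (intro mult_left_mono) auto
        then show "real (J * R) \<le> (real J * 2) * real K" by simp
      qed (use D3 in auto)
      also have "\<dots> = (real J * 2) powr D * real K powr D" by (simp add: powr_mult)
      finally show ?thesis using c0 by (simp add: mult.assoc)
    qed
    have Mb: "exp (- (M / (2 * \<Lambda>))) \<le> exp (- (b * real K powr \<delta>))"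
    proof -
      have "M / (2 * \<Lambda>) = 1 / 2 * real K powr \<delta>"
      proof -
        have "real K powr (2 * \<delta>) = real K powr \<delta> * real K powr \<delta>" by (simp add: powr_add[symmetric])
        then show ?thesis using C(1) K1 by (simp add: M_def \<Lambda>_def)
      qed
      moreover have "b * real K powr \<delta> \<le> 1 / 2 * real K powr \<delta>" using b by (intro mult_right_mono) auto
      ultimately show ?thesis by simp
    qed
    have Hb: "exp (- (\<rho> ^ J * h)) \<le> exp (- (b * real K powr \<delta>))"
    proof -
      have "\<rho> ^ J = real K powr ((1 - 7 * \<delta>) * real J)"
        using K1 by (simp add: \<rho>_def powr_realpow[symmetric] powr_powr)
      then have "\<rho> ^ J * h = c2 * (real K powr ((1 - 7 * \<delta>) * real J) * real K powr (1 - D / 2 - 2 * \<delta>))"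
        by (simp add: h_def)
      also have "real K powr ((1 - 7 * \<delta>) * real J) * real K powr (1 - D / 2 - 2 * \<delta>) = real K powr \<delta>"
      proof -
        have "(1 - 7 * \<delta>) * real J + (1 - D / 2 - 2 * \<delta>) = \<delta>"
          using \<delta>\<gamma> by (simp add: \<gamma>_def algebra_simps)
        then show ?thesis by (simp only: powr_add[symmetric])
      qed
      finally have "\<rho> ^ J * h = c2 * real K powr \<delta>" .
      then show ?thesis using b by (simp add: mult_right_mono)
    qed
    show ?case
    proof (intro allI impI)
      fix N X x s
      assume KN: "K \<le> N" and x: "x \<in> carrier G" and s: "s \<in> S" and X: "finite X" "X \<subseteq> carrier G" "wball x K \<subseteq> X"
      let ?Z = "c * (real J * 2) powr D * real K powr D"
      let ?e = "exp (- (b * real K powr \<delta>))"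
      let ?cZ = "real (card (wball x (J * R)))"
      have ball: "wball x (J * R) \<subseteq> X" using X(3) wball_mono[OF JRK, of x] by auto
      have bnd: "green_iter \<tau> j z u \<le> \<Lambda>" if "1 \<le> j" "j \<le> J" "u \<in> carrier G" "z \<in> carrier G" for j u z
      proof -
        have "green_iter \<tau> j z u \<le> C * real \<tau> powr \<delta>" using that tau1 by (intro C(2)) auto
        also have "\<dots> \<le> \<Lambda>" unfolding \<Lambda>_def using C(1) tauK \<delta>0 by (intro mult_left_mono powr_mono2) auto
        finally show ?thesis .
      qed
      have tail0: "0 \<le> (real \<tau> + 1) * tail \<tau> R" by (simp add: tail_def)
      have Kp: "real K powr D \<le> real K powr (2 * D + 2)" "real K powr 0 \<le> real K powr (2 * D + 2)"
        using K1 D3 by (intro powr_mono; simp)+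
      have Z1: "?cZ * ((real \<tau> + 1) * tail \<tau> R) \<le> c * (real J * 2) powr D * (8 * c) * (real K powr (2 * D + 2) * ?e)"
      proof -
        have "?cZ * ((real \<tau> + 1) * tail \<tau> R) \<le> ?Z * (8 * c * real K powr (D + 2) * ?e)"
          by (rule mult_mono[OF Zb[OF x] tailb]) (use c0 tail0 in auto)
        also have "\<dots> = c * (real J * 2) powr D * (8 * c) * ((real K powr D * real K powr (D + 2)) * ?e)" by simp
        also have "real K powr D * real K powr (D + 2) = real K powr (2 * D + 2)"
          by (simp add: powr_add[symmetric])
        finally show ?thesis .
      qed
      have Z2: "real J * ?cZ * exp (- (M / (2 * \<Lambda>))) \<le> real J * (c * (real J * 2) powr D) * (real K powr (2 * D + 2) * ?e)"
      proof -
        have "?cZ \<le> c * (real J * 2) powr D * real K powr (2 * D + 2)"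
          by (rule order_trans[OF Zb[OF x] mult_left_mono[OF Kp(1)]]) (use c0 in simp)
        then have "real J * ?cZ * exp (- (M / (2 * \<Lambda>))) \<le> real J * (c * (real J * 2) powr D * real K powr (2 * D + 2)) * ?e"
          using Mb c0 by (intro mult_mono mult_left_mono) auto
        then show ?thesis by (simp add: mult.assoc)
      qed
      have Z3: "exp (- (\<rho> ^ J * h)) \<le> 1 * (real K powr (2 * D + 2) * ?e)"
        unfolding mult_1 by (rule order_trans[OF Hb]) (use mult_right_mono[OF Kp(2), of ?e] K1 in simp)
      have "measure_pmf.prob (Omega X N) {\<omega>. \<not> wakes \<omega> x (s \<otimes> x) ((J + 1) * K)}
        \<le> J * (card (wball x (J * R)) * ((real \<tau> + 1) * tail \<tau> R) + J * card (wball x (J * R)) * exp (- (M / (2 * \<Lambda>))))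
         + exp (- (\<rho> ^ J * h))"
        by (rule one_step[OF x tauK KN L0 LM bnd rho1 rho2 h0 hit[OF x s] X(1,2) ball])
      also have "\<dots> \<le> real J * (c * (real J * 2) powr D * (8 * c) * (real K powr (2 * D + 2) * ?e)
         + real J * (c * (real J * 2) powr D) * (real K powr (2 * D + 2) * ?e)) + 1 * (real K powr (2 * D + 2) * ?e)"
        using Z1 Z2 Z3 by (intro add_mono mult_left_mono) auto
      also have "\<dots> = P * real K powr (2 * D + 2) * ?e"
        by (simp add: P_def algebra_simps)
      also have "\<dots> \<le> exp (- (real K powr (\<delta> / 2)))" by (rule elim(5))
      finally show "measure_pmf.prob (Omega X N) {\<omega>. \<not> wakes \<omega> x (s \<otimes> x) ((J + 1) * K)} \<le> exp (- (real K powr (\<delta> / 2)))" .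
    qed
  qed
  moreover have "0 < \<delta> / 2" using \<delta>0 by simp
  ultimately show ?thesis by blast
qed

end

context symmetric_generators
begin

section \<open>The sum of the waiting times along a geodesic\<close>

definition restrict_to :: "'a set \<Rightarrow> ('a \<Rightarrow> 'a list) \<Rightarrow> 'a \<Rightarrow> 'a list" where
  "restrict_to B \<omega> x = (if x \<in> B then \<omega> x else [])"

lemma Omega_res: "finite X \<Longrightarrow> B \<subseteq> X \<Longrightarrow> Omega B N = map_pmf (restrict_to B) (Omega X N)"
  unfolding restrict_to_def[abs_def] by (rule Omega_restrict)

lemma expectation_res:
  fixes F :: "('a \<Rightarrow> 'a list) \<Rightarrow> real"
  assumes "finite X" "B \<subseteq> X"
  shows "measure_pmf.expectation (Omega X N) (\<lambda>\<omega>. F (restrict_to B \<omega>)) = measure_pmf.expectation (Omega B N) F"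
  unfolding Omega_res[OF assms] by simp

lemma prob_res:
  "finite X \<Longrightarrow> B \<subseteq> X \<Longrightarrow>
    measure_pmf.prob (Omega X N) {\<omega>. P (restrict_to B \<omega>)} = measure_pmf.prob (Omega B N) {\<omega>. P \<omega>}"
  unfolding prob_expectation by (rule expectation_res)

lemma wakes_res: "wakes (restrict_to B \<omega>) x y k \<Longrightarrow> wakes \<omega> x y k"
proof (erule wakes_prefix)
  fix z show "\<exists>n. restrict_to B \<omega> z = take n (\<omega> z)"
    by (cases "z \<in> B") (auto simp: restrict_to_def intro: exI[of _ "length (\<omega> z)"] exI[of _ 0])
qed

text \<open>The sets are split off one at a time by \<open>Omega_split\<close>.\<close>

lemma Omega_independent:
  fixes F :: "'i \<Rightarrow> ('a \<Rightarrow> 'a list) \<Rightarrow> real"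
  assumes "finite I" "finite X" "\<And>i. i \<in> I \<Longrightarrow> B i \<subseteq> X"
    and "\<And>i j. i \<in> I \<Longrightarrow> j \<in> I \<Longrightarrow> i \<noteq> j \<Longrightarrow> B i \<inter> B j = {}"
  shows "measure_pmf.expectation (Omega X N) (\<lambda>\<omega>. \<Prod>i\<in>I. F i (restrict_to (B i) \<omega>))
    = (\<Prod>i\<in>I. measure_pmf.expectation (Omega (B i) N) (F i))"
  using assms
proof (induction I arbitrary: X rule: finite_induct)
  case (insert i I)
  have Bi: "B i \<subseteq> X" using insert.prems by auto
  have fin: "finite (B i)" "finite (X - B i)" using Bi insert.prems(1) by (auto intro: finite_subset)
  let ?H = "\<lambda>g. \<Prod>j\<in>I. F j (restrict_to (B j) g)"
  have "measure_pmf.expectation (Omega X N) (\<lambda>\<omega>. \<Prod>j\<in>insert i I. F j (restrict_to (B j) \<omega>))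
    = measure_pmf.expectation (pair_pmf (Omega (B i) N) (Omega (X - B i) N))
        (\<lambda>z. \<Prod>j\<in>insert i I. F j (restrict_to (B j) (merge (B i) (fst z) (snd z))))"
    by (subst Omega_split[OF insert.prems(1) Bi]) (simp add: case_prod_beta)
  also have "\<dots> = measure_pmf.expectation (pair_pmf (Omega (B i) N) (Omega (X - B i) N)) (\<lambda>z. F i (fst z) * ?H (snd z))"
  proof (rule integral_cong_AE)
    show "AE z in pair_pmf (Omega (B i) N) (Omega (X - B i) N).
       (\<Prod>j\<in>insert i I. F j (restrict_to (B j) (merge (B i) (fst z) (snd z)))) = F i (fst z) * ?H (snd z)"
      unfolding AE_measure_pmf_iff
    proof
      fix z assume z: "z \<in> set_pmf (pair_pmf (Omega (B i) N) (Omega (X - B i) N))"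
      have 1: "restrict_to (B i) (merge (B i) (fst z) (snd z)) = fst z"
      proof
        fix u
        have "fst z \<in> set_pmf (Omega (B i) N)" using z by (simp add: mem_Times_iff)
        from in_set_Omega(3)[OF fin(1) this, of u]
        show "restrict_to (B i) (merge (B i) (fst z) (snd z)) u = fst z u" by (simp add: restrict_to_def merge_def)
      qed
      have 2: "restrict_to (B j) (merge (B i) (fst z) (snd z)) = restrict_to (B j) (snd z)" if "j \<in> I" for j
      proof
        fix u
        have "j \<noteq> i" using insert.hyps(2) that by auto
        then have "B j \<inter> B i = {}" using insert.prems(3)[of j i] that by simp
        then show "restrict_to (B j) (merge (B i) (fst z) (snd z)) u = restrict_to (B j) (snd z) u"
          by (auto simp: restrict_to_def merge_def)
      qed
      show "(\<Prod>j\<in>insert i I. F j (restrict_to (B j) (merge (B i) (fst z) (snd z)))) = F i (fst z) * ?H (snd z)"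
        using insert.hyps by (simp add: 1 2)
    qed
  qed auto
  also have "\<dots> = measure_pmf.expectation (Omega (B i) N) (F i) * measure_pmf.expectation (Omega (X - B i) N) ?H"
    by (subst expectation_pair_finite) (auto simp: finite_set_Omega fin)
  also have "measure_pmf.expectation (Omega (X - B i) N) ?H = (\<Prod>j\<in>I. measure_pmf.expectation (Omega (B j) N) (F j))"
  proof (rule insert.IH[OF fin(2)])
    fix j assume "j \<in> I"
    then show "B j \<subseteq> X - B i" using insert.prems(2)[of j] insert.prems(3)[of j i] insert.hyps(2) by auto
  qed (use insert.prems(3) in auto)
  finally show ?case using insert.hyps by simp
qed simp

text \<open>The time needed to wake \<open>y\<close> from \<open>x\<close>, capped at \<open>L\<close>. As \<open>wakes\<close> is monotone in the time, counting
  the failures below \<open>L\<close> gives the first success, and the expectation becomes a sum of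
  probabilities.\<close>

definition wait :: "nat \<Rightarrow> 'a \<Rightarrow> 'a \<Rightarrow> ('a \<Rightarrow> 'a list) \<Rightarrow> nat" where
  "wait L x y \<omega> = card {k. k < L \<and> \<not> wakes \<omega> x y k}"

lemma wait_le: "wait L x y \<omega> \<le> L"
  unfolding wait_def using card_mono[of "{..<L}" "{k. k < L \<and> \<not> wakes \<omega> x y k}"] by auto

lemma wakes_wait:
  assumes "wakes \<omega> x y L"
  shows "wakes \<omega> x y (wait L x y \<omega>)"
proof (rule ccontr)
  let ?Y = "wait L x y \<omega>"
  assume n: "\<not> wakes \<omega> x y ?Y"
  then have "?Y < L" using assms wait_le[of L x y \<omega>] by (cases "?Y = L") auto
  then have "{..?Y} \<subseteq> {k. k < L \<and> \<not> wakes \<omega> x y k}" using n wakes_le[of \<omega> x y _ ?Y] by auto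
  then have "card {..?Y} \<le> ?Y" unfolding wait_def by (rule card_mono[rotated]) simp
  then show False by simp
qed

lemma wait_sum: "real (wait L x y \<omega>) = (\<Sum>k<L. of_bool (\<not> wakes \<omega> x y k))"
proof -
  have "{k. k < L \<and> \<not> wakes \<omega> x y k} = {..<L} \<inter> {k. \<not> wakes \<omega> x y k}" by auto
  then have "real (wait L x y \<omega>) = (\<Sum>k\<in>{..<L} \<inter> {k. \<not> wakes \<omega> x y k}. 1)" by (simp only: wait_def) simp
  also have "\<dots> = (\<Sum>k<L. if \<not> wakes \<omega> x y k then 1 else 0)" by (simp only: sum.inter_restrict[OF finite_lessThan] mem_Collect_eq)
  finally show ?thesis by (simp only: of_bool_def)
qed

lemma expectation_wait:
  assumes "finite X"
  shows "measure_pmf.expectation (Omega X N) (\<lambda>\<omega>. real (wait L x y \<omega>))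
    = (\<Sum>k<L. measure_pmf.prob (Omega X N) {\<omega>. \<not> wakes \<omega> x y k})"
  unfolding wait_sum prob_expectation
  by (rule Bochner_Integration.integral_sum) (intro integrable_measure_pmf_finite finite_set_Omega assms)

text \<open>On the unit interval, \<open>exp u \<le> 1 + 2 u\<close>.\<close>

lemma expectation_exp_wait:
  assumes "finite X" "1 \<le> L" "measure_pmf.expectation (Omega X N) (\<lambda>\<omega>. real (wait L x y \<omega>)) \<le> \<mu>"
  shows "measure_pmf.expectation (Omega X N) (\<lambda>\<omega>. exp (real (wait L x y \<omega>) / real L)) \<le> exp (2 * \<mu> / real L)"
proof -
  have "measure_pmf.expectation (Omega X N) (\<lambda>\<omega>. exp (real (wait L x y \<omega>) / real L))
    \<le> measure_pmf.expectation (Omega X N) (\<lambda>\<omega>. 1 + 2 / real L * real (wait L x y \<omega>))"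
  proof (intro expectation_mono_finite finite_set_Omega assms(1))
    fix \<omega>
    let ?u = "real (wait L x y \<omega>) / real L"
    have u: "0 \<le> ?u" "?u \<le> 1" using wait_le[of L x y \<omega>] assms(2) by auto
    have "exp ?u \<le> 1 + ?u + ?u\<^sup>2" by (rule exp_bound[OF u])
    also have "?u\<^sup>2 \<le> ?u" using u mult_left_mono[of ?u 1 ?u] by (simp add: power2_eq_square)
    finally show "exp ?u \<le> 1 + 2 / real L * real (wait L x y \<omega>)" by simp
  qed
  also have "\<dots> = 1 + 2 / real L * measure_pmf.expectation (Omega X N) (\<lambda>\<omega>. real (wait L x y \<omega>))"
    by (subst Bochner_Integration.integral_add) (auto intro!: integrable_measure_pmf_finite finite_set_Omega assms(1))
  also have "\<dots> \<le> 1 + 2 / real L * \<mu>" using assms(3) by (intro add_left_mono mult_left_mono) auto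
  also have "\<dots> \<le> exp (2 / real L * \<mu>)" by (rule exp_ge_add_one_self)
  finally show ?thesis by simp
qed

text \<open>If the balls met, a path of length at most \<open>2 L\<close> would shorten the geodesic.\<close>

lemma geodesic_disjoint:
  assumes w: "set w \<subseteq> S" and minw: "\<And>w'. set w' \<subseteq> S \<Longrightarrow> endpt \<one> w' = endpt \<one> w \<Longrightarrow> length w \<le> length w'"
    and ij: "i < j" "j \<le> length w" "2 * L < j - i"
  shows "wball (endpt \<one> (take i w)) L \<inter> wball (endpt \<one> (take j w)) L = {}"
proof (rule ccontr)
  let ?x = "endpt \<one> (take i w)" and ?y = "endpt \<one> (take j w)"
  have sub: "set (take i w) \<subseteq> S" "set (take j w) \<subseteq> S" "set (drop j w) \<subseteq> S"
    using w set_take_subset set_drop_subset by fast+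
  have c: "?x \<in> carrier G" "?y \<in> carrier G" using sub by (auto intro: endpt_closed)
  assume "wball ?x L \<inter> wball ?y L \<noteq> {}"
  then obtain z where z: "z \<in> wball ?x L" "z \<in> wball ?y L" by auto
  have "?y \<in> wball z L" by (rule wball_sym[OF c(2) z(2)])
  with z(1) have "?y \<in> wball ?x (L + L)" by (rule wball_trans)
  then obtain l where l: "set l \<subseteq> S" "length l \<le> L + L" "?y = endpt ?x l" by (auto simp: wball_def)
  have "endpt \<one> (take i w @ l @ drop j w) = endpt \<one> (take j w @ drop j w)"
    using l(3) by (simp only: endpt_append)
  then have "endpt \<one> (take i w @ l @ drop j w) = endpt \<one> w" by simp
  then have "length w \<le> length (take i w @ l @ drop j w)" using sub l(1) by (intro minw) auto
  then show False using ij l(2) by simp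
qed

text \<open>Exponential Markov inequality with parameter \<open>1 / L\<close>, for which the capped waiting times have exponents in
  the unit interval.\<close>

lemma class_tail:
  fixes xs :: "nat \<Rightarrow> 'a" and t :: real
  assumes I: "finite I" and X: "finite X" and L: "1 \<le> L"
    and B: "\<And>i. i \<in> I \<Longrightarrow> B i \<subseteq> X" "\<And>i j. i \<in> I \<Longrightarrow> j \<in> I \<Longrightarrow> i \<noteq> j \<Longrightarrow> B i \<inter> B j = {}"
    and mean: "\<And>i. i \<in> I \<Longrightarrow> measure_pmf.expectation (Omega (B i) N) (\<lambda>\<omega>. real (wait L (xs i) (xs (Suc i)) \<omega>)) \<le> \<mu>"
  shows "measure_pmf.prob (Omega X N) {\<omega>. t \<le> (\<Sum>i\<in>I. real (wait L (xs i) (xs (Suc i)) (restrict_to (B i) \<omega>)))}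
     \<le> exp ((2 * \<mu> * card I - t) / L)"
proof -
  let ?Y = "\<lambda>i \<omega>. real (wait L (xs i) (xs (Suc i)) \<omega>)"
  have finB: "finite (B i)" if "i \<in> I" for i using B(1)[OF that] X by (rule finite_subset)
  have "measure_pmf.prob (Omega X N) {\<omega>. t \<le> (\<Sum>i\<in>I. ?Y i (restrict_to (B i) \<omega>))}
     \<le> measure_pmf.expectation (Omega X N) (\<lambda>\<omega>. exp (- (t / L)) * (\<Prod>i\<in>I. exp (?Y i (restrict_to (B i) \<omega>) / L)))"
    unfolding prob_expectation
  proof (intro expectation_mono_finite finite_set_Omega X)
    fix \<omega>
    have e: "exp (- (t / L)) * (\<Prod>i\<in>I. exp (?Y i (restrict_to (B i) \<omega>) / L)) = exp (((\<Sum>i\<in>I. ?Y i (restrict_to (B i) \<omega>)) - t) / L)"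
      by (simp add: exp_sum[OF I, symmetric] sum_divide_distrib[symmetric] exp_add[symmetric] diff_divide_distrib)
    show "of_bool (t \<le> (\<Sum>i\<in>I. ?Y i (restrict_to (B i) \<omega>))) \<le> exp (- (t / L)) * (\<Prod>i\<in>I. exp (?Y i (restrict_to (B i) \<omega>) / L))"
      unfolding e by (cases "t \<le> (\<Sum>i\<in>I. ?Y i (restrict_to (B i) \<omega>))") auto
  qed
  also have "\<dots> = exp (- (t / L)) * measure_pmf.expectation (Omega X N) (\<lambda>\<omega>. \<Prod>i\<in>I. exp (?Y i (restrict_to (B i) \<omega>) / L))"
    by simp
  also have "measure_pmf.expectation (Omega X N) (\<lambda>\<omega>. \<Prod>i\<in>I. exp (?Y i (restrict_to (B i) \<omega>) / L))
     = (\<Prod>i\<in>I. measure_pmf.expectation (Omega (B i) N) (\<lambda>\<omega>. exp (?Y i \<omega> / L)))"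
    by (rule Omega_independent[OF I X B])
  also have "\<dots> \<le> (\<Prod>i\<in>I. exp (2 * \<mu> / L))"
    using expectation_exp_wait[OF finB L mean] by (intro prod_mono) (auto intro: integral_nonneg_AE)
  also have "\<dots> = exp (card I * (2 * \<mu> / L))" by (simp add: exp_of_nat_mult[symmetric])
  finally have "measure_pmf.prob (Omega X N) {\<omega>. t \<le> (\<Sum>i\<in>I. ?Y i (restrict_to (B i) \<omega>))}
     \<le> exp (- (t / L)) * exp (card I * (2 * \<mu> / L))" by simp
  also have "\<dots> = exp ((2 * \<mu> * card I - t) / L)"
    by (simp add: exp_add[symmetric] diff_divide_distrib mult.commute mult.left_commute)
  finally show ?thesis .
qed

lemma wakes_chain:
  assumes "\<And>i. i < m \<Longrightarrow> wakes \<omega> (xs i) (xs (Suc i)) (Y i)"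
  shows "wakes \<omega> (xs 0) (xs m) (\<Sum>i<m. Y i)"
  using assms
proof (induction m)
  case 0 then show ?case by (auto intro: wakes_refl)
next
  case (Suc m) then show ?case using wakes_trans[of \<omega> "xs 0" "xs m" "\<Sum>i<m. Y i" "xs (Suc m)" "Y m"] by auto
qed

text \<open>Unless some waiting time reaches its cap, which costs \<open>n * p0\<close>, the frogs wake each other along the
  geodesic in a total time that is the sum of the waiting times. If the sum is at least \<open>t\<close>, then its part
  in one of the \<open>2 L + 1\<close> residue classes is at least \<open>t / (2 L + 1)\<close>.\<close>

lemma chernoff_geodesic:
  fixes \<mu> p0 :: real and n L :: nat
  assumes x: "x \<in> wball \<one> n" and n: "1 \<le> n" and L: "1 \<le> L" and mu: "0 \<le> \<mu>"
    and mean: "\<And>u s. u \<in> carrier G \<Longrightarrow> s \<in> S \<Longrightarrow>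
        measure_pmf.expectation (Omega (wball u L) L) (\<lambda>\<omega>. real (wait L u (s \<otimes> u) \<omega>)) \<le> \<mu>"
    and fail: "\<And>u s. u \<in> carrier G \<Longrightarrow> s \<in> S \<Longrightarrow>
        measure_pmf.prob (Omega (wball u L) L) {\<omega>. \<not> wakes \<omega> u (s \<otimes> u) L} \<le> p0"
  shows "measure_pmf.prob (Omega (wball \<one> (n + L)) L) {\<omega>. \<not> (\<exists>t. real t < (2 * \<mu> + 1) * n \<and> wakes \<omega> \<one> x t)}
     \<le> n * p0 + (2 * L + 1) * exp ((2 * \<mu> - n / (2 * L + 1)) / L)"
proof -
  let ?Q = "\<lambda>w. set w \<subseteq> S \<and> endpt \<one> w = x"
  obtain w0 where w0: "?Q w0" "length w0 \<le> n" using x by (auto simp: wball_def)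
  define w where "w = arg_min length ?Q"
  have w: "?Q w" and minw: "\<And>w'. ?Q w' \<Longrightarrow> length w \<le> length w'"
    using arg_min_nat_lemma[of ?Q w0 length] w0(1) unfolding w_def by auto
  define m where "m = length w"
  have mn: "m \<le> n" using minw[OF w0(1)] w0(2) by (simp add: m_def)
  define xs where "xs i = endpt \<one> (take i w)" for i
  have wS: "set (take i w) \<subseteq> S" for i using w set_take_subset by fast
  have xsc: "xs i \<in> carrier G" for i unfolding xs_def by (rule endpt_closed[OF one_closed wS])
  have xs0: "xs 0 = \<one>" and xsm: "xs m = x" using w by (auto simp: xs_def m_def)
  have xsS: "w ! i \<in> S" "xs (Suc i) = w ! i \<otimes> xs i" if "i < m" for i
    using that w by (auto simp: xs_def m_def take_Suc_conv_app_nth endpt_append)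
  define B where "B i = wball (xs i) L" for i
  define X where "X = wball \<one> (n + L)"
  have finX: "finite X" by (simp add: X_def finite_wball)
  have BX: "B i \<subseteq> X" if "i < m" for i
  proof
    fix z assume z: "z \<in> B i"
    have "xs i \<in> wball \<one> n" using wS[of i] that mn by (auto simp: xs_def wball_def m_def)
    then show "z \<in> X" using z wball_trans by (auto simp: B_def X_def)
  qed
  define p where "p = 2 * L + 1"
  define Y where "Y i \<omega> = wait L (xs i) (xs (Suc i)) (restrict_to (B i) \<omega>)" for i \<omega>
  define I where "I r = {i. i < m \<and> i mod p = r}" for r
  define t where "t = (2 * \<mu> + 1) * n"
  have meanI: "measure_pmf.expectation (Omega (B i) L) (\<lambda>\<omega>. real (wait L (xs i) (xs (Suc i)) \<omega>)) \<le> \<mu>" if "i < m" for i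
    using mean[OF xsc xsS(1)[OF that], of i] xsS(2)[OF that] by (simp add: B_def)
  have class_bound: "measure_pmf.prob (Omega X L) {\<omega>. t / p \<le> (\<Sum>i\<in>I r. real (Y i \<omega>))} \<le> exp ((2 * \<mu> - n / p) / L)" for r
  proof -
    have "measure_pmf.prob (Omega X L) {\<omega>. t / p \<le> (\<Sum>i\<in>I r. real (Y i \<omega>))} \<le> exp ((2 * \<mu> * card (I r) - t / p) / L)"
      unfolding Y_def
    proof (rule class_tail[OF _ finX L])
      show "B i \<inter> B j = {}" if ij: "i \<in> I r" "j \<in> I r" "i \<noteq> j" for i j
      proof -
        have *: "B i \<inter> B j = {}" if "i \<in> I r" "j \<in> I r" "i < j" for i j
        proof -
          have "p dvd j - i" using that by (auto simp: I_def intro: mod_eq_dvd_iff_nat[THEN iffD1])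
          then have "p \<le> j - i" using that(3) by (intro dvd_imp_le) auto
          then show ?thesis unfolding B_def xs_def using that w minw
            by (intro geodesic_disjoint) (auto simp: I_def m_def p_def)
        qed
        show ?thesis using *[of i j] *[of j i] ij by (cases "i < j") (auto simp: Int_commute)
      qed
    qed (auto simp: I_def BX meanI)
    also have "\<dots> \<le> exp ((2 * \<mu> - n / p) / L)"
    proof -
      have "real (card (I r)) \<le> n / p + 1"
      proof -
        have "card (I r) \<le> m div p + 1" unfolding I_def by (rule card_residue_class)
        then have "real (card (I r)) \<le> real (m div p) + 1" by linarith
        also have "real (m div p) \<le> real m / real p" by (rule of_nat_div_le_of_nat)
        also have "\<dots> \<le> real n / real p" using mn by (simp add: divide_right_mono)
        finally show ?thesis by simp
      qed
      then have "2 * \<mu> * card (I r) \<le> 2 * \<mu> * (n / p + 1)" using mu by (intro mult_left_mono) auto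
      then have "2 * \<mu> * card (I r) - t / p \<le> 2 * \<mu> - n / p"
        by (simp add: t_def algebra_simps add_divide_distrib)
      then show ?thesis by (simp add: divide_right_mono)
    qed
    finally show ?thesis .
  qed
  have "measure_pmf.prob (Omega X L) {\<omega>. \<not> (\<exists>k. real k < t \<and> wakes \<omega> \<one> x k)}
    \<le> measure_pmf.prob (Omega X L) {\<omega>. (\<exists>i\<in>{..<m}. \<not> wakes (restrict_to (B i) \<omega>) (xs i) (xs (Suc i)) L) \<or>
        (\<exists>r\<in>{..<p}. t / p \<le> (\<Sum>i\<in>I r. real (Y i \<omega>)))}"
  proof (rule prob_mono_support, rule ccontr)
    fix \<omega>
    assume nw: "\<not> (\<exists>k. real k < t \<and> wakes \<omega> \<one> x k)"
      and "\<not> ((\<exists>i\<in>{..<m}. \<not> wakes (restrict_to (B i) \<omega>) (xs i) (xs (Suc i)) L) \<or>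
        (\<exists>r\<in>{..<p}. t / p \<le> (\<Sum>i\<in>I r. real (Y i \<omega>))))"
    then have good: "\<And>i. i < m \<Longrightarrow> wakes (restrict_to (B i) \<omega>) (xs i) (xs (Suc i)) L"
      and few: "\<And>r. r < p \<Longrightarrow> (\<Sum>i\<in>I r. real (Y i \<omega>)) < t / p" by (auto simp: not_le)
    have "wakes \<omega> (xs i) (xs (Suc i)) (Y i \<omega>)" if "i < m" for i
      unfolding Y_def by (rule wakes_res[OF wakes_wait[OF good[OF that]]])
    then have "wakes \<omega> \<one> x (\<Sum>i<m. Y i \<omega>)" using wakes_chain[of m \<omega> xs "\<lambda>i. Y i \<omega>"] by (simp add: xs0 xsm)
    moreover have "real (\<Sum>i<m. Y i \<omega>) < t"
    proof -
      have "(\<Sum>i<m. real (Y i \<omega>)) = (\<Sum>r<p. \<Sum>i\<in>{i \<in> {..<m}. i mod p = r}. real (Y i \<omega>))"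
        by (rule sum.group[symmetric]) (auto simp: p_def)
      also have "\<dots> = (\<Sum>r<p. \<Sum>i\<in>I r. real (Y i \<omega>))" by (simp add: I_def)
      also have "\<dots> < (\<Sum>r<p. t / p)"       proof (rule sum_strict_mono)
        show "(\<Sum>i\<in>I r. real (Y i \<omega>)) < t / p" if "r \<in> {..<p}" for r using few that by simp
      qed (auto simp: p_def lessThan_empty_iff)
      also have "\<dots> = t" by (simp add: p_def)
      finally show ?thesis by simp
    qed
    ultimately show False using nw by blast
  qed
  also have "\<dots> \<le> measure_pmf.prob (Omega X L) {\<omega>. \<exists>i\<in>{..<m}. \<not> wakes (restrict_to (B i) \<omega>) (xs i) (xs (Suc i)) L}
      + measure_pmf.prob (Omega X L) {\<omega>. \<exists>r\<in>{..<p}. t / p \<le> (\<Sum>i\<in>I r. real (Y i \<omega>))}"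
    by (rule prob_disj_le)
  also have "measure_pmf.prob (Omega X L) {\<omega>. \<exists>i\<in>{..<m}. \<not> wakes (restrict_to (B i) \<omega>) (xs i) (xs (Suc i)) L} \<le> n * p0"
  proof -
    have p0: "0 \<le> p0"
    proof -
      obtain s where "s \<in> S" using S_ne by auto
      from order_trans[OF measure_nonneg fail[OF one_closed this]] show ?thesis .
    qed
    have "measure_pmf.prob (Omega X L) {\<omega>. \<exists>i\<in>{..<m}. \<not> wakes (restrict_to (B i) \<omega>) (xs i) (xs (Suc i)) L}
      \<le> (\<Sum>i<m. measure_pmf.prob (Omega X L) {\<omega>. \<not> wakes (restrict_to (B i) \<omega>) (xs i) (xs (Suc i)) L})"
      by (rule prob_UN_le) simp
    also have "\<dots> \<le> (\<Sum>i<m. p0)"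
    proof (rule sum_mono)
      fix i assume i: "i \<in> {..<m}"
      have "measure_pmf.prob (Omega X L) {\<omega>. \<not> wakes (restrict_to (B i) \<omega>) (xs i) (xs (Suc i)) L}
         = measure_pmf.prob (Omega (B i) L) {\<omega>. \<not> wakes \<omega> (xs i) (xs (Suc i)) L}"
        using BX i by (intro prob_res finX) auto
      also have "\<dots> \<le> p0" using fail[OF xsc xsS(1), of i i] xsS(2)[of i] i by (simp add: B_def)
      finally show "measure_pmf.prob (Omega X L) {\<omega>. \<not> wakes (restrict_to (B i) \<omega>) (xs i) (xs (Suc i)) L} \<le> p0" .
    qed
    also have "\<dots> \<le> n * p0" using mn p0 by (simp add: mult_right_mono)
    finally show ?thesis .
  qed
  also have "measure_pmf.prob (Omega X L) {\<omega>. \<exists>r\<in>{..<p}. t / p \<le> (\<Sum>i\<in>I r. real (Y i \<omega>))}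
     \<le> (\<Sum>r<p. exp ((2 * \<mu> - n / p) / L))"
    by (rule order_trans[OF prob_UN_le sum_mono]) (auto simp: class_bound)
  also have "\<dots> = (2 * L + 1) * exp ((2 * \<mu> - n / (2 * L + 1)) / L)" by (simp add: p_def)
  finally show ?thesis by (simp add: X_def t_def)
qed

end

context polynomial_growth
begin

section \<open>Linear speed\<close>

text \<open>The times of the form \<open>(J + 1) * K\<close> of \<open>one_step_tail\<close> are replaced by all large times; a smaller exponent
  absorbs the factor \<open>J + 1\<close>.\<close>

lemma neighbour_tail:
  "\<exists>\<kappa>>0. \<exists>k0. \<forall>k\<ge>k0. \<forall>N X x s. k \<le> N \<longrightarrow> x \<in> carrier G \<longrightarrow> s \<in> S \<longrightarrow>
     finite X \<longrightarrow> X \<subseteq> carrier G \<longrightarrow> wball x k \<subseteq> X \<longrightarrow>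
     measure_pmf.prob (Omega X N) {\<omega>. \<not> wakes \<omega> x (s \<otimes> x) k} \<le> exp (- (real k powr \<kappa>))"
proof -
  obtain \<kappa> K0 where \<kappa>: "\<kappa> > 0" and K0': "\<forall>K\<ge>K0. \<forall>N X x s. K \<le> N \<longrightarrow> x \<in> carrier G \<longrightarrow> s \<in> S \<longrightarrow>
     finite X \<longrightarrow> X \<subseteq> carrier G \<longrightarrow> wball x K \<subseteq> X \<longrightarrow>
     measure_pmf.prob (Omega X N) {\<omega>. \<not> wakes \<omega> x (s \<otimes> x) ((J + 1) * K)} \<le> exp (- (real K powr \<kappa>))"
    using one_step_tail unfolding eventually_sequentially by (elim exE conjE)
  note K0 = K0'[rule_format]
  define b where "b = (1 / (2 * (real J + 1))) powr \<kappa>"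
  have b: "0 < b" by (simp add: b_def)
  have "\<forall>\<^sub>F k::nat in sequentially. 1 / b * real k powr (\<kappa> / 2) \<le> real k powr \<kappa>"
    using \<kappa> by (intro eventually_powr_le) auto
  then obtain k1 where k1: "\<And>k. k \<ge> k1 \<Longrightarrow> 1 / b * real k powr (\<kappa> / 2) \<le> real k powr \<kappa>"
    by (auto simp: eventually_sequentially)
  have "measure_pmf.prob (Omega X N) {\<omega>. \<not> wakes \<omega> x (s \<otimes> x) k} \<le> exp (- (real k powr (\<kappa> / 2)))"
    if k: "k \<ge> k1 + (J + 1) * (2 * (K0 + 1))" and N: "k \<le> N" and x: "x \<in> carrier G" "s \<in> S"
      and X: "finite X" "X \<subseteq> carrier G" "wball x k \<subseteq> X" for k N X x s
  proof -
    define K where "K = k div (J + 1)"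
    have Kk: "(J + 1) * K \<le> k" unfolding K_def by (rule times_div_less_eq_dividend)
    have "(J + 1) * (2 * (K0 + 1)) div (J + 1) \<le> K" unfolding K_def using k by (intro div_le_mono) linarith
    then have K2: "2 * (K0 + 1) \<le> K" by (simp only: nonzero_mult_div_cancel_left[of "J + 1"])
    have "k < (J + 1) * (K + 1)"
      using dividend_less_div_times[of "J + 1" k] by (simp add: K_def algebra_simps)
    then have "k \<le> (J + 1) * (2 * K)" proof -
      have "(J + 1) * (K + 1) \<le> (J + 1) * (2 * K)" using K2 by (intro mult_le_mono2) simp
      with \<open>k < (J + 1) * (K + 1)\<close> show ?thesis by linarith
    qed
    then have kK: "real k \<le> (real J + 1) * (2 * real K)"
      by (simp only: of_nat_le_iff[symmetric, where 'a = real]) (simp add: distrib_right)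
    have "measure_pmf.prob (Omega X N) {\<omega>. \<not> wakes \<omega> x (s \<otimes> x) k}
      \<le> measure_pmf.prob (Omega X N) {\<omega>. \<not> wakes \<omega> x (s \<otimes> x) ((J + 1) * K)}"
      by (rule prob_mono_support) (use wakes_le[OF _ Kk] in auto)
    also have "\<dots> \<le> exp (- (real K powr \<kappa>))"
    proof (rule K0[OF _ _ x X(1,2)])
      have "K \<le> k" by (simp add: K_def)
      then show "K \<le> N" "wball x K \<subseteq> X" using N X(3) wball_mono[of K k x] by auto
    qed (use K2 in simp)
    also have "\<dots> \<le> exp (- (real k powr (\<kappa> / 2)))"
    proof -
      have "real k powr (\<kappa> / 2) \<le> b * real k powr \<kappa>" using k1[of k] k b by (simp add: field_simps)
      also have "\<dots> = (1 / (2 * (real J + 1)) * real k) powr \<kappa>" by (simp add: b_def powr_mult[symmetric])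
      also have "\<dots> \<le> real K powr \<kappa>"
        using kK \<kappa> by (intro powr_mono2) (auto simp: field_simps)
      finally show ?thesis by simp
    qed
    finally show ?thesis .
  qed
  moreover have "0 < \<kappa> / 2" using \<kappa> by simp
  ultimately show ?thesis by blast
qed

text \<open>The stretched exponential tail gives a uniform bound \<open>\<mu>\<close> for the mean waiting times. With \<open>L\<close> about the cube
  root of \<open>n\<close>, the Chernoff exponent \<open>n / L\<^sup>2\<close> and the exponent \<open>L powr \<kappa>\<close> for reaching a cap are both powers of \<open>n\<close>.\<close>

lemma linear_speed:
  "\<exists>\<kappa>>0. \<exists>\<alpha>>1::real. \<forall>\<^sub>F n in sequentially. \<exists>L. \<forall>x\<in>wball \<one> n.
     measure_pmf.prob (Omega (wball \<one> (n + L)) L) {\<omega>. \<not> (\<exists>t. real t < \<alpha> * real n \<and> wakes \<omega> \<one> x t)}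
       \<le> exp (- (real n powr \<kappa>))"
proof -
  obtain \<kappa> k0 where \<kappa>: "\<kappa> > 0" and k0': "\<forall>k\<ge>k0. \<forall>N X x s. k \<le> N \<longrightarrow> x \<in> carrier G \<longrightarrow> s \<in> S \<longrightarrow>
     finite X \<longrightarrow> X \<subseteq> carrier G \<longrightarrow> wball x k \<subseteq> X \<longrightarrow>
     measure_pmf.prob (Omega X N) {\<omega>. \<not> wakes \<omega> x (s \<otimes> x) k} \<le> exp (- (real k powr \<kappa>))"
    using neighbour_tail by (elim exE conjE)
  note k0 = k0'[rule_format]
  obtain C1 where C1: "C1 > 0" "\<And>k::nat. k \<ge> 1 \<Longrightarrow> exp (- (1 * real k powr \<kappa>)) \<le> C1 * real k powr (- 2)"
  proof -
    have "\<exists>C>0. \<forall>k::nat\<ge>1. exp (- (1 * real k powr \<kappa>)) \<le> C * real k powr (- 2)"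
      by (rule exp_le_powr[OF zero_less_one \<kappa>])
    then show ?thesis using that by blast
  qed
  have sm: "summable (\<lambda>k::nat. C1 * real k powr (- 2))"
    by (intro summable_mult) (simp add: summable_real_powr_iff)
  \<comment> \<open>The summand \<open>real k0 + 1\<close> pays for the times below the threshold \<open>k0\<close>.\<close>
  define \<mu> where "\<mu> = real k0 + 1 + (\<Sum>k. C1 * real k powr (- 2))"
  have mu0: "0 < \<mu>" using suminf_nonneg[OF sm] C1(1) by (simp add: \<mu>_def add_pos_nonneg)
  have mean: "measure_pmf.expectation (Omega (wball u L) L) (\<lambda>\<omega>. real (wait L u (s \<otimes> u) \<omega>)) \<le> \<mu>"
    if us: "u \<in> carrier G" "s \<in> S" for u s L
  proof -
    let ?p = "\<lambda>k. measure_pmf.prob (Omega (wball u L) L) {\<omega>. \<not> wakes \<omega> u (s \<otimes> u) k}"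
    have "measure_pmf.expectation (Omega (wball u L) L) (\<lambda>\<omega>. real (wait L u (s \<otimes> u) \<omega>)) = (\<Sum>k<L. ?p k)"
      by (rule expectation_wait[OF finite_wball])
    also have "\<dots> \<le> (\<Sum>k<L. of_bool (k < k0 + 1) + C1 * real k powr (- 2))"
    proof (rule sum_mono)
      fix k assume k: "k \<in> {..<L}"
      show "?p k \<le> of_bool (k < k0 + 1) + C1 * real k powr (- 2)"
      proof (cases "k < k0 + 1")
        case True
        then show ?thesis using C1(1) measure_pmf.prob_le_1[of "Omega (wball u L) L" "{\<omega>. \<not> wakes \<omega> u (s \<otimes> u) k}"]
          by (simp add: add_increasing2)
      next
        case False
        have "?p k \<le> exp (- (real k powr \<kappa>))"
          by (rule k0[OF _ _ us finite_wball wball_sub[OF us(1)]]) (use False k wball_mono[of k L u] in auto)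
        also have "\<dots> \<le> C1 * real k powr (- 2)" using C1(2)[of k] False by simp
        finally show ?thesis using False by simp
      qed
    qed
    also have "\<dots> = (\<Sum>k<L. of_bool (k < k0 + 1)) + (\<Sum>k<L. C1 * real k powr (- 2))" by (rule sum.distrib)
    also have "(\<Sum>k<L. of_bool (k < k0 + 1)) \<le> real (k0 + 1)"
    proof -
      have "(\<Sum>k<L. of_bool (k < k0 + 1)) = real (card ({..<L} \<inter> {k. k < k0 + 1}))"
        by (simp add: sum.If_cases of_bool_def)
      also have "\<dots> \<le> real (card {..<k0 + 1})" by (intro of_nat_mono card_mono) auto
      finally show ?thesis by simp
    qed
    also have "(\<Sum>k<L. C1 * real k powr (- 2)) \<le> (\<Sum>k. C1 * real k powr (- 2))"
      using C1(1) by (intro sum_le_suminf sm) auto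
    finally show ?thesis by (simp add: \<mu>_def)
  qed
  define b where "b = (1 / 2) powr \<kappa>"
  \<comment> \<open>\<open>\<kappa> / 3\<close> comes from the caps at \<open>L\<close>, and \<open>1 / 3\<close> from the Chernoff bounds.\<close>
  define \<beta> where "\<beta> = min (1 / 3) (\<kappa> / 3)"
  have b: "0 < b" by (simp add: b_def)
  have \<beta>: "0 < \<beta>" "\<beta> \<le> 1 / 3" "\<beta> \<le> \<kappa> / 3" using \<kappa> by (auto simp: \<beta>_def)
  have F1: "\<forall>\<^sub>F n::nat in sequentially. 2 * real n powr 1 * exp (- (b * real n powr (\<kappa> / 3))) \<le> exp (- (real n powr (\<beta> / 2)))"
    using b \<beta> \<kappa> by (intro eventually_poly_exp_le) auto
  have F2: "\<forall>\<^sub>F n::nat in sequentially. (6 * exp (2 * \<mu>)) * real n powr 1 * exp (- (1 / 3 * real n powr (1 / 3))) \<le> exp (- (real n powr (\<beta> / 2)))"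
    using \<beta> by (intro eventually_poly_exp_le) auto
  have F3: "\<forall>\<^sub>F n::nat in sequentially. (2 * real k0 + 2) * real n powr 0 \<le> real n powr (1 / 3)"
    by (intro eventually_powr_le) auto
  have "\<forall>\<^sub>F n in sequentially. \<exists>L. \<forall>x\<in>wball \<one> n.
     measure_pmf.prob (Omega (wball \<one> (n + L)) L) {\<omega>. \<not> (\<exists>t. real t < (2 * \<mu> + 1) * n \<and> wakes \<omega> \<one> x t)}
       \<le> exp (- (real n powr (\<beta> / 2)))"
    using F1 F2 F3 eventually_ge_at_top[of 1]
  proof eventually_elim
    case (elim n)
    define L where "L = nat \<lfloor>real n powr (1 / 3)\<rfloor>"
    have n3: "2 * real k0 + 2 \<le> real n powr (1 / 3)" using elim(3,4) by simp
    have Lu: "real L \<le> real n powr (1 / 3)" unfolding L_def using n3 by simp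
    have Ll: "real n powr (1 / 3) / 2 \<le> real L" unfolding L_def using n3 by linarith
    have L1: "1 \<le> L" "k0 \<le> L" using Ll n3 by linarith+
    have Ln: "real L \<le> real n"
    proof -
      have "real n powr (1 / 3) \<le> real n powr 1" using elim(4) by (intro powr_mono) auto
      then show ?thesis using Lu elim(4) by simp
    qed
    show ?case
    proof (intro exI[of _ L] ballI)
      fix x assume x: "x \<in> wball \<one> n"
      have "measure_pmf.prob (Omega (wball \<one> (n + L)) L) {\<omega>. \<not> (\<exists>t. real t < (2 * \<mu> + 1) * n \<and> wakes \<omega> \<one> x t)}
         \<le> n * exp (- (real L powr \<kappa>)) + (2 * L + 1) * exp ((2 * \<mu> - n / (2 * L + 1)) / L)"
      proof (rule chernoff_geodesic[OF x elim(4) L1(1) less_imp_le[OF mu0] mean])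
        fix u s assume "u \<in> carrier G" "s \<in> S"
        then show "measure_pmf.prob (Omega (wball u L) L) {\<omega>. \<not> wakes \<omega> u (s \<otimes> u) L} \<le> exp (- (real L powr \<kappa>))"
          by (intro k0[OF L1(2) order_refl _ _ finite_wball wball_sub order_refl])
      qed
      also have "n * exp (- (real L powr \<kappa>)) \<le> 1 / 2 * exp (- (real n powr (\<beta> / 2)))"
      proof -
        have "b * real n powr (\<kappa> / 3) = (real n powr (1 / 3) / 2) powr \<kappa>"
          by (simp add: b_def powr_divide powr_powr)
        also have "\<dots> \<le> real L powr \<kappa>" using Ll \<kappa> by (intro powr_mono2) auto
        finally have "n * exp (- (real L powr \<kappa>)) \<le> n * exp (- (b * real n powr (\<kappa> / 3)))"
          by (intro mult_left_mono) auto
        also have "\<dots> \<le> 1 / 2 * exp (- (real n powr (\<beta> / 2)))" using elim(1,4) by simp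
        finally show ?thesis .
      qed
      also have "(2 * L + 1) * exp ((2 * \<mu> - n / (2 * L + 1)) / L) \<le> 1 / 2 * exp (- (real n powr (\<beta> / 2)))"
      proof -
        have "1 / 3 * real n powr (1 / 3) = n / (3 * real n powr (2 / 3))"
        proof -
          have "real n powr (1 / 3) * real n powr (2 / 3) = real n" using elim(4) by (simp add: powr_add[symmetric])
          then show ?thesis using elim(4) by (simp add: field_simps)
        qed
        also have "\<dots> \<le> n / ((2 * real L + 1) * L)"
        proof (rule divide_left_mono)
          have "(2 * real L + 1) * real L \<le> (3 * real n powr (1 / 3)) * real n powr (1 / 3)"
            using Lu L1 by (intro mult_mono) auto
          also have "\<dots> = 3 * real n powr (2 / 3)" by (simp add: powr_add[symmetric])
          finally show "(2 * real L + 1) * real L \<le> 3 * real n powr (2 / 3)" .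
        qed (use L1 elim(4) in auto)
        finally have quot: "1 / 3 * real n powr (1 / 3) \<le> n / ((2 * real L + 1) * L)" .
        have "2 * \<mu> / L \<le> 2 * \<mu> / 1" using L1 mu0 by (intro divide_left_mono) auto
        moreover have "(2 * \<mu> - n / (2 * L + 1)) / L = 2 * \<mu> / L - n / ((2 * real L + 1) * L)"
          by (simp add: diff_divide_distrib)
        ultimately have "(2 * \<mu> - n / (2 * L + 1)) / L \<le> 2 * \<mu> - 1 / 3 * real n powr (1 / 3)"
          using quot by linarith
        then have "exp ((2 * \<mu> - n / (2 * L + 1)) / L) \<le> exp (2 * \<mu> - 1 / 3 * real n powr (1 / 3))" by simp
        also have "\<dots> = exp (2 * \<mu>) * exp (- (1 / 3 * real n powr (1 / 3)))" by (simp add: exp_add[symmetric])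
        finally have "(2 * real L + 1) * exp ((2 * \<mu> - n / (2 * L + 1)) / L) \<le> (3 * real n) * (exp (2 * \<mu>) * exp (- (1 / 3 * real n powr (1 / 3))))"
          using Ln elim(4) by (intro mult_mono) auto
        also have "\<dots> \<le> 1 / 2 * exp (- (real n powr (\<beta> / 2)))" using elim(2,4) by (simp add: mult.assoc mult.left_commute)
        finally show ?thesis by (simp add: add.commute)
      qed
      finally show "measure_pmf.prob (Omega (wball \<one> (n + L)) L) {\<omega>. \<not> (\<exists>t. real t < (2 * \<mu> + 1) * n \<and> wakes \<omega> \<one> x t)}
         \<le> exp (- (real n powr (\<beta> / 2)))" by simp
    qed
  qed
  moreover have "0 < \<beta> / 2" "1 < 2 * \<mu> + 1" using \<beta> mu0 by auto
  ultimately show ?thesis by (intro exI[of _ "\<beta> / 2"] exI[of _ "2 * \<mu> + 1"] conjI)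
qed

end

section \<open>From the finite model to the frog model\<close>

lemma graph_dist_le_iff: "graph_dist E x y \<le> enat r \<longleftrightarrow> (\<exists>k\<le>r. \<exists>p. is_walk E x y k p)"
proof -
  let ?A = "{k. \<exists>p. is_walk E x y k p}"
  show ?thesis
  proof (cases "?A = {}")
    case True
    then have "graph_dist E x y = \<infinity>" unfolding graph_dist_def True by (simp add: top_enat_def)
    then show ?thesis using True by auto
  next
    case False
    then obtain k0 where "k0 \<in> ?A" by blast
    then have "(INF k\<in>?A. enat k) \<in> enat ` ?A" by (intro wellorder_InfI[of "enat k0"]) auto
    then obtain k where k: "k \<in> ?A" "graph_dist E x y = enat k" by (auto simp: graph_dist_def)
    have upper: "graph_dist E x y \<le> enat j" if "j \<in> ?A" for j
      unfolding graph_dist_def using that by (rule INF_lower)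
    have "graph_dist E x y \<le> enat r \<Longrightarrow> \<exists>k\<le>r. \<exists>p. is_walk E x y k p"
      using k by (auto intro!: exI[of _ k])
    moreover have "graph_dist E x y \<le> enat r" if "j \<le> r" "j \<in> ?A" for j
      by (rule order_trans[OF upper[OF that(2)]]) (simp add: that(1))
    ultimately show ?thesis by blast
  qed
qed

lemma (in group) cayley_ball_empty:
  assumes "x \<in> carrier G"
  shows "cayley_ball G {} x r = {x}"
proof -
  have walk: "is_walk (cayley_edges G {}) x y k p \<longleftrightarrow> k = 0 \<and> p 0 = x \<and> y = x" for y k p
    by (auto simp: is_walk_def cayley_edges_def)
  have "(\<exists>k\<le>r. \<exists>p. is_walk (cayley_edges G {}) x y k p) \<longleftrightarrow> y = x" for y
    unfolding walk by (auto intro: exI[of _ "\<lambda>_. x"])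
  then show ?thesis using assms unfolding cayley_ball_def graph_dist_le_iff by auto
qed

context symmetric_generators
begin

text \<open>An edge can be traversed in both directions since \<open>S\<close> is symmetric.\<close>

lemma walk_endpt:
  assumes "is_walk (cayley_edges G S) x y k p" "x \<in> carrier G"
  shows "y \<in> wball x k"
proof -
  have "p i \<in> wball x i \<and> p i \<in> carrier G" if "i \<le> k" for i
    using that
  proof (induction i)
    case 0
    then show ?case using assms by (auto simp: is_walk_def wball_self)
  next
    case (Suc i)
    then have IH: "p i \<in> wball x i" "p i \<in> carrier G" by auto
    have "{p i, p (Suc i)} \<in> cayley_edges G S" using assms(1) Suc.prems by (auto simp: is_walk_def)
    then obtain s z where sz: "s \<in> S" "z \<in> carrier G" "{p i, p (Suc i)} = {s \<otimes> z, z}"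
      by (auto simp: cayley_edges_def)
    have one: "s \<otimes> z \<in> wball z 1" if "s \<in> S" for s z
      using that unfolding wball_def mem_Collect_eq by (intro exI[of _ "[s]"]) auto
    from sz(3) consider "p i = z" "p (Suc i) = s \<otimes> z" | "p i = s \<otimes> z" "p (Suc i) = z"
      by (auto simp: doubleton_eq_iff)
    then have "p (Suc i) \<in> wball (p i) 1 \<and> p (Suc i) \<in> carrier G"
    proof cases
      case 1 then show ?thesis using sz one[OF sz(1), of z] by (simp add: S_carrier)
    next
      case 2
      have "p (Suc i) = inv s \<otimes> p i" using sz(1,2) unfolding 2 by (simp add: m_assoc[symmetric] S_carrier)
      moreover have "p (Suc i) \<in> carrier G" using sz(2) unfolding 2(2) .
      ultimately show ?thesis using one[OF S_inv[OF sz(1)], of "p i"] by simp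
    qed
    then show ?case using wball_trans[OF IH(1), of "p (Suc i)" 1] by simp
  qed
  then show ?thesis using assms(1) by (auto simp: is_walk_def)
qed

lemma endpt_walk:
  assumes "set l \<subseteq> S" "x \<in> carrier G"
  shows "is_walk (cayley_edges G S) x (endpt x l) (length l) (\<lambda>i. endpt x (take i l))"
  unfolding is_walk_def
proof (intro conjI allI impI)
  fix i assume i: "i < length l"
  have "set (take i l) \<subseteq> S" using assms(1) set_take_subset by fast
  then have c: "endpt x (take i l) \<in> carrier G" using assms(2) by (rule endpt_closed[rotated])
  have "endpt x (take (Suc i) l) = l ! i \<otimes> endpt x (take i l)"
    using i by (simp add: take_Suc_conv_app_nth endpt_append)
  moreover have "l ! i \<in> S" using i assms(1) by auto
  ultimately show "{endpt x (take i l), endpt x (take (Suc i) l)} \<in> cayley_edges G S"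
    using c unfolding cayley_edges_def mem_Collect_eq
    by (intro exI[of _ "l ! i"] exI[of _ "endpt x (take i l)"]) (auto simp: insert_commute)
qed auto

lemma cayley_ball_eq: "x \<in> carrier G \<Longrightarrow> cayley_ball G S x r = wball x r"
proof
  assume x: "x \<in> carrier G"
  show "cayley_ball G S x r \<subseteq> wball x r"
    unfolding cayley_ball_def graph_dist_le_iff by (auto dest!: walk_endpt[OF _ x] intro: subsetD[OF wball_mono])
  show "wball x r \<subseteq> cayley_ball G S x r"
  proof
    fix y assume y: "y \<in> wball x r"
    then obtain l where l: "set l \<subseteq> S" "length l \<le> r" "y = endpt x l" by (auto simp: wball_def)
    have "\<exists>k\<le>r. \<exists>p. is_walk (cayley_edges G S) x y k p"
      using endpt_walk[OF l(1) x] l(2,3) by auto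
    then show "y \<in> cayley_ball G S x r"
      using y wball_sub[OF x] by (auto simp: cayley_ball_def graph_dist_le_iff)
  qed
qed

lemma pmf_steps: "set l \<subseteq> S \<Longrightarrow> length l = N \<Longrightarrow> pmf (steps N) l = (1 / card S) ^ N"
proof (induction N arbitrary: l)
  case (Suc N)
  then obtain s l' where l: "l = s # l'" "s \<in> S" "set l' \<subseteq> S" "length l' = N" by (cases l) auto
  have pe: "pmf p z = measure_pmf.expectation p (\<lambda>y. of_bool (y = z))" for p :: "'a list pmf" and z
    using prob_expectation[of p "\<lambda>y. y = z"] by (simp add: pmf.rep_eq)
  have "pmf (steps (Suc N)) l = (\<Sum>t\<in>S. measure_pmf.expectation (steps N) (\<lambda>k. of_bool (t # k = s # l'))) / card S"
    unfolding pe l(1) by (rule expectation_steps_Suc)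
  also have "(\<Sum>t\<in>S. measure_pmf.expectation (steps N) (\<lambda>k. of_bool (t # k = s # l'))) = (\<Sum>t\<in>S. if t = s then pmf (steps N) l' else 0)"
    by (intro sum.cong) (auto simp: pe)
  also have "\<dots> = (1 / card S) ^ N" using Suc.IH[OF l(3,4)] fin_S l(2) by simp
  finally show ?case by simp
qed simp

lemma pmf_Omega:
  assumes "finite X" "\<And>x. x \<in> X \<Longrightarrow> set (l x) \<subseteq> S \<and> length (l x) = N" "\<And>x. x \<notin> X \<Longrightarrow> l x = []"
  shows "pmf (Omega X N) l = (1 / card S) ^ (N * card X)"
proof -
  have "pmf (Omega X N) l = (\<Prod>x\<in>X. pmf (steps N) (l x))"
    unfolding Omega_def using assms(1,3) by (rule pmf_Pi')
  also have "\<dots> = (\<Prod>x\<in>X. (1 / card S) ^ N)" using assms(2) by (intro prod.cong pmf_steps) auto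
  finally show ?thesis by (simp add: power_mult)
qed

lemma frog_steps_prob:
  assumes "prob_space M" "frog_steps G S M \<xi>" "finite X" "X \<subseteq> carrier G"
    and l: "\<And>x. x \<in> X \<Longrightarrow> set (l x) \<subseteq> S \<and> length (l x) = N"
  shows "{\<omega> \<in> space M. \<forall>x\<in>X. \<forall>i\<in>{1..N}. \<xi> x i \<omega> = l x ! (i - 1)} \<in> sets M"
    and "measure M {\<omega> \<in> space M. \<forall>x\<in>X. \<forall>i\<in>{1..N}. \<xi> x i \<omega> = l x ! (i - 1)} = (1 / card S) ^ (N * card X)"
proof -
  interpret M: prob_space M by fact
  let ?I = "carrier G \<times> {1::nat..}"
  let ?J = "X \<times> {1..N}"
  have iv: "M.indep_vars (\<lambda>_. count_space (carrier G)) (\<lambda>(x, i). \<xi> x i) ?I"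
    and di: "\<And>x i. x \<in> carrier G \<Longrightarrow> i \<ge> 1 \<Longrightarrow>
       distr M (count_space (carrier G)) (\<xi> x i) = uniform_measure (count_space (carrier G)) S"
    using assms(2) by (auto simp: frog_steps_def)
  have me: "\<xi> x i \<in> measurable M (count_space (carrier G))" if "x \<in> carrier G" "i \<ge> 1" for x i
    using iv that unfolding M.indep_vars_def by fastforce
  have J: "?J \<subseteq> ?I" "finite ?J" using assms(3,4) by auto
  let ?E = "{\<omega> \<in> space M. \<forall>x\<in>X. \<forall>i\<in>{1..N}. \<xi> x i \<omega> = l x ! (i - 1)}"
  let ?F = "\<lambda>(x, i). {l x ! (i - 1)}"
  have lS: "l x ! (i - 1) \<in> S" if "(x, i) \<in> ?J" for x i
  proof -
    have "i - 1 < length (l x)" using that l[of x] by auto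
    then show ?thesis using l[of x] that nth_mem by fastforce
  qed
  have single: "measure M (\<xi> x i -` {l x ! (i - 1)} \<inter> space M) = 1 / card S" if xi: "(x, i) \<in> ?J" for x i
  proof -
    have c: "x \<in> carrier G" "1 \<le> i" using xi assms(4) by auto
    have "measure M (\<xi> x i -` {l x ! (i - 1)} \<inter> space M)
       = measure (distr M (count_space (carrier G)) (\<xi> x i)) {l x ! (i - 1)}"
      using lS[OF xi] by (intro measure_distr[symmetric] me c) (auto simp: S_carrier)
    also have "\<dots> = measure (count_space (carrier G)) (S \<inter> {l x ! (i - 1)}) / measure (count_space (carrier G)) S"
      unfolding di[OF c] using S_sub fin_S S_ne lS[OF xi]
      by (intro measure_uniform_measure) (auto simp: emeasure_count_space)
    also have "S \<inter> {l x ! (i - 1)} = {l x ! (i - 1)}" using lS[OF xi] by auto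
    also have "measure (count_space (carrier G)) {l x ! (i - 1)} / measure (count_space (carrier G)) S = 1 / card S"
      using S_sub fin_S lS[OF xi] by (simp add: measure_count_space S_carrier)
    finally show ?thesis .
  qed
  have "?E \<in> sets M \<and> measure M ?E = (1 / card S) ^ (N * card X)"
  proof (cases "?J = {}")
    case True
    then have "?E = space M" and 0: "N * card X = 0" using assms(3) by auto
    then show ?thesis unfolding 0 by (simp add: M.prob_space)
  next
    case False
    have E: "?E = (\<Inter>p\<in>?J. (case p of (x, i) \<Rightarrow> \<xi> x i) -` ?F p \<inter> space M)" using False by auto
    have "(case p of (x, i) \<Rightarrow> \<xi> x i) -` ?F p \<inter> space M \<in> sets M" if "p \<in> ?J" for p
    proof -
      obtain x i where p: "p = (x, i)" by (cases p)
      have "\<xi> x i -` {l x ! (i - 1)} \<inter> space M \<in> sets M"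
        using that assms(4) lS[of x i] unfolding p by (intro measurable_sets[OF me]) (auto simp: S_carrier)
      then show ?thesis by (simp add: p)
    qed
    then have 1: "?E \<in> sets M" unfolding E using J(2) False by (intro sets.finite_INT) auto
    have "measure M ?E = (\<Prod>p\<in>?J. measure M ((case p of (x, i) \<Rightarrow> \<xi> x i) -` ?F p \<inter> space M))"
      unfolding E by (rule M.indep_varsD[OF iv False J(2,1)]) (use lS in \<open>auto simp: S_carrier\<close>)
    also have "\<dots> = (\<Prod>p\<in>?J. 1 / card S)" by (intro prod.cong refl) (use single in auto)
    also have "\<dots> = (1 / card S) ^ (N * card X)" by (simp add: card_cartesian_product mult.commute)
    finally show ?thesis using 1 by simp
  qed
  then show "?E \<in> sets M" "measure M ?E = (1 / card S) ^ (N * card X)" by auto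
qed

text \<open>The good configurations correspond to finitely many disjoint measurable events of known probability that avoid
  \<open>E\<close>, so \<open>E\<close> lies in the complement of their union.\<close>

lemma transfer_bound:
  assumes M: "prob_space M" and fr: "frog_steps G S M \<xi>" and X: "finite X" "X \<subseteq> carrier G"
    and E: "\<And>\<omega> l. \<omega> \<in> space M \<Longrightarrow> Good l \<Longrightarrow> (\<And>x. x \<in> X \<Longrightarrow> set (l x) \<subseteq> S \<and> length (l x) = N) \<Longrightarrow>
      (\<And>x. x \<notin> X \<Longrightarrow> l x = []) \<Longrightarrow> (\<And>x i. x \<in> X \<Longrightarrow> i \<in> {1..N} \<Longrightarrow> \<xi> x i \<omega> = l x ! (i - 1)) \<Longrightarrow> \<omega> \<notin> E"
    and EM: "E \<subseteq> space M"
  shows "measure M E \<le> measure_pmf.prob (Omega X N) {l. \<not> Good l}"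
proof -
  interpret M: prob_space M by fact
  define T where "T = {l \<in> set_pmf (Omega X N). Good l}"
  define A where "A l = {\<omega> \<in> space M. \<forall>x\<in>X. \<forall>i\<in>{1..N}. \<xi> x i \<omega> = l x ! (i - 1)}" for l
  have T: "set (l x) \<subseteq> S \<and> length (l x) = N" if "l \<in> T" "x \<in> X" for l x
    using that in_set_Omega[OF X(1), of l N] by (auto simp: T_def)
  have T': "l y = []" if "l \<in> T" "y \<notin> X" for l y
    using that in_set_Omega(3)[OF X(1), of l N] by (auto simp: T_def)
  have finT: "finite T" using finite_set_Omega[OF X(1), of N] by (simp add: T_def)
  have Am: "A l \<in> sets M" and Ap: "measure M (A l) = pmf (Omega X N) l" if "l \<in> T" for l
    using frog_steps_prob[OF M fr X, of l N] T[OF that] pmf_Omega[OF X(1), of l N] T'[OF that]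
    by (auto simp: A_def)
  have disj: "disjoint_family_on A T"
    unfolding disjoint_family_on_def
  proof (intro ballI impI)
    fix l k assume lk: "l \<in> T" "k \<in> T" "l \<noteq> k"
    show "A l \<inter> A k = {}"
    proof (rule ccontr)
      assume "A l \<inter> A k \<noteq> {}"
      then obtain \<omega> where w: "\<omega> \<in> A l" "\<omega> \<in> A k" by auto
      have "l x = k x" for x
      proof (cases "x \<in> X")
        case True
        show ?thesis
        proof (rule nth_equalityI)
          show "length (l x) = length (k x)" using T[OF lk(1) True] T[OF lk(2) True] by simp
          fix i assume "i < length (l x)"
          then have "Suc i \<in> {1..N}" using T[OF lk(1) True] by auto
          then have "\<xi> x (Suc i) \<omega> = l x ! (Suc i - 1)" "\<xi> x (Suc i) \<omega> = k x ! (Suc i - 1)"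
            using w True unfolding A_def by blast+
          then show "l x ! i = k x ! i" by simp
        qed
      next
        case False then show ?thesis using T'[OF lk(1)] T'[OF lk(2)] by simp
      qed
      then show False using lk(3) by auto
    qed
  qed
  let ?U = "\<Union>l\<in>T. A l"
  have U: "?U \<in> sets M" using finT Am by auto
  have "E \<subseteq> space M - ?U"
  proof
    fix \<omega> assume w: "\<omega> \<in> E"
    have "\<omega> \<notin> A l" if l: "l \<in> T" for l
    proof
      assume a: "\<omega> \<in> A l"
      have "\<omega> \<notin> E"
        by (rule E[of \<omega> l]) (use a l T[OF l] T'[OF l] in \<open>auto simp: A_def T_def\<close>)
      then show False using w by simp
    qed
    then show "\<omega> \<in> space M - ?U" using w EM by auto
  qed
  then have "measure M E \<le> measure M (space M - ?U)" using U by (intro M.finite_measure_mono) auto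
  also have "\<dots> = 1 - measure M ?U" by (rule M.prob_compl[OF U])
  also have "measure M ?U = (\<Sum>l\<in>T. measure M (A l))"
    by (rule M.finite_measure_finite_Union[OF finT _ disj]) (use Am in auto)
  also have "\<dots> = (\<Sum>l\<in>T. pmf (Omega X N) l)" by (simp add: Ap)
  also have "\<dots> = measure_pmf.prob (Omega X N) T" by (rule measure_measure_pmf_finite[OF finT, symmetric])
  also have "\<dots> = measure_pmf.prob (Omega X N) {l. Good l}"
    by (rule measure_prob_cong_0) (auto simp: T_def set_pmf_iff)
  also have "1 - \<dots> = measure_pmf.prob (Omega X N) (space (measure_pmf (Omega X N)) - {l. Good l})"
    by (rule measure_pmf.prob_compl[symmetric]) simp
  also have "space (measure_pmf (Omega X N)) - {l. Good l} = {l. \<not> Good l}" by auto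
  finally show ?thesis .
qed

text \<open>Each hop of the finite model is a visit of the frog walk, hence bounds a hitting time.\<close>

lemma wakes_chain_exists:
  assumes "wakes l x y k" "x \<in> carrier G" "\<And>z. set (l z) \<subseteq> S"
    and walk: "\<And>z n. z \<in> carrier G \<Longrightarrow> n \<le> length (l z) \<Longrightarrow> frog_walk G \<xi> z n \<omega> = endpt z (take n (l z))"
  shows "\<exists>(m::nat) p. 1 \<le> m \<and> p 0 = x \<and> p m = y \<and> (\<forall>i\<le>m. p i \<in> carrier G) \<and>
     (\<Sum>i=1..m. hitting_time G \<xi> (p (i - 1)) (p i) \<omega>) \<le> enat k"
  using assms(1,2)
proof (induction rule: wakes.induct)
  case (wakes_refl y k)
  have "hitting_time G \<xi> y y \<omega> \<le> enat 0"
    unfolding hitting_time_def by (rule INF_lower) simp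
  then have "hitting_time G \<xi> y y \<omega> \<le> enat k" by (rule order_trans) simp
  then show ?case using wakes_refl
    by (intro exI[of _ 1] exI[of _ "\<lambda>_. y"]) simp
next
  case (wakes_step n x y k)
  let ?z = "endpt x (take n (l x))"
  have zc: "?z \<in> carrier G"
    using assms(3)[of x] wakes_step.prems set_take_subset[of n "l x"] by (intro endpt_closed) auto
  then obtain m :: nat and p where mp: "1 \<le> m" "p 0 = ?z" "p m = y" "\<And>i. i \<le> m \<Longrightarrow> p i \<in> carrier G"
    "(\<Sum>i=1..m. hitting_time G \<xi> (p (i - 1)) (p i) \<omega>) \<le> enat k" using wakes_step.IH by auto
  define p' where "p' i = (case i of 0 \<Rightarrow> x | Suc j \<Rightarrow> p j)" for i
  have h: "hitting_time G \<xi> x ?z \<omega> \<le> enat n"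
    unfolding hitting_time_def using walk[OF wakes_step.prems wakes_step.hyps(1)] by (intro INF_lower) simp
  have "(\<Sum>i=1..Suc m. hitting_time G \<xi> (p' (i - 1)) (p' i) \<omega>)
     = (\<Sum>i=0..m. hitting_time G \<xi> (p' i) (p' (Suc i)) \<omega>)"
    using sum.shift_bounds_cl_Suc_ivl[of "\<lambda>i. hitting_time G \<xi> (p' (i - 1)) (p' i) \<omega>" 0 m] by simp
  also have "\<dots> = hitting_time G \<xi> x ?z \<omega> + (\<Sum>i=1..m. hitting_time G \<xi> (p' i) (p' (Suc i)) \<omega>)"
    by (subst sum.atLeast_Suc_atMost) (auto simp: p'_def mp(2))
  also have "(\<Sum>i=1..m. hitting_time G \<xi> (p' i) (p' (Suc i)) \<omega>) = (\<Sum>i=1..m. hitting_time G \<xi> (p (i - 1)) (p i) \<omega>)"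
    by (intro sum.cong) (auto simp: p'_def split: nat.split)
  also have "hitting_time G \<xi> x ?z \<omega> + (\<Sum>i=1..m. hitting_time G \<xi> (p (i - 1)) (p i) \<omega>) \<le> enat n + enat k"
    using h mp(5) by (rule add_mono)
  finally have "(\<Sum>i=1..Suc m. hitting_time G \<xi> (p' (i - 1)) (p' i) \<omega>) \<le> enat (n + k)" by simp
  moreover have "\<forall>i\<le>Suc m. p' i \<in> carrier G" using mp(4) wakes_step.prems by (auto simp: p'_def split: nat.split)
  moreover have "p' 0 = x" "p' (Suc m) = y" using mp by (auto simp: p'_def)
  ultimately show ?case by (intro exI[of _ "Suc m"] exI[of _ p']) auto
qed

lemma wakes_activation:
  assumes "wakes l x y k" "x \<in> carrier G" "\<And>z. set (l z) \<subseteq> S"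
    and "\<And>z n. z \<in> carrier G \<Longrightarrow> n \<le> length (l z) \<Longrightarrow> frog_walk G \<xi> z n \<omega> = endpt z (take n (l z))"
  shows "activation_time G \<xi> x y \<omega> \<le> enat k"
proof -
  have "\<exists>(m::nat) p. 1 \<le> m \<and> p 0 = x \<and> p m = y \<and> (\<forall>i\<le>m. p i \<in> carrier G) \<and>
     (\<Sum>i=1..m. hitting_time G \<xi> (p (i - 1)) (p i) \<omega>) \<le> enat k"
    by (rule wakes_chain_exists[where l = l]) (fact assms)+
  then obtain m :: nat and p where "1 \<le> m" "p 0 = x" "p m = y" "\<forall>i\<le>m. p i \<in> carrier G"
     "(\<Sum>i=1..m. hitting_time G \<xi> (p (i - 1)) (p i) \<omega>) \<le> enat k"
    by (elim exE conjE)
  then show ?thesis unfolding activation_time_def by (intro Inf_lower2) auto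
qed

lemma frog_walk_endpt:
  assumes "\<And>i. i \<in> {1..length w} \<Longrightarrow> \<xi> z i \<omega> = w ! (i - 1)" "n \<le> length w"
  shows "frog_walk G \<xi> z n \<omega> = endpt z (take n w)"
  using assms(2)
proof (induction n)
  case (Suc n)
  then have "frog_walk G \<xi> z (Suc n) \<omega> = w ! n \<otimes> endpt z (take n w)"
    using assms(1)[of "Suc n"] by simp
  also have "\<dots> = endpt z (take (Suc n) w)"
    using Suc.prems by (simp add: take_Suc_conv_app_nth endpt_append)
  finally show ?case .
qed simp

end

theorem proposition2p10:
  fixes G :: "('a, 'b) monoid_scheme"
    and S :: "'a set"
    and D :: real
    and M :: "'w measure"
    and \<xi> :: "'a \<Rightarrow> nat \<Rightarrow> 'w \<Rightarrow> 'a"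
  assumes "group G"
    and "finite S" and "S \<subseteq> carrier G"
    and "\<forall>s\<in>S. inv\<^bsub>G\<^esub> s \<in> S"
    and "generate G S = carrier G"
    and "\<one>\<^bsub>G\<^esub> \<notin> S"
    and "polynomial_growth_rate G S D" and "D \<ge> 3"
    and "prob_space M"
    and "frog_steps G S M \<xi>"
  shows "\<exists>C>0. \<exists>\<kappa>>0. \<exists>\<alpha>>1. \<forall>x\<in>carrier G. \<forall>n::nat. cayley_norm G S x \<le> enat n \<longrightarrow>
           measure M {\<omega> \<in> space M. ereal_of_enat (activation_time G \<xi> \<one>\<^bsub>G\<^esub> x \<omega>) \<ge> ereal (\<alpha> * real n)}
             \<le> C * exp (- (real n powr \<kappa>))"
proof -
  interpret group G by fact
  interpret M: prob_space M by fact
  obtain c where c: "0 < c" and vol: "\<And>x r. x \<in> carrier G \<Longrightarrow> 1 \<le> r \<Longrightarrow>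
      1 / c * real r powr D \<le> card (cayley_ball G S x r) \<and> card (cayley_ball G S x r) \<le> c * real r powr D"
    using assms(7) unfolding polynomial_growth_rate_def by auto
  \<comment> \<open>Without generators all balls are singletons, which contradicts the volume growth.\<close>
  have "S \<noteq> {}"
  proof
    assume "S = {}"
    define r where "r = nat \<lceil>c\<rceil> + 1"
    have r: "1 \<le> r" "c < real r" unfolding r_def by (auto, linarith)
    have "1 / c * real r powr D \<le> 1"
      using vol[of "\<one>\<^bsub>G\<^esub>" r] r(1) cayley_ball_empty[of "\<one>\<^bsub>G\<^esub>" r] \<open>S = {}\<close> by simp
    then have "real r powr D \<le> c" using c by (simp add: field_simps)
    moreover have "real r powr 1 \<le> real r powr D" using r assms(8) by (intro powr_mono) auto
    ultimately show False using r by simp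
  qed
  then interpret SG: symmetric_generators G S
    using assms by unfold_locales auto
  interpret PG: polynomial_growth G S D c
    using assms(8) c vol[of "\<one>\<^bsub>G\<^esub>"] SG.cayley_ball_eq[of "\<one>\<^bsub>G\<^esub>"] by unfold_locales auto
  obtain \<kappa> \<alpha> where \<kappa>: "0 < \<kappa>" and \<alpha>: "1 < \<alpha>" and ev: "\<forall>\<^sub>F n in sequentially. \<exists>L. \<forall>x\<in>SG.wball \<one>\<^bsub>G\<^esub> n.
     measure_pmf.prob (SG.Omega (SG.wball \<one>\<^bsub>G\<^esub> (n + L)) L) {l. \<not> (\<exists>t. real t < \<alpha> * real n \<and> SG.wakes l \<one>\<^bsub>G\<^esub> x t)}
       \<le> exp (- (real n powr \<kappa>))"
    using PG.linear_speed by (elim exE conjE)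
  obtain n0 where n0: "\<forall>n\<ge>n0. \<exists>L. \<forall>x\<in>SG.wball \<one>\<^bsub>G\<^esub> n.
     measure_pmf.prob (SG.Omega (SG.wball \<one>\<^bsub>G\<^esub> (n + L)) L) {l. \<not> (\<exists>t. real t < \<alpha> * real n \<and> SG.wakes l \<one>\<^bsub>G\<^esub> x t)}
       \<le> exp (- (real n powr \<kappa>))"
    using ev unfolding eventually_sequentially by (elim exE)
  \<comment> \<open>This constant makes the bound trivial for \<open>n < n0\<close>.\<close>
  define C where "C = exp (real n0 powr \<kappa>)"
  have C1: "1 \<le> C" by (simp add: C_def)
  have main: "measure M {\<omega> \<in> space M. ereal_of_enat (activation_time G \<xi> \<one>\<^bsub>G\<^esub> x \<omega>) \<ge> ereal (\<alpha> * real n)}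
             \<le> C * exp (- (real n powr \<kappa>))"
    if x: "x \<in> carrier G" and xn: "cayley_norm G S x \<le> enat n" for x n
  proof (cases "n0 \<le> n")
    case False
    have "real n powr \<kappa> \<le> real n0 powr \<kappa>" using False \<kappa> by (intro powr_mono2) auto
    then have "1 \<le> C * exp (- (real n powr \<kappa>))" by (simp add: C_def exp_add[symmetric])
    then show ?thesis by (rule order_trans[OF M.prob_le_1])
  next
    case True
    let ?E = "{\<omega> \<in> space M. ereal_of_enat (activation_time G \<xi> \<one>\<^bsub>G\<^esub> x \<omega>) \<ge> ereal (\<alpha> * real n)}"
    have xw: "x \<in> SG.wball \<one>\<^bsub>G\<^esub> n"
      using x xn SG.cayley_ball_eq[of "\<one>\<^bsub>G\<^esub>" n] by (auto simp: cayley_ball_def cayley_norm_def)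
    obtain L where L: "measure_pmf.prob (SG.Omega (SG.wball \<one>\<^bsub>G\<^esub> (n + L)) L)
        {l. \<not> (\<exists>t. real t < \<alpha> * real n \<and> SG.wakes l \<one>\<^bsub>G\<^esub> x t)} \<le> exp (- (real n powr \<kappa>))"
    proof -
      from n0 True obtain L where "\<forall>x\<in>SG.wball \<one>\<^bsub>G\<^esub> n.
         measure_pmf.prob (SG.Omega (SG.wball \<one>\<^bsub>G\<^esub> (n + L)) L) {l. \<not> (\<exists>t. real t < \<alpha> * real n \<and> SG.wakes l \<one>\<^bsub>G\<^esub> x t)}
           \<le> exp (- (real n powr \<kappa>))" by (elim allE[of _ n] impE exE)
      from bspec[OF this xw] show ?thesis by (rule that)
    qed
    have "measure M ?E \<le> measure_pmf.prob (SG.Omega (SG.wball \<one>\<^bsub>G\<^esub> (n + L)) L)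
        {l. \<not> (\<exists>t. real t < \<alpha> * real n \<and> SG.wakes l \<one>\<^bsub>G\<^esub> x t)}"
    proof (rule SG.transfer_bound[OF assms(9,10) SG.finite_wball SG.wball_sub])
      fix \<omega> l
      assume "\<exists>t. real t < \<alpha> * real n \<and> SG.wakes l \<one>\<^bsub>G\<^esub> x t"
        and l: "\<And>x. x \<in> SG.wball \<one>\<^bsub>G\<^esub> (n + L) \<Longrightarrow> set (l x) \<subseteq> S \<and> length (l x) = L"
          "\<And>x. x \<notin> SG.wball \<one>\<^bsub>G\<^esub> (n + L) \<Longrightarrow> l x = []"
          "\<And>x i. x \<in> SG.wball \<one>\<^bsub>G\<^esub> (n + L) \<Longrightarrow> i \<in> {1..L} \<Longrightarrow> \<xi> x i \<omega> = l x ! (i - 1)"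
      then obtain t where t: "real t < \<alpha> * real n" "SG.wakes l \<one>\<^bsub>G\<^esub> x t" by auto
      have lS: "set (l z) \<subseteq> S" for z using l(1,2)[of z] by (cases "z \<in> SG.wball \<one>\<^bsub>G\<^esub> (n + L)") auto
      have "activation_time G \<xi> \<one>\<^bsub>G\<^esub> x \<omega> \<le> enat t"
      proof (rule SG.wakes_activation[OF t(2) one_closed lS])
        fix z m assume "z \<in> carrier G" and m: "m \<le> length (l z)"
        show "frog_walk G \<xi> z m \<omega> = SG.endpt z (take m (l z))"
        proof (rule SG.frog_walk_endpt[OF _ m])
          fix i assume "i \<in> {1..length (l z)}"
          then show "\<xi> z i \<omega> = l z ! (i - 1)"
            using l(1)[of z] l(2)[of z] l(3)[of z i] by (cases "z \<in> SG.wball \<one>\<^bsub>G\<^esub> (n + L)") auto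
        qed
      qed
      then have "ereal_of_enat (activation_time G \<xi> \<one>\<^bsub>G\<^esub> x \<omega>) \<le> ereal_of_enat (enat t)"
        by (simp only: ereal_of_enat_le_iff)
      also have "\<dots> < ereal (\<alpha> * real n)" using t(1) by simp
      finally show "\<omega> \<notin> ?E" by (simp add: not_le)
    qed auto
    also have "\<dots> \<le> exp (- (real n powr \<kappa>))" by (rule L)
    also have "\<dots> \<le> C * exp (- (real n powr \<kappa>))" using C1 by simp
    finally show ?thesis .
  qed
  have "0 < C" by (simp add: C_def)
  then show ?thesis using \<kappa> \<alpha>
    by (intro exI[of _ C] exI[of _ \<kappa>] exI[of _ \<alpha>] conjI ballI allI impI main)
qed

end
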